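(* Let $n,m\ge 0$ be integers and $\nu,\mu,\lambda$ partitions with $\ell(\nu)\le n$, $\ell(\mu)\le m$ and $\lambda_{n+1}<m+1$. With the notation of the context ($\chi^{n,m}_{\mu,\nu,\lambda}(q)$, $r$, $N_j$, $M_i$, $P_i$, $Q_j$), the generating function $\chi^{n,m}_{\mu,\nu,\lambda}(q)$ equals \[ \frac{(-1)^{mn-r}q^{\Delta^{m,n}_{\mu,\nu,\lambda}}}{(q)_\infty^{m+n}}\det\begin{pmatrix} \left(\sum_{a\geq 0}(-1)^a q^{\binom{a+1}2}q^{(N_j-M_i)a}\right)_{\substack{1 \leq i \leq m\\ 1 \leq j \leq n}} & \left(q^{-M_iQ_{j}}\right)_{\substack{1 \leq i \leq m\\ 1 \leq j \leq m-r}}\\ \left(q^{-N_j(P_{i}+1)}\right)_{\substack{1 \leq i \leq n-r\\ 1 \leq j \leq n}} & 0 \end{pmatrix}, \] a determinant of a block matrix of size $(m+n-r)\times(m+n-r)$ (the lower right block is the zero $(n-r)\times(m-r)$ matrix), where $\Delta^{m,n}_{\mu,\nu,\lambda}=\sum_{j=1}^{m-r}M_jQ_j+\sum_{i=1}^{n-r}N_i(P_i+1)$.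
   Context: Partitions are weakly decreasing sequences of nonnegative integers with finitely many nonzero parts; $\lambda_k=0$ for $k>\ell(\lambda)$, $\lambda'$ is the transposed partition, and $(i,j)\in\lambda$ means $1\le j\le\lambda_i$. Let $\mathcal{A}$ be the set of arrays $a=(a_{i,j})_{i,j\ge1}$ with entries in $\mathbb{Z}_{\ge0}\cup\{\infty\}$ such that $a_{i,j}\ge a_{i+1,j}$ and $a_{i,j}\ge a_{i,j+1}$ for all $i,j$; $a_{n+1,m+1}=0$; for each $i$, $a_{i,j}=\nu_i$ for all sufficiently large $j$; for each $j$, $a_{i,j}=\mu_j$ for all sufficiently large $i$; and $a_{i,j}=\infty$ if and only if $(i,j)\in\lambda$. The weight of $a$ is \[|a|=\sum_{i-n\le j-m,\ (i,j)\notin\lambda}(a_{i,j}-\nu_i)+\sum_{i-n>j-m,\ (i,j)\notin\lambda}(a_{i,j}-\mu_j),\] and $\chi^{n,m}_{\mu,\nu,\lambda}(q)=\sum_{a\in\mathcal{A}}q^{|a|}$ (formal power series in $q$). Let $(q)_\infty=\prod_{k\ge1}(1-q^k)$. Let $r=\min\{t\ge 0\mid \lambda_{n-t}\ge m-t\}$ with the convention $\lambda_0=+\infty$, so $0\le r\le\min(n,m)$. Define $\pi_i=\lambda_i-(m-r)$ for $1\le i\le n-r$ and $\kappa_j=\lambda'_j-(n-r)$ for $1\le j\le m-r$, and set $N_i=\nu_i+n-i$ ($1\le i\le n$), $M_j=\mu_j+m-j$ ($1\le j\le m$), $P_i=\pi_i+(n-r)-i$ ($1\le i\le n-r$), $Q_j=\kappa_j+(m-r)-j$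 ($1\le j\le m-r$). The entries $\sum_{a\ge0}(-1)^aq^{\binom{a+1}{2}+(N_j-M_i)a}$ are formal Laurent series in $q$. *)

theory Defs
  imports
    "HOL-Analysis.Infinite_Sum"
    "HOL-Analysis.Infinite_Products"
    "HOL-Library.Extended_Nat"
    "HOL-Library.FuncSet"
    "HOL-Computational_Algebra.Formal_Laurent_Series"
    "Jordan_Normal_Form.Determinant"
begin

section \<open>Partitions\<close>

text \<open>Sequences are indexed from 1; the value at index 0 is never used.\<close>

definition is_partition :: "(nat \<Rightarrow> nat) \<Rightarrow> bool" where
  "is_partition p \<longleftrightarrow> (\<forall>i\<ge>1. p (Suc i) \<le> p i) \<and> finite {i. 1 \<le> i \<and> p i \<noteq> 0}"

definition part_length :: "(nat \<Rightarrow> nat) \<Rightarrow> nat" where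
  "part_length p = card {i. 1 \<le> i \<and> p i \<noteq> 0}"

definition part_transpose :: "(nat \<Rightarrow> nat) \<Rightarrow> nat \<Rightarrow> nat" where
  "part_transpose p j = card {i. 1 \<le> i \<and> j \<le> p i}"

definition diagram :: "(nat \<Rightarrow> nat) \<Rightarrow> (nat \<times> nat) set" where
  "diagram p = {(i, j). 1 \<le> i \<and> 1 \<le> j \<and> j \<le> p i}"


section \<open>Plane partitions with asymptotics and their generating function\<close>

text \<open>Arrays are extensional functions on pairs of positive indices, so that each array is
  represented by exactly one function.\<close>

definition arrays ::
  "nat \<Rightarrow> nat \<Rightarrow> (nat \<Rightarrow> nat) \<Rightarrow> (nat \<Rightarrow> nat) \<Rightarrow> (nat \<Rightarrow> nat) \<Rightarrow> (nat \<times> nat \<Rightarrow> enat) set" where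
  "arrays n m \<mu> \<nu> \<Lambda> =
    {a \<in> ({1..} \<times> {1..}) \<rightarrow>\<^sub>E UNIV.
       (\<forall>i\<ge>1. \<forall>j\<ge>1. a (i, j) \<ge> a (Suc i, j) \<and> a (i, j) \<ge> a (i, Suc j)) \<and>
       a (n + 1, m + 1) = 0 \<and>
       (\<forall>i\<ge>1. \<forall>\<^sub>F j in sequentially. a (i, j) = enat (\<nu> i)) \<and>
       (\<forall>j\<ge>1. \<forall>\<^sub>F i in sequentially. a (i, j) = enat (\<mu> j)) \<and>
       (\<forall>i\<ge>1. \<forall>j\<ge>1. a (i, j) = \<infinity> \<longleftrightarrow> (i, j) \<in> diagram \<Lambda>)}"

definition upper_cells :: "nat \<Rightarrow> nat \<Rightarrow> (nat \<Rightarrow> nat) \<Rightarrow> (nat \<times> nat) set" where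
  "upper_cells n m \<Lambda> =
    {(i, j). 1 \<le> i \<and> 1 \<le> j \<and> int i - int n \<le> int j - int m \<and> (i, j) \<notin> diagram \<Lambda>}"

definition lower_cells :: "nat \<Rightarrow> nat \<Rightarrow> (nat \<Rightarrow> nat) \<Rightarrow> (nat \<times> nat) set" where
  "lower_cells n m \<Lambda> =
    {(i, j). 1 \<le> i \<and> 1 \<le> j \<and> int i - int n > int j - int m \<and> (i, j) \<notin> diagram \<Lambda>}"

definition weight ::
  "nat \<Rightarrow> nat \<Rightarrow> (nat \<Rightarrow> nat) \<Rightarrow> (nat \<Rightarrow> nat) \<Rightarrow> (nat \<Rightarrow> nat) \<Rightarrow> (nat \<times> nat \<Rightarrow> enat) \<Rightarrow> int" where
  "weight n m \<mu> \<nu> \<Lambda> a =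
     (\<Sum>\<^sub>\<infinity>(i, j)\<in>upper_cells n m \<Lambda>. int (the_enat (a (i, j))) - int (\<nu> i)) +
     (\<Sum>\<^sub>\<infinity>(i, j)\<in>lower_cells n m \<Lambda>. int (the_enat (a (i, j))) - int (\<mu> j))"

definition chi ::
  "nat \<Rightarrow> nat \<Rightarrow> (nat \<Rightarrow> nat) \<Rightarrow> (nat \<Rightarrow> nat) \<Rightarrow> (nat \<Rightarrow> nat) \<Rightarrow> rat fps" where
  "chi n m \<mu> \<nu> \<Lambda> = (\<Sum>\<^sub>\<infinity>a\<in>arrays n m \<mu> \<nu> \<Lambda>. fps_X ^ nat (weight n m \<mu> \<nu> \<Lambda> a))"


section \<open>The determinantal formula\<close>

definition q_inf :: "rat fps" where
  "q_inf = (\<Prod>k. 1 - fps_X ^ Suc k)"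

text \<open>The disjunct \<open>n \<le> t\<close> encodes the convention that the zeroth part is infinite.\<close>

definition diag_r :: "nat \<Rightarrow> nat \<Rightarrow> (nat \<Rightarrow> nat) \<Rightarrow> nat" where
  "diag_r n m \<Lambda> = (LEAST t. n \<le> t \<or> int (\<Lambda> (n - t)) \<ge> int m - int t)"

definition N_co :: "nat \<Rightarrow> (nat \<Rightarrow> nat) \<Rightarrow> nat \<Rightarrow> int" where
  "N_co n \<nu> i = int (\<nu> i) + int n - int i"

definition M_co :: "nat \<Rightarrow> (nat \<Rightarrow> nat) \<Rightarrow> nat \<Rightarrow> int" where
  "M_co m \<mu> j = int (\<mu> j) + int m - int j"

definition pi_part :: "nat \<Rightarrow> nat \<Rightarrow> (nat \<Rightarrow> nat) \<Rightarrow> nat \<Rightarrow> int" where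
  "pi_part n m \<Lambda> i = int (\<Lambda> i) - (int m - int (diag_r n m \<Lambda>))"

definition kappa_part :: "nat \<Rightarrow> nat \<Rightarrow> (nat \<Rightarrow> nat) \<Rightarrow> nat \<Rightarrow> int" where
  "kappa_part n m \<Lambda> j = int (part_transpose \<Lambda> j) - (int n - int (diag_r n m \<Lambda>))"

definition P_co :: "nat \<Rightarrow> nat \<Rightarrow> (nat \<Rightarrow> nat) \<Rightarrow> nat \<Rightarrow> int" where
  "P_co n m \<Lambda> i = pi_part n m \<Lambda> i + (int n - int (diag_r n m \<Lambda>)) - int i"

definition Q_co :: "nat \<Rightarrow> nat \<Rightarrow> (nat \<Rightarrow> nat) \<Rightarrow> nat \<Rightarrow> int" where
  "Q_co n m \<Lambda> j = kappa_part n m \<Lambda> j + (int m - int (diag_r n m \<Lambda>)) - int j"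

definition Delta ::
  "nat \<Rightarrow> nat \<Rightarrow> (nat \<Rightarrow> nat) \<Rightarrow> (nat \<Rightarrow> nat) \<Rightarrow> (nat \<Rightarrow> nat) \<Rightarrow> int" where
  "Delta n m \<mu> \<nu> \<Lambda> =
     (\<Sum>j=1..m - diag_r n m \<Lambda>. M_co m \<mu> j * Q_co n m \<Lambda> j) +
     (\<Sum>i=1..n - diag_r n m \<Lambda>. N_co n \<nu> i * (P_co n m \<Lambda> i + 1))"

definition theta_entry :: "int \<Rightarrow> rat fls" where
  "theta_entry d = (\<Sum>a. (-1) ^ a * fls_X powi (int ((a + 1) choose 2) + d * int a))"

text \<open>Matrix indices start at 0, hence the successors.\<close>

definition block_matrix ::
  "nat \<Rightarrow> nat \<Rightarrow> (nat \<Rightarrow> nat) \<Rightarrow> (nat \<Rightarrow> nat) \<Rightarrow> (nat \<Rightarrow> nat) \<Rightarrow> rat fls mat" where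
  "block_matrix n m \<mu> \<nu> \<Lambda> =
    (let r = diag_r n m \<Lambda>; N = N_co n \<nu>; M = M_co m \<mu>; P = P_co n m \<Lambda>; Q = Q_co n m \<Lambda> in
     four_block_mat
       (mat m n (\<lambda>(i, j). theta_entry (N (Suc j) - M (Suc i))))
       (mat m (m - r) (\<lambda>(i, j). fls_X powi (- (M (Suc i) * Q (Suc j)))))
       (mat (n - r) n (\<lambda>(i, j). fls_X powi (- (N (Suc j) * (P (Suc i) + 1)))))
       (0\<^sub>m (n - r) (m - r)))"


section \<open>Well-definedness\<close>

text \<open>The infinite sums and products above all converge, \<^term>\<open>weight\<close> is nonnegative on the
  arrays, and the truncated subtractions \<open>n - r\<close>, \<open>m - r\<close> are harmless.\<close>


lemma fls_summableI:
  fixes F :: "nat \<Rightarrow> 'a::ab_group_add fls"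
  assumes "\<And>N. \<forall>\<^sub>F a in sequentially. \<forall>k<N. fls_nth (F a) k = 0"
  shows "summable F"
proof -
  have "\<forall>N. \<exists>A. \<forall>a\<ge>A. \<forall>k<N. fls_nth (F a) k = 0"
    using assms by (simp add: eventually_sequentially)
  then obtain A where A: "\<And>N a k. A N \<le> a \<Longrightarrow> k < N \<Longrightarrow> fls_nth (F a) k = 0"
    by metis
  define s where "s k = (\<Sum>a<A (k + 1). fls_nth (F a) k)" for k
  have s: "(\<Sum>a<n. fls_nth (F a) k) = s k" if "A N \<le> n" "k < N" for n N k
    unfolding s_def using A[of N _ k] A[of "k + 1" _ k] that
    by (intro sum.mono_neutral_cong) (auto simp: not_less)
  define L where "L = Min (insert 0 (fls_subdegree ` F ` {..<A 0}))"
  have "s k = 0" if "k < L" for k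
  proof -
    have "k < 0" using that by (simp add: L_def)
    then have "s k = (\<Sum>a<A 0. fls_nth (F a) k)" using s[of 0 "A 0" k] by simp
    also have "\<dots> = 0"
    proof (rule sum.neutral, safe)
      fix a assume "a < A 0"
      then have "k < fls_subdegree (F a)" using that by (auto simp: L_def)
      then show "fls_nth (F a) k = 0" by simp
    qed
    finally show ?thesis .
  qed
  then have S: "fls_nth (Abs_fls s) = s" by (intro ext nth_Abs_fls_lower_bound) blast
  have "(\<lambda>n. \<Sum>a<n. F a) \<longlonglongrightarrow> Abs_fls s"
  proof (rule metric_LIMSEQ_I)
    fix r :: real assume "r > 0"
    then obtain N where "(1 / 2) ^ N < r" using reals_power_lt_ex[of r 2] by auto
    then have N: "inverse (2 ^ N) < r" by (simp add: power_one_over inverse_eq_divide)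
    have "dist (\<Sum>a<n. F a) (Abs_fls s) < r" if n: "A (int N) \<le> n" for n
    proof (cases "(\<Sum>a<n. F a) = Abs_fls s")
      case False
      have "fls_subdegree ((\<Sum>a<n. F a) - Abs_fls s) \<ge> int N"
        by (rule fls_subdegree_geI)
          (use False s[OF n] in \<open>auto simp: S fls_nth_sum\<close>)
      then have "dist (\<Sum>a<n. F a) (Abs_fls s) \<le> inverse (2 ^ N)"
        using False by (auto simp: dist_fls_def intro!: power_increasing)
      with N show ?thesis by simp
    qed (use \<open>r > 0\<close> in simp)
    then show "\<exists>no. \<forall>n\<ge>no. dist (\<Sum>a<n. F a) (Abs_fls s) < r" by blast
  qed
  then show ?thesis unfolding summable_def sums_def by blast
qed

lemma fls_X_powi: "fls_X powi e = (fls_shift (- e) 1 :: 'a::field fls)"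
proof (cases "e \<ge> 0")
  case True
  then show ?thesis by (simp add: power_int_def fls_X_power_conv_shift_1)
next
  case False
  then show ?thesis by (simp add: power_int_def fls_inverse_X fls_X_inv_power_conv_shift_1)
qed

lemma summable_theta_entry:
  "summable (\<lambda>a. (-1) ^ a * fls_X powi (int ((a + 1) choose 2) + d * int a) :: rat fls)"
proof (rule fls_summableI)
  fix N :: int
  have "fls_nth ((-1) ^ a * fls_X powi (int ((a + 1) choose 2) + d * int a) :: rat fls) k = 0"
    if a: "nat (2 * max N 0 + 2 * \<bar>d\<bar>) \<le> a" and k: "k < N" for a k
  proof -
    let ?e = "int ((a + 1) choose 2) + d * int a"
    have "2 * ((a + 1) choose 2) = a * (a + 1)" by (simp add: choose_two)
    then have "int (2 * ((a + 1) choose 2)) = int (a * (a + 1))" by (rule arg_cong)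
    then have "2 * ?e = int a * (int a + 1 + 2 * d)" by (simp add: algebra_simps)
    moreover have "2 * max N 0 * 1 \<le> int a * (int a + 1 + 2 * d)"
      by (rule mult_mono) (use a in linarith)+
    ultimately have "2 * max N 0 \<le> 2 * ?e" by (simp only: mult_1_right)
    then have "k < ?e" using k by (simp only: mult_le_cancel_left_pos)
    then show ?thesis by (cases "even a") (simp_all add: fls_X_powi)
  qed
  then show "\<forall>\<^sub>F a in sequentially. \<forall>k<N.
      fls_nth ((-1) ^ a * fls_X powi (int ((a + 1) choose 2) + d * int a) :: rat fls) k = 0"
    unfolding eventually_sequentially by blast
qed

lemma convergent_q_inf: "convergent_prod (\<lambda>k. 1 - fps_X ^ Suc k :: rat fps)"
proof -
  let ?P = "\<lambda>n. \<Prod>i\<le>n. 1 - fps_X ^ Suc i :: rat fps"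
  have step: "fps_nth (?P (Suc n)) k = fps_nth (?P n) k" if "k \<le> n" for n k
    using that by (simp add: algebra_simps fps_X_power_mult_nth fps_X_power_mult_right_nth del: power_Suc)
  have eq: "fps_nth (?P n) k = fps_nth (?P k) k" if "k \<le> n" for n k
    using that by (induction n rule: dec_induct) (simp_all only: step)
  let ?p = "Abs_fps (\<lambda>k. fps_nth (?P k) k)"
  have "?P \<longlonglongrightarrow> ?p"
  proof (rule tendsto_fpsI)
    fix k show "\<forall>\<^sub>F n in sequentially. fps_nth (?P n) k = fps_nth ?p k"
      unfolding eventually_sequentially fps_nth_Abs_fps using eq by blast
  qed
  moreover have "fps_nth ?p 0 \<noteq> 0" by simp
  then have "?p \<noteq> 0" by (metis fps_zero_nth)
  ultimately show ?thesis
    unfolding convergent_prod_def raw_has_prod_def by (intro exI[of _ 0] exI[of _ ?p]) simp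
qed

lemma diag_r_le: "diag_r n m \<Lambda> \<le> n" "diag_r n m \<Lambda> \<le> m"
  unfolding diag_r_def by (rule Least_le; simp)+


lemma infsum_int_ge:
  fixes f :: "'a \<Rightarrow> int"
  assumes "finite {x \<in> S. f x \<noteq> 0}" "\<And>x. x \<in> S \<Longrightarrow> 0 \<le> f x" "finite T" "T \<subseteq> S"
  shows "sum f T \<le> infsum f S"
proof -
  have "infsum f S = infsum f {x \<in> S. f x \<noteq> 0}" by (rule infsum_cong_neutral) auto
  also have "\<dots> = sum f ({x \<in> S. f x \<noteq> 0} \<union> T)"
    using assms by (auto intro!: sum.mono_neutral_left)
  also have "\<dots> \<ge> sum f T" using assms by (intro sum_mono2) auto
  finally show ?thesis .
qed

lemma the_enat_0: "the_enat 0 = 0"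
  by (simp add: zero_enat_def)

lemma is_partition_antimono:
  assumes "is_partition p" "1 \<le> i" "i \<le> j"
  shows "p j \<le> p i"
  using assms(3) by (induction rule: dec_induct)
    (use assms(1,2) in \<open>auto simp: is_partition_def intro: order_trans\<close>)

lemma is_partition_eq_0:
  assumes "is_partition p" "part_length p < i"
  shows "p i = 0"
proof (rule ccontr)
  assume "p i \<noteq> 0"
  then have "{1..i} \<subseteq> {k. 1 \<le> k \<and> p k \<noteq> 0}"
    using is_partition_antimono[OF assms(1), of _ i] by fastforce
  then have "card {1..i} \<le> part_length p"
    unfolding part_length_def using assms(1) by (intro card_mono) (auto simp: is_partition_def)
  with assms(2) show False by simp
qed

context
  fixes n m :: nat and \<nu> \<mu> \<Lambda> :: "nat \<Rightarrow> nat"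
  assumes parts: "is_partition \<nu>" "is_partition \<mu>" "is_partition \<Lambda>"
    and lens: "part_length \<nu> \<le> n" "part_length \<mu> \<le> m"
begin

context
  fixes a assumes a: "a \<in> arrays n m \<mu> \<nu> \<Lambda>"
begin

lemma arrays_step:
  assumes "1 \<le> i" "1 \<le> j"
  shows "a (i, Suc j) \<le> a (i, j)" "a (Suc i, j) \<le> a (i, j)"
    "a (i, j) = \<infinity> \<longleftrightarrow> (i, j) \<in> diagram \<Lambda>"
  using a assms unfolding arrays_def by blast+

lemma arrays_extensional: "a \<in> ({1..} \<times> {1..}) \<rightarrow>\<^sub>E UNIV"
  using a by (simp add: arrays_def)

lemma arrays_row_mono:
  assumes "1 \<le> i" "1 \<le> j" "j \<le> j'" shows "a (i, j') \<le> a (i, j)"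
  using assms(3)
proof (induction rule: dec_induct)
  case (step k)
  then show ?case using arrays_step(1)[of i k] assms by force
qed simp

lemma arrays_col_mono:
  assumes "1 \<le> i" "1 \<le> j" "i \<le> i'" shows "a (i', j) \<le> a (i, j)"
  using assms(3)
proof (induction rule: dec_induct)
  case (step k)
  then show ?case using arrays_step(2)[of k j] assms by force
qed simp

lemma arrays_row_limit:
  obtains J where "\<And>i j. 1 \<le> i \<Longrightarrow> J i \<le> j \<Longrightarrow> a (i, j) = enat (\<nu> i)"
proof -
  have "\<forall>i. \<exists>J. 1 \<le> i \<longrightarrow> (\<forall>j\<ge>J. a (i, j) = enat (\<nu> i))"
    using a by (auto simp: arrays_def eventually_sequentially)
  then show ?thesis using that by metis
qed

lemma arrays_col_limit:
  obtains I where "\<And>i j. 1 \<le> j \<Longrightarrow> I j \<le> i \<Longrightarrow> a (i, j) = enat (\<mu> j)"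
proof -
  have "\<forall>j. \<exists>I. 1 \<le> j \<longrightarrow> (\<forall>i\<ge>I. a (i, j) = enat (\<mu> j))"
    using a by (auto simp: arrays_def eventually_sequentially)
  then show ?thesis using that by metis
qed

lemma arrays_row_ge: "1 \<le> i \<Longrightarrow> 1 \<le> j \<Longrightarrow> enat (\<nu> i) \<le> a (i, j)"
  by (metis arrays_row_limit arrays_row_mono max.cobounded1 max.cobounded2)

lemma arrays_col_ge: "1 \<le> i \<Longrightarrow> 1 \<le> j \<Longrightarrow> enat (\<mu> j) \<le> a (i, j)"
  by (metis arrays_col_limit arrays_col_mono max.cobounded1 max.cobounded2)

lemma arrays_eq_0: "n < i \<Longrightarrow> m < j \<Longrightarrow> a (i, j) = 0"
  using arrays_row_mono[of "n + 1" "m + 1" j] arrays_col_mono[of "n + 1" j i] a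
  by (auto simp: arrays_def)

lemma arrays_finite: "1 \<le> i \<Longrightarrow> 1 \<le> j \<Longrightarrow> (i, j) \<notin> diagram \<Lambda> \<Longrightarrow> \<exists>k. a (i, j) = enat k"
  using arrays_step(3) by (cases "a (i, j)") auto

definition upper_excess where "upper_excess = (\<lambda>(i, j). int (the_enat (a (i, j))) - int (\<nu> i))"
definition lower_excess where "lower_excess = (\<lambda>(i, j). int (the_enat (a (i, j))) - int (\<mu> j))"

lemma weight_up_lo:
  "weight n m \<mu> \<nu> \<Lambda> a =
     infsum upper_excess (upper_cells n m \<Lambda>) + infsum lower_excess (lower_cells n m \<Lambda>)"
  by (simp add: weight_def upper_excess_def lower_excess_def)

lemma up_nonneg: "x \<in> upper_cells n m \<Lambda> \<Longrightarrow> 0 \<le> upper_excess x"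
  using arrays_row_ge arrays_finite by (force simp: upper_excess_def upper_cells_def)

lemma lo_nonneg: "x \<in> lower_cells n m \<Lambda> \<Longrightarrow> 0 \<le> lower_excess x"
  using arrays_col_ge arrays_finite by (force simp: lower_excess_def lower_cells_def)

lemma finite_up: "finite {x \<in> upper_cells n m \<Lambda>. upper_excess x \<noteq> 0}"
proof -
  obtain J where J: "\<And>i j. 1 \<le> i \<Longrightarrow> J i \<le> j \<Longrightarrow> a (i, j) = enat (\<nu> i)"
    using arrays_row_limit by metis
  have "{x \<in> upper_cells n m \<Lambda>. upper_excess x \<noteq> 0} \<subseteq> (SIGMA i:{1..n}. {..<J i})"
  proof (rule subrelI)
    fix i j assume "(i, j) \<in> {x \<in> upper_cells n m \<Lambda>. upper_excess x \<noteq> 0}"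
    then have ij: "(i, j) \<in> upper_cells n m \<Lambda>" and nz: "upper_excess (i, j) \<noteq> 0" by simp_all
    from ij have "1 \<le> i" by (simp add: upper_cells_def)
    then have "j < J i" using J[of i j] nz by (force simp: upper_excess_def)
    moreover have "i \<in> {1..n}"
    proof (rule ccontr)
      assume "i \<notin> {1..n}"
      then have "n < i" "m < j" using ij by (auto simp: upper_cells_def)
      then show False
        using nz lens is_partition_eq_0[OF parts(1), of i]
        by (simp add: upper_excess_def arrays_eq_0 the_enat_0)
    qed
    ultimately show "(i, j) \<in> (SIGMA i:{1..n}. {..<J i})" by simp
  qed
  then show ?thesis by (rule finite_subset) auto
qed

lemma finite_lo: "finite {x \<in> lower_cells n m \<Lambda>. lower_excess x \<noteq> 0}"
proof -
  obtain I where I: "\<And>i j. 1 \<le> j \<Longrightarrow> I j \<le> i \<Longrightarrow> a (i, j) = enat (\<mu> j)"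
    using arrays_col_limit by metis
  have "{x \<in> lower_cells n m \<Lambda>. lower_excess x \<noteq> 0} \<subseteq> prod.swap ` (SIGMA j:{1..m}. {..<I j})"
  proof safe
    fix i j assume ij: "(i, j) \<in> lower_cells n m \<Lambda>" and nz: "lower_excess (i, j) \<noteq> 0"
    then have "1 \<le> j" by (simp add: lower_cells_def)
    then have "i < I j" using I[of j i] nz by (force simp: lower_excess_def)
    moreover have "j \<in> {1..m}"
    proof (rule ccontr)
      assume "j \<notin> {1..m}"
      then have "n < i" "m < j" using ij by (auto simp: lower_cells_def)
      then show False
        using nz lens is_partition_eq_0[OF parts(2), of j]
        by (simp add: lower_excess_def arrays_eq_0 the_enat_0)
    qed
    ultimately show "(i, j) \<in> prod.swap ` (SIGMA j:{1..m}. {..<I j})" by force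
  qed
  then show ?thesis by (rule finite_subset) auto
qed

lemmas up_sum_le = infsum_int_ge[OF finite_up up_nonneg]
lemmas lo_sum_le = infsum_int_ge[OF finite_lo lo_nonneg]

lemma weight_ge:
  assumes "finite S" "S \<subseteq> upper_cells n m \<Lambda>" "finite T" "T \<subseteq> lower_cells n m \<Lambda>"
  shows "sum upper_excess S + sum lower_excess T \<le> weight n m \<mu> \<nu> \<Lambda> a"
  unfolding weight_up_lo using up_sum_le[of S] lo_sum_le[of T] assms by simp

lemma weight_nonneg_aux: "0 \<le> weight n m \<mu> \<nu> \<Lambda> a"
  using weight_ge[of "{}" "{}"] by simp

lemma array_row_stable:
  assumes w: "weight n m \<mu> \<nu> \<Lambda> a = int K" and i: "1 \<le> i" and j: "\<Lambda> 1 + m + K + 1 \<le> j"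
  shows "a (i, j) = enat (\<nu> i)"
proof (cases "n < i")
  case True
  then show ?thesis using j lens is_partition_eq_0[OF parts(1), of i]
    by (simp add: arrays_eq_0 zero_enat_def)
next
  case False
  show ?thesis
  proof (rule ccontr)
    assume ne: "a (i, j) \<noteq> enat (\<nu> i)"
    have j1: "1 \<le> j" using j by simp
    define S where "S = {i} \<times> {\<Lambda> 1 + m + 1..j}"
    have S: "S \<subseteq> upper_cells n m \<Lambda>"
      using False i is_partition_antimono[OF parts(3), of 1 i]
      by (auto simp: S_def upper_cells_def diagram_def)
    have "1 \<le> upper_excess x" if xS: "x \<in> S" for x
    proof -
      obtain j' where x: "x = (i, j')" "1 \<le> j'" "j' \<le> j" using xS by (auto simp: S_def)
      have "enat (\<nu> i) < a (i, j)" using arrays_row_ge[OF i j1] ne by simp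
      also have "\<dots> \<le> a (i, j')" using arrays_row_mono[OF i x(2,3)] .
      finally have "enat (\<nu> i) < a (i, j')" .
      moreover obtain k where "a (i, j') = enat k"
        using arrays_finite[OF i x(2)] S xS x by (auto simp: upper_cells_def)
      ultimately show ?thesis by (simp add: upper_excess_def x)
    qed
    then have "(\<Sum>x\<in>S. 1) \<le> sum upper_excess S" by (intro sum_mono)
    also have "\<dots> \<le> int K" using weight_ge[of S "{}"] S w by (simp add: S_def)
    finally show False using j by (simp add: S_def)
  qed
qed

lemma array_col_stable:
  assumes w: "weight n m \<mu> \<nu> \<Lambda> a = int K" and j: "1 \<le> j" and i: "part_length \<Lambda> + n + K + 1 \<le> i"
  shows "a (i, j) = enat (\<mu> j)"
proof (cases "m < j")
  case True
  then show ?thesis using i lens is_partition_eq_0[OF parts(2), of j]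
    by (simp add: arrays_eq_0 zero_enat_def)
next
  case False
  show ?thesis
  proof (rule ccontr)
    assume ne: "a (i, j) \<noteq> enat (\<mu> j)"
    have i1: "1 \<le> i" using i by simp
    define S where "S = {part_length \<Lambda> + n + 1..i} \<times> {j}"
    have S: "S \<subseteq> lower_cells n m \<Lambda>"
      using False j is_partition_eq_0[OF parts(3)]
      by (auto simp: S_def lower_cells_def diagram_def)
    have "1 \<le> lower_excess x" if xS: "x \<in> S" for x
    proof -
      obtain i' where x: "x = (i', j)" "1 \<le> i'" "i' \<le> i" using xS by (auto simp: S_def)
      have "enat (\<mu> j) < a (i, j)" using arrays_col_ge[OF i1 j] ne by simp
      also have "\<dots> \<le> a (i', j)" using arrays_col_mono[OF x(2) j x(3)] .
      finally have "enat (\<mu> j) < a (i', j)" .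
      moreover obtain k where "a (i', j) = enat k"
        using arrays_finite[OF x(2) j] S xS x by (auto simp: lower_cells_def)
      ultimately show ?thesis by (simp add: lower_excess_def x)
    qed
    then have "(\<Sum>x\<in>S. 1) \<le> sum lower_excess S" by (intro sum_mono)
    also have "\<dots> \<le> int K" using weight_ge[of "{}" S] S w by (simp add: S_def)
    finally show False using i by (simp add: S_def)
  qed
qed

lemma array_values:
  assumes w: "weight n m \<mu> \<nu> \<Lambda> a = int K" and i: "1 \<le> i" and j: "1 \<le> j"
  shows "a (i, j) \<in> insert \<infinity> (enat ` {..\<nu> 1 + \<mu> 1 + K})"
proof (cases "a (i, j)")
  case (enat k)
  then have "(i, j) \<notin> diagram \<Lambda>" using arrays_step(3)[OF i j] by simp
  then consider "(i, j) \<in> upper_cells n m \<Lambda>" | "(i, j) \<in> lower_cells n m \<Lambda>"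
    using i j by (force simp: upper_cells_def lower_cells_def)
  then have "k \<le> \<nu> 1 + \<mu> 1 + K"
  proof cases
    case 1
    then show ?thesis
      using weight_ge[of "{(i, j)}" "{}"] w enat is_partition_antimono[OF parts(1), of 1 i] i
      by (simp add: upper_excess_def)
  next
    case 2
    then show ?thesis
      using weight_ge[of "{}" "{(i, j)}"] w enat is_partition_antimono[OF parts(2), of 1 j] j
      by (simp add: lower_excess_def)
  qed
  then show ?thesis using enat by simp
qed simp

end

lemma weight_nonneg: "a \<in> arrays n m \<mu> \<nu> \<Lambda> \<Longrightarrow> 0 \<le> weight n m \<mu> \<nu> \<Lambda> a"
  by (rule weight_nonneg_aux)

lemma finite_arrays_weight: "finite {a \<in> arrays n m \<mu> \<nu> \<Lambda>. weight n m \<mu> \<nu> \<Lambda> a = int K}"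
  (is "finite ?F")
proof -
  define B where "B = {1..part_length \<Lambda> + n + K} \<times> {1..\<Lambda> 1 + m + K}"
  let ?V = "insert \<infinity> (enat ` {..\<nu> 1 + \<mu> 1 + K})"
  have "inj_on (\<lambda>a. restrict a B) ?F"
  proof (rule inj_onI)
    fix a b assume a: "a \<in> ?F" and b: "b \<in> ?F" and eq: "restrict a B = restrict b B"
    have A: "a \<in> arrays n m \<mu> \<nu> \<Lambda>" "b \<in> arrays n m \<mu> \<nu> \<Lambda>"
      and W: "weight n m \<mu> \<nu> \<Lambda> a = int K" "weight n m \<mu> \<nu> \<Lambda> b = int K"
      using a b by blast+
    show "a = b"
    proof
      fix x :: "nat \<times> nat"
      obtain i j where x: "x = (i, j)" by force
      consider "i = 0 \<or> j = 0" | "x \<in> B" | "1 \<le> i" "\<Lambda> 1 + m + K + 1 \<le> j"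
        | "1 \<le> j" "part_length \<Lambda> + n + K + 1 \<le> i"
        by (force simp: B_def x)
      then show "a x = b x"
      proof cases
        case 1
        then have "x \<notin> {1..} \<times> {1..}" by (auto simp: x)
        then show ?thesis
          using PiE_arb[OF arrays_extensional[OF A(1)]] PiE_arb[OF arrays_extensional[OF A(2)]]
          by presburger
      next
        case 2
        then show ?thesis using eq by (metis restrict_apply')
      next
        case 3
        then show ?thesis
          using array_row_stable[OF A(1) W(1)] array_row_stable[OF A(2) W(2)] unfolding x by metis
      next
        case 4
        then show ?thesis
          using array_col_stable[OF A(1) W(1)] array_col_stable[OF A(2) W(2)] unfolding x by metis
      qed
    qed
  qed
  moreover have "(\<lambda>a. restrict a B) ` ?F \<subseteq> B \<rightarrow>\<^sub>E ?V"
  proof (rule image_subsetI)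
    fix a assume "a \<in> ?F"
    then have a: "a \<in> arrays n m \<mu> \<nu> \<Lambda>" "weight n m \<mu> \<nu> \<Lambda> a = int K" by blast+
    have "\<forall>x\<in>B. a x \<in> ?V"
    proof
      fix x assume "x \<in> B"
      then obtain i j where x: "x = (i, j)" "1 \<le> i" "1 \<le> j" unfolding B_def by force
      show "a x \<in> ?V" unfolding x(1) by (rule array_values[OF a x(2,3)])
    qed
    then show "restrict a B \<in> B \<rightarrow>\<^sub>E ?V" unfolding restrict_PiE_iff .
  qed
  moreover have "finite (B \<rightarrow>\<^sub>E ?V)" by (intro finite_PiE) (auto simp: B_def)
  ultimately show ?thesis by (rule inj_on_finite)
qed

lemma chi_has_sum:
  "((\<lambda>a. fps_X ^ nat (weight n m \<mu> \<nu> \<Lambda> a)) has_sum chi n m \<mu> \<nu> \<Lambda>) (arrays n m \<mu> \<nu> \<Lambda>)"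
proof -
  let ?A = "arrays n m \<mu> \<nu> \<Lambda>" and ?F = "\<lambda>a. fps_X ^ nat (weight n m \<mu> \<nu> \<Lambda> a) :: rat fps"
  have "{a \<in> ?A. fps_nth (?F a) k \<noteq> 0} \<subseteq> {a \<in> ?A. weight n m \<mu> \<nu> \<Lambda> a = int k}" for k
    using weight_nonneg by (auto split: if_splits)
  then have fin: "finite {a \<in> ?A. fps_nth (?F a) k \<noteq> 0}" for k
    using finite_arrays_weight finite_subset by blast
  have "(?F has_sum Abs_fps (\<lambda>k. \<Sum>a | a \<in> ?A \<and> fps_nth (?F a) k \<noteq> 0. fps_nth (?F a) k)) ?A"
    using fin by (intro has_sum_fpsI) simp_all
  then show ?thesis unfolding chi_def by (rule has_sum_infsum[OF has_sum_imp_summable])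
qed

lemma chi_nth:
  "fps_nth (chi n m \<mu> \<nu> \<Lambda>) k =
     of_nat (card {a \<in> arrays n m \<mu> \<nu> \<Lambda>. weight n m \<mu> \<nu> \<Lambda> a = int k})"
proof -
  have "{a \<in> arrays n m \<mu> \<nu> \<Lambda>. fps_nth (fps_X ^ nat (weight n m \<mu> \<nu> \<Lambda> a) :: rat fps) k \<noteq> 0} =
      {a \<in> arrays n m \<mu> \<nu> \<Lambda>. weight n m \<mu> \<nu> \<Lambda> a = int k}"
    using weight_nonneg by force
  moreover have "fps_nth (fps_X ^ nat (weight n m \<mu> \<nu> \<Lambda> a) :: rat fps) k = 1"
    if "weight n m \<mu> \<nu> \<Lambda> a = int k" for a
    using that by simp
  ultimately show ?thesis using has_sum_fpsD(2)[OF chi_has_sum, of k] by simp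
qed

end

end

theory Submission
  imports Defs
begin

text \<open>
  The diagonals of an array interlace, so an array is a family of nonintersecting particle paths:
  going from the far upper right to the far lower left, \<open>n\<close> particles start at the positions \<open>N\<^sub>j\<close>,
  \<open>n - r\<close> of them disappear at infinity on reaching the pit, \<open>r\<close> cross the main diagonal, \<open>m - r\<close> new
  ones arrive from infinity, and all end at the positions \<open>M\<^sub>i\<close>. Truncate to finitely many diagonals
  and bounded entries, and sum over the diagonals one at a time. At each step the partial sum is a
  determinant in the current positions: interlacing means that each particle ranges over the interval
  between two neighbours, so by multilinearity the sum of a determinant is a determinant of differences
  of cumulative sums, and row operations telescope the differences. Disappearing particles leave
  constant rows, arriving ones create new columns, which yields the block matrix. Its entries are
  generating functions of single paths: \<open>q\<close>-binomial coefficients for the two border blocks, and a sum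
  over the crossing point of the main diagonal otherwise. Removing the truncation, the border
  entries become monomials over \<open>(q)\<^sub>\<infinity>\<close>, and the identity
  \<open>(\<Sum>k. q\<^sup>k / ((q)\<^sub>k (q)\<^bsub>k + D\<^esub>)) = (q)\<^sub>\<infinity>\<^bsup>-2\<^esup> (\<Sum>a. (-1)\<^sup>a q\<^bsup>a (a + 1) / 2 + D a\<^esup>)\<close>
  gives the remaining ones.
\<close>

section \<open>Determinants of summed rows\<close>

text \<open>The slices are summed with raw positions, whereas \<open>weight\<close> subtracts \<nu>
  or \<mu> from each entry. The discrepancy is the total of the asymptotic positions over all finite
  cells. Its part linear in the number \<open>L\<close> of diagonals per side, \<open>L + 1\<close>
  times the sum of all \<open>N p\<close> plus \<open>L - 1\<close> times the sum of all
  \<open>M p\<close>, is exactly what factors out of the columns and rows of the determinant; the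
  rest, due to the cells inside the pit, is the exponent Delta. The main diagonal counts as upper,
  so index \<open>p\<close> loses \<open>P p + 1\<close> cells above but only \<open>Q p\<close>
  below: hence the asymmetry of the formula. The bound \<open>H\<close> stands in for infinity: a
  particle that disappears or arrives is limited by \<open>H\<close> alone, which keeps all sums
  finite and makes the row of a dead particle constant. In the limit each of the \<open>m\<close>
  rows of final particles and each of the \<open>n\<close> columns of starting particles contributes
  one factor \<open>1 / (q)_\<infinity>\<close>. The recursion orders particles by increasing
  position, unlike the block matrix; the sign is the parity of that rearrangement.\<close>

definition fdet :: "nat \<Rightarrow> (nat \<Rightarrow> nat \<Rightarrow> 'a::comm_ring_1) \<Rightarrow> 'a" where
  "fdet K R = Determinant.det (mat K K (\<lambda>(i, j). R i j))"

lemma fdet_leibniz: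
  "fdet K R = (\<Sum>p | p permutes {0..<K}. signof p * (\<Prod>i<K. R i (p i)))"
  unfolding fdet_def
  by (subst det_def'[of _ K]) (auto intro!: sum.cong prod.cong simp: lessThan_atLeast0 permutes_in_image)

lemma fdet_cong:
  assumes "\<And>i j. i < K \<Longrightarrow> j < K \<Longrightarrow> R i j = R' i j"
  shows "fdet K R = fdet K R'"
  unfolding fdet_def using assms by (intro arg_cong[of _ _ Determinant.det] eq_matI) auto

lemma fdet_triangular_product:
  assumes "\<And>i j. i < K \<Longrightarrow> j < K \<Longrightarrow> B i j = (\<Sum>l<K. U i l * A l j)"
    and U: "Determinant.det (mat K K (\<lambda>(i, j). U i j)) = 1"
  shows "fdet K B = fdet K A"
proof -
  have "mat K K (\<lambda>(i, j). B i j) = mat K K (\<lambda>(i, j). U i j) * mat K K (\<lambda>(i, j). A i j)"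
    using assms(1) by (intro eq_matI) (auto simp: scalar_prod_def lessThan_atLeast0)
  then show ?thesis
    unfolding fdet_def by (simp add: det_mult[of _ K] U)
qed

lemma prod_list_diag_one:
  assumes "\<And>i. i < K \<Longrightarrow> U i i = (1::'a::comm_ring_1)"
  shows "prod_list (diag_mat (mat K K (\<lambda>(i, j). U i j))) = 1"
  using assms by (simp add: prod_list_diag_prod)

text \<open>All rows are changed at once, each by a multiple of an original row. Since
  \<open>f\<close> moves every affected index strictly in one direction, the transition matrix is
  triangular with ones on the diagonal.\<close>

lemma fdet_sub_row:
  assumes B: "\<And>i j. i < K \<Longrightarrow> j < K \<Longrightarrow> B i j = A i j - c i * A (f i) j"
    and f: "(\<forall>i<K. c i \<noteq> 0 \<longrightarrow> f i < i) \<or> (\<forall>i<K. c i \<noteq> 0 \<longrightarrow> i < f i \<and> f i < K)"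
  shows "fdet K B = fdet K A"
proof -
  define U where "U i l = (if l = i then 1 else 0) - (if l = f i then c i else 0)" for i l :: nat
  have fK: "c i = 0 \<or> f i < K" if "i < K" for i using f that by (meson order.strict_trans)
  then have "(\<Sum>l<K. U i l * A l j) = A i j - c i * A (f i) j" if "i < K" for i j
    using \<open>i < K\<close> fK[OF \<open>i < K\<close>] unfolding U_def
    by (elim disjE) (simp_all add: left_diff_distrib sum_subtractf if_distrib[of "\<lambda>z. z * _"] cong: if_cong)
  then have 1: "B i j = (\<Sum>l<K. U i l * A l j)" if "i < K" "j < K" for i j
    using that B by simp
  have diag: "U i i = 1" if "i < K" for i using f that by (auto simp: U_def)
  from f have "Determinant.det (mat K K (\<lambda>(i, j). U i j)) = prod_list (diag_mat (mat K K (\<lambda>(i, j). U i j)))"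
  proof
    assume *: "\<forall>i<K. c i \<noteq> 0 \<longrightarrow> f i < i"
    have "U i j = 0" if "i < j" "j < K" for i j
      using that *[rule_format, of i] by (cases "c i = 0") (auto simp: U_def)
    then show ?thesis by (intro det_lower_triangular[of K]) auto
  next
    assume "\<forall>i<K. c i \<noteq> 0 \<longrightarrow> i < f i \<and> f i < K"
    then show ?thesis by (intro det_upper_triangular[of _ K] upper_triangularI) (auto simp: U_def)
  qed
  with 1 show ?thesis by (intro fdet_triangular_product) (simp_all add: prod_list_diag_one diag)
qed

text \<open>A permutation with nonzero contribution must fix \<open>c\<close>, so the other entries
  of row \<open>c\<close> never occur in a surviving term and can be replaced freely.\<close>

lemma fdet_unit_column:
  assumes c: "c < K" and R: "\<And>i. i < K \<Longrightarrow> i \<noteq> c \<Longrightarrow> R i c = 0"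
    and eq: "\<And>i j. i < K \<Longrightarrow> j < K \<Longrightarrow> i \<noteq> c \<or> j = c \<Longrightarrow> R' i j = R i j"
  shows "fdet K R' = fdet K R"
  unfolding fdet_leibniz
proof (rule sum.cong[OF refl])
  fix p assume "p \<in> {p. p permutes {0..<K}}"
  then have p: "p permutes {0..<K}" by simp
  have pK: "p i < K" if "i < K" for i using permutes_in_image[OF p, of i] that by simp
  have "(\<Prod>i<K. R' i (p i)) = (\<Prod>i<K. R i (p i))"
  proof (cases "p c = c")
    case True
    then show ?thesis by (intro prod.cong) (use eq pK in \<open>metis lessThan_iff\<close>)+
  next
    case False
    obtain i where i: "p i = c" using permutes_surj[OF p] by (metis surj_def)
    then have iK: "i < K" "i \<noteq> c" using permutes_in_image[OF p, of i] c False by auto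
    then have "R i (p i) = 0" "R' i (p i) = 0" using R eq i c by auto
    then show ?thesis using iK by (metis finite_lessThan lessThan_iff prod_zero)
  qed
  then show "signof p * (\<Prod>i<K. R' i (p i)) = signof p * (\<Prod>i<K. R i (p i))" by simp
qed

lemma fdet_zero_row:
  assumes "i < K" "\<And>j. j < K \<Longrightarrow> R i j = 0"
  shows "fdet K R = 0"
  unfolding fdet_leibniz
proof (intro sum.neutral ballI)
  fix p assume "p \<in> {p. p permutes {0..<K}}"
  then have "R i (p i) = 0" using assms permutes_in_image[of p "{0..<K}" i] by auto
  then have "(\<Prod>i<K. R i (p i)) = 0" using assms(1) by (intro prod_zero) auto
  then show "signof p * (\<Prod>i<K. R i (p i)) = 0" by simp
qed

lemma fdet_zero_column:
  assumes "j < K" "\<And>i. i < K \<Longrightarrow> R i j = 0"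
  shows "fdet K R = 0"
  unfolding fdet_leibniz
proof (intro sum.neutral ballI)
  fix p assume "p \<in> {p. p permutes {0..<K}}"
  then have p: "p permutes {0..<K}" by simp
  obtain i where i: "p i = j" using permutes_surj[OF p] by (metis surj_def)
  then have "i < K" using permutes_in_image[OF p, of i] assms(1) by auto
  then have "R i (p i) = 0" using i assms by auto
  then have "(\<Prod>i<K. R i (p i)) = 0" using \<open>i < K\<close> by (intro prod_zero) auto
  then show "signof p * (\<Prod>i<K. R i (p i)) = 0" by simp
qed

lemma fdet_identity: "fdet K (\<lambda>i j. if i = j then 1 else 0) = 1"
proof -
  have "mat K K (\<lambda>(i, j). if i = j then 1 else 0) = (1\<^sub>m K :: 'a mat)" by (intro eq_matI) auto
  then show ?thesis by (simp add: fdet_def)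
qed

lemma fdet_scale:
  "fdet K (\<lambda>i j. r i * c j * R i j) = (\<Prod>i<K. r i) * (\<Prod>j<K. c j) * fdet K R"
  unfolding fdet_leibniz sum_distrib_left
proof (rule sum.cong[OF refl])
  fix p assume "p \<in> {p. p permutes {0..<K}}"
  then have "(\<Prod>i<K. c (p i)) = (\<Prod>j<K. c j)"
    using prod.permute[of p "{..<K}" c] by (simp add: lessThan_atLeast0 o_def)
  then show "signof p * (\<Prod>i<K. r i * c (p i) * R i (p i)) =
      (\<Prod>i<K. r i) * (\<Prod>j<K. c j) * (signof p * (\<Prod>i<K. R i (p i)))"
    by (simp add: prod.distrib algebra_simps)
qed

lemma fdet_reverse: "fdet K (\<lambda>i j. R (K - Suc i) (K - Suc j)) = fdet K R"
proof -
  define p where "p i = (if i < K then K - Suc i else i)" for i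
  have p: "p permutes {0..<K}"
    by (rule bij_imp_permutes[OF bij_betw_byWitness[where f' = p]]) (auto simp: p_def)
  let ?A = "mat K K (\<lambda>(i, j). R i j)"
  let ?B = "mat K K (\<lambda>(i, j). ?A $$ (p i, j))"
  have "fdet K (\<lambda>i j. R (K - Suc i) (K - Suc j)) =
      Determinant.det (transpose_mat (mat K K (\<lambda>(i, j). transpose_mat ?B $$ (p i, j))))"
    unfolding fdet_def by (intro arg_cong[of _ _ Determinant.det] eq_matI) (auto simp: p_def)
  also have "\<dots> = Determinant.det (mat K K (\<lambda>(i, j). transpose_mat ?B $$ (p i, j)))"
    by (rule det_transpose[of _ K]) simp
  also have "\<dots> = signof p * Determinant.det (transpose_mat ?B)"
    by (rule det_permute_rows[OF _ p]) simp
  also have "Determinant.det (transpose_mat ?B) = Determinant.det ?B"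
    by (rule det_transpose[of _ K]) simp
  also have "Determinant.det ?B = signof p * Determinant.det ?A"
    by (rule det_permute_rows[OF _ p]) simp
  finally show ?thesis by (simp add: fdet_def sign_def)
qed

text \<open>Multilinearity with independent variables: \<open>y p\<close> occurs only in the row
  that \<open>\<sigma>\<close> matches with \<open>p\<close>, so in every Leibniz term the sum over
  the product set splits into a product of sums.\<close>

lemma fdet_sum_rows:
  fixes w :: "'b \<Rightarrow> 'a::comm_ring_1"
  assumes \<sigma>: "bij_betw \<sigma> S P" and S: "S \<subseteq> {..<K}" and I: "\<And>p. p \<in> P \<Longrightarrow> finite (I p)"
  shows "(\<Sum>y\<in>PiE P I. (\<Prod>p\<in>P. w (y p)) * fdet K (\<lambda>i j. if i \<in> S then g (y (\<sigma> i)) j else R i j)) =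
    fdet K (\<lambda>i j. if i \<in> S then (\<Sum>z\<in>I (\<sigma> i). w z * g z j) else R i j)"
proof -
  have finS: "finite S" using S finite_subset by blast
  have finP: "finite P" using \<sigma> finS bij_betw_finite by blast
  define \<rho> where "\<rho> = the_inv_into S \<sigma>"
  have \<rho>: "bij_betw \<rho> P S" unfolding \<rho>_def by (rule bij_betw_the_inv_into[OF \<sigma>])
  have \<sigma>\<rho>: "\<sigma> (\<rho> p) = p" if "p \<in> P" for p
    using that \<sigma> unfolding \<rho>_def by (simp add: f_the_inv_into_f_bij_betw)
  have split: "(\<Prod>i<K. if i \<in> S then u i else v i) = (\<Prod>p\<in>P. u (\<rho> p)) * (\<Prod>i\<in>{..<K} - S. v i)"
    for u v :: "nat \<Rightarrow> 'a"
  proof -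
    have "(\<Prod>i<K. if i \<in> S then u i else v i) = (\<Prod>i\<in>S. u i) * (\<Prod>i\<in>{..<K} - S. v i)"
      using S by (subst prod.If_cases) (auto simp: Int_absorb1 Diff_eq)
    then show ?thesis by (simp add: prod.reindex_bij_betw[OF \<rho>])
  qed
  have "(\<Sum>y\<in>PiE P I. (\<Prod>p\<in>P. w (y p)) * fdet K (\<lambda>i j. if i \<in> S then g (y (\<sigma> i)) j else R i j)) =
      (\<Sum>\<pi> | \<pi> permutes {0..<K}. signof \<pi> * (\<Prod>i\<in>{..<K} - S. R i (\<pi> i)) *
        (\<Sum>y\<in>PiE P I. \<Prod>p\<in>P. w (y p) * g (y p) (\<pi> (\<rho> p))))"
    unfolding fdet_leibniz sum_distrib_left
    by (subst sum.swap) (simp add: if_distribR split \<sigma>\<rho> prod.distrib mult_ac cong: if_cong prod.cong)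
  also have "\<dots> = fdet K (\<lambda>i j. if i \<in> S then (\<Sum>z\<in>I (\<sigma> i). w z * g z j) else R i j)"
    unfolding fdet_leibniz
  proof (rule sum.cong[OF refl], goal_cases)
    case (1 \<pi>)
    have "(\<Prod>p\<in>P. \<Sum>z\<in>I p. w z * g z (\<pi> (\<rho> p))) =
        (\<Sum>y\<in>PiE P I. \<Prod>p\<in>P. w (y p) * g (y p) (\<pi> (\<rho> p)))"
      by (rule prod_sum_PiE) (use finP I in auto)
    then show ?case by (simp add: if_distribR split \<sigma>\<rho> mult_ac cong: if_cong prod.cong)
  qed
  finally show ?thesis .
qed

text \<open>Summing a row over the interval between consecutive boundary values gives a difference of
  two cumulative sums; subtracting neighbouring rows then leaves one cumulative sum per row.\<close>

lemma fdet_sum_interlacing_below: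
  fixes w :: "nat \<Rightarrow> 'a::comm_ring_1"
  assumes k: "k \<le> K" and x: "\<And>p. Suc p < k \<Longrightarrow> x p \<le> x (Suc p)"
  shows "(\<Sum>y\<in>(\<Pi>\<^sub>E p\<in>{..<k}. {if p = 0 then 0 else Suc (x (p - 1))..x p}).
      (\<Prod>p<k. w (y p)) * fdet K (\<lambda>i j. if i \<in> {..<k} then g (y i) j else R i j)) =
    fdet K (\<lambda>i j. if i \<in> {..<k} then (\<Sum>z\<le>x i. w z * g z j) else R i j)"
proof -
  have "(\<Sum>y\<in>(\<Pi>\<^sub>E p\<in>{..<k}. {if p = 0 then 0 else Suc (x (p - 1))..x p}).
      (\<Prod>p<k. w (y p)) * fdet K (\<lambda>i j. if i \<in> {..<k} then g (y (id i)) j else R i j)) =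
    fdet K (\<lambda>i j. if i \<in> {..<k} then
      (\<Sum>z\<in>{if id i = 0 then 0 else Suc (x (id i - 1))..x (id i)}. w z * g z j) else R i j)"
    by (rule fdet_sum_rows) (use k in \<open>auto simp: bij_betw_def\<close>)
  also have "\<dots> = fdet K (\<lambda>i j. if i \<in> {..<k} then (\<Sum>z\<le>x i. w z * g z j) else R i j)"
  proof (rule fdet_sub_row[where f = "\<lambda>i. i - 1" and c = "\<lambda>i. if 0 < i \<and> i < k then 1 else 0"])
    fix i j assume "i < K" "j < K"
    show "(if i \<in> {..<k} then
        (\<Sum>z\<in>{if id i = 0 then 0 else Suc (x (id i - 1))..x (id i)}. w z * g z j) else R i j) =
      (if i \<in> {..<k} then (\<Sum>z\<le>x i. w z * g z j) else R i j) -
      (if 0 < i \<and> i < k then 1 else 0) *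
      (if i - 1 \<in> {..<k} then (\<Sum>z\<le>x (i - 1). w z * g z j) else R (i - 1) j)"
    proof (cases "0 < i \<and> i < k")
      case True
      then have "x (i - 1) \<le> x i" using x[of "i - 1"] by simp
      then have "{..x i} = {..x (i - 1)} \<union> {Suc (x (i - 1))..x i}" by auto
      then have "(\<Sum>z\<le>x i. w z * g z j) =
          (\<Sum>z\<le>x (i - 1). w z * g z j) + (\<Sum>z\<in>{Suc (x (i - 1))..x i}. w z * g z j)"
        by (simp only:) (rule sum.union_disjoint; auto)
      moreover have "i - 1 < k" using True by linarith
      ultimately show ?thesis using True by simp
    next
      case False
      then show ?thesis by (auto simp: atLeast0AtMost)
    qed
  qed auto
  finally show ?thesis by (simp only: id_apply)
qed

text \<open>In the second alternative of \<open>birth\<close> there is one boundary value more than there are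
  summation variables. The unit row \<open>c\<close> then receives the extra cumulative sum, which is harmless
  because all other rows vanish in column \<open>c\<close>.\<close>

lemma fdet_sum_interlacing_above:
  fixes w :: "nat \<Rightarrow> 'a::comm_ring_1"
  assumes \<rho>: "strict_mono_on {..k} \<rho>" "\<And>p. p < k \<Longrightarrow> \<rho> p < K" "\<And>p. p \<le> k \<Longrightarrow> \<sigma> (\<rho> p) = p"
    and y: "\<And>p. p < k \<Longrightarrow> y p \<le> y (Suc p)" and T: "y k \<le> T"
    and birth: "b = 0 \<and> y k = T \<or>
      \<rho> k = c \<and> c < K \<and> (\<forall>j<K. R c j = (if j = c then b else 0)) \<and> (\<forall>v. g v c = 0) \<and>
      (\<forall>i<K. i \<notin> \<rho> ` {..k} \<longrightarrow> R i c = 0)"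
    and A: "A = (if b = 0 \<and> y k = T then {..<k} else {..k})"
  shows "(\<Sum>x\<in>(\<Pi>\<^sub>E p\<in>{..<k}. {y p..<y (Suc p)}).
      (\<Prod>p<k. w (x p)) * fdet K (\<lambda>i j. if i \<in> \<rho> ` {..<k} then g (x (\<sigma> i)) j else R i j)) =
    fdet K (\<lambda>i j. if i \<in> \<rho> ` A
      then (\<Sum>z\<in>{y (\<sigma> i)..<T}. w z * g z j) + (if j = c then b else 0) else R i j)"
    (is "_ = fdet K ?A")
proof -
  let ?S = "\<rho> ` {..<k}"
  \<comment> \<open>The constant \<open>b\<close> in column \<open>c\<close> cancels when
    consecutive cumulative rows are subtracted, so it may be put into all of them.\<close>
  define G where "G z j = (\<Sum>v\<in>{z..<T}. w v * g v j) + (if j = c then b else 0)" for z j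
  define B where "B i j = (if i \<in> ?S then (\<Sum>z\<in>{y (\<sigma> i)..<y (Suc (\<sigma> i))}. w z * g z j) else R i j)" for i j
  \<comment> \<open>Among the summed rows only the last one can have coefficient zero, namely when
    no row is created: its interval already ends at \<open>T\<close>, so it is a full cumulative
    sum.\<close>
  define e where "e i = (if i \<in> ?S \<and> (\<sigma> i < k - 1 \<or> k \<in> A) then (1::'a) else 0)" for i
  have \<sigma>: "bij_betw \<sigma> ?S {..<k}"
    by (rule bij_betw_byWitness[where f' = \<rho>]) (use \<rho>(3) in auto)
  have \<rho>_inj: "\<rho> p = \<rho> p' \<longleftrightarrow> p = p'" if "p \<le> k" "p' \<le> k" for p p' using \<rho>(3) that by metis
  have kS: "\<rho> k \<notin> ?S" using \<rho>_inj by auto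
  have yT: "y p \<le> T" if "p \<le> k" for p
    using that by (induction rule: inc_induct) (use y T in \<open>auto intro: order_trans\<close>)
  have "(\<Sum>x\<in>(\<Pi>\<^sub>E p\<in>{..<k}. {y p..<y (Suc p)}).
      (\<Prod>p<k. w (x p)) * fdet K (\<lambda>i j. if i \<in> ?S then g (x (\<sigma> i)) j else R i j)) = fdet K B"
    unfolding B_def by (rule fdet_sum_rows[OF \<sigma>]) (use \<rho>(2) in auto)
  also have "fdet K B = fdet K (\<lambda>i j. ?A i j - e i * ?A (\<rho> (Suc (\<sigma> i))) j)" (is "_ = fdet K ?B'")
  proof -
    have in_S: "?B' i j = B i j" if i: "i \<in> ?S" for i j
    proof -
      obtain p where p: "p < k" "i = \<rho> p" using i by auto
      have iA: "i \<in> \<rho> ` A" using p A by auto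
      have "{y p..<T} = {y p..<y (Suc p)} \<union> {y (Suc p)..<T}" using y[of p] yT[of "Suc p"] p by auto
      then have "(\<Sum>z\<in>{y p..<T}. w z * g z j) =
          (\<Sum>z\<in>{y p..<y (Suc p)}. w z * g z j) + (\<Sum>z\<in>{y (Suc p)..<T}. w z * g z j)"
        by (simp only:) (rule sum.union_disjoint; auto)
      then have *: "(\<Sum>z\<in>{y p..<y (Suc p)}. w z * g z j) = G (y p) j - G (y (Suc p)) j"
        by (simp add: G_def)
      show ?thesis
      proof (cases "Suc p < k \<or> k \<in> A")
        case True
        then have "Suc p \<in> A" using p A by (cases "Suc p = k") (auto split: if_splits)
        then have "\<rho> (Suc p) \<in> \<rho> ` A" by blast
        moreover have "e i = 1" using True p \<rho>(3)[of p] i by (auto simp: e_def)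
        ultimately show ?thesis using * p \<rho>(3)[of p] \<rho>(3)[of "Suc p"] iA i by (simp add: G_def B_def)
      next
        case False
        then have "Suc p = k" "b = 0" "y k = T" using p A by (auto split: if_splits)
        moreover have "e i = 0" using False p \<rho>(3)[of p] by (auto simp: e_def)
        ultimately show ?thesis using * p \<rho>(3)[of p] iA i by (simp add: G_def B_def)
      qed
    qed
    have out: "?B' i j = B i j" if "i \<notin> \<rho> ` A" for i j
      using that A by (auto simp: e_def B_def split: if_splits)
    show ?thesis
    proof (cases "k \<in> A")
      case False
      then have "A = {..<k}" using A by (metis atMost_iff order_refl)
      then show ?thesis using in_S[symmetric] out[symmetric] by (intro fdet_cong) blast
    next
      case True
      then have "\<not> (b = 0 \<and> y k = T)" using A by (metis lessThan_iff less_irrefl)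
      with birth have c: "\<rho> k = c" "c < K" "\<forall>j<K. R c j = (if j = c then b else 0)" "\<forall>v. g v c = 0"
        "\<forall>i<K. i \<notin> \<rho> ` {..k} \<longrightarrow> R i c = 0" by blast+
      have "A = insert k {..<k}" using True A by (auto split: if_splits)
      then have A': "\<rho> ` A = insert c ?S" by (simp add: c(1))
      show ?thesis
      proof (rule fdet_unit_column[OF c(2), symmetric])
        fix i assume i: "i < K" "i \<noteq> c"
        show "B i c = 0"
        proof (cases "i \<in> ?S")
          case False
          then have "i \<notin> \<rho> ` {..k}" using i c(1) by (simp add: lessThan_Suc_atMost[symmetric] lessThan_Suc)
          then show ?thesis using c(5) i False by (simp add: B_def)
        qed (simp add: B_def c(4))
      next
        fix i j assume ij: "i < K" "j < K" "i \<noteq> c \<or> j = c"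
        show "?B' i j = B i j"
        proof (cases "i = c")
          case True
          then have "e c = 0" using kS c by (simp add: e_def)
          then show ?thesis using ij True c kS A' by (simp add: B_def)
        next
          case False
          then show ?thesis using in_S[of i j] out[of i j] A' by blast
        qed
      qed
    qed
  qed
  also have "\<dots> = fdet K ?A"
  proof (rule fdet_sub_row[where c = e and f = "\<lambda>i. \<rho> (Suc (\<sigma> i))"])
    have "i < \<rho> (Suc (\<sigma> i)) \<and> \<rho> (Suc (\<sigma> i)) < K" if "i < K" "e i \<noteq> 0" for i
    proof -
      obtain p where p: "p < k" "i = \<rho> p" "p < k - 1 \<or> k \<in> A"
        using \<open>e i \<noteq> 0\<close> \<rho>(3) by (auto simp: e_def split: if_splits)
      have "\<rho> (Suc p) < K"
      proof (cases "Suc p < k")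
        case False
        then have "k \<in> A" "Suc p = k" using p by auto
        then show ?thesis using birth A by (auto split: if_splits)
      qed (rule \<rho>(2))
      moreover have "\<rho> p < \<rho> (Suc p)" using \<rho>(1) p(1) by (simp add: strict_mono_on_def)
      ultimately show ?thesis using p \<rho>(3)[of p] by simp
    qed
    then show "(\<forall>i<K. e i \<noteq> 0 \<longrightarrow> \<rho> (Suc (\<sigma> i)) < i) \<or>
      (\<forall>i<K. e i \<noteq> 0 \<longrightarrow> i < \<rho> (Suc (\<sigma> i)) \<and> \<rho> (Suc (\<sigma> i)) < K)" by blast
  qed (rule refl)
  finally show ?thesis .
qed

section \<open>Interlacing slices\<close>

text \<open>\<open>y\<close> is the slice farther from the main diagonal. Entries on neighbouring
  diagonals are weakly ordered; adding the index makes the comparison of \<open>p - 1\<close> with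
  \<open>p\<close> strict. For \<open>p \<ge> l\<close> the particle \<open>x p\<close> is missing
  and \<open>y p\<close> has no upper bound.\<close>

definition interlace :: "nat \<Rightarrow> nat \<Rightarrow> (nat \<Rightarrow> nat) \<Rightarrow> (nat \<Rightarrow> nat) \<Rightarrow> bool" where
  "interlace k l y x \<longleftrightarrow> (\<forall>p<k. (p < l \<longrightarrow> y p \<le> x p) \<and> (0 < p \<longrightarrow> x (p - 1) < y p))"

text \<open>Time \<open>t\<close> runs through the diagonals \<open>d = L - t\<close> from \<open>d = L\<close> down to \<open>d = - L\<close>, and \<open>k t\<close> is
  the number of finite cells on the diagonal. A cell with index \<open>p\<close> and entry \<open>e\<close> is a particle at
  position \<open>e + p\<close>, where \<open>p\<close> is counted from the corner \<open>(n + 1, m + 1)\<close>. The particle \<open>p\<close> with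
  \<open>r \<le> p < n\<close> disappears at time \<open>\<tau> p\<close>; its row then stays in the determinant as a constant row.
  A particle that appears after time \<open>L\<close> starts from a unit row, hence the fixed size
  \<open>n + m - r\<close>.\<close>

locale slices =
  fixes n m r L H :: nat and k :: "nat \<Rightarrow> nat" and N \<tau> :: "nat \<Rightarrow> nat" and q :: "'a::comm_ring_1"
  assumes r_le: "r \<le> n" "r \<le> m"
    and N_mono: "\<And>p p'. p < p' \<Longrightarrow> p' < n \<Longrightarrow> N p < N p'"
    and N_le: "\<And>p. p < n \<Longrightarrow> N p \<le> H"
    and k_ends: "k 0 = n" "k L = r" "k (2 * L) = m"
    and k_upper: "\<And>t. t < L \<Longrightarrow> k t = k (Suc t) \<or> k t = Suc (k (Suc t)) \<and> \<tau> (k (Suc t)) = Suc t"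
    and k_lower: "\<And>t. L \<le> t \<Longrightarrow> t < 2 * L \<Longrightarrow> k (Suc t) = k t \<or> k (Suc t) = Suc (k t)"
begin

text \<open>Rows \<open>r\<close> to \<open>n - 1\<close> stay reserved for the particles that die,
  so a particle born below the main diagonal, with index at least \<open>r\<close>, gets a row from
  \<open>n\<close> on.\<close>

definition row_of :: "nat \<Rightarrow> nat" where "row_of p = (if p < r then p else p + n - r)"
definition particle_of :: "nat \<Rightarrow> nat" where "particle_of i = (if i < n then i else i - n + r)"

text \<open>The generating function of a single path standing at \<open>x\<close> at time
  \<open>t\<close>, with the weight of \<open>x\<close> itself not yet counted. A column
  \<open>j < n\<close> stands for the start \<open>N j\<close>, a later column for a birth. Paths
  rise until time \<open>L\<close> and fall afterwards; a newborn particle may stand anywhere with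
  amplitude one.\<close>

primrec amp :: "nat \<Rightarrow> nat \<Rightarrow> nat \<Rightarrow> 'a" where
  "amp 0 x j = (if j < n \<and> x = N j then 1 else 0)"
| "amp (Suc t) x j =
    (if t < L then (\<Sum>z\<le>x. q ^ z * amp t z j)
     else (\<Sum>z\<in>{x..<Suc H}. q ^ z * amp t z j) + (if j = row_of (k t) then of_bool (k (Suc t) \<noteq> k t) else 0))"

definition rest :: "nat \<Rightarrow> nat \<Rightarrow> 'a" where
  "rest i j = (if i < n then amp (\<tau> i) H j else if j = i then 1 else 0)"

definition states :: "nat \<Rightarrow> (nat \<Rightarrow> nat) set" where
  "states t = {x \<in> {..<k t} \<rightarrow>\<^sub>E {..H}. \<forall>p. Suc p < k t \<longrightarrow> x p < x (Suc p)}"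

definition step :: "nat \<Rightarrow> (nat \<Rightarrow> nat) \<Rightarrow> (nat \<Rightarrow> nat) \<Rightarrow> bool" where
  "step t s s' \<longleftrightarrow> (if t < L then interlace (k t) (k (Suc t)) s s' else interlace (k (Suc t)) (k t) s' s)"

text \<open>As in \<open>amp\<close>, the current slice is not weighted; over the full time span
  this omits only the last slice, whose positions are prescribed.\<close>

primrec path_sum :: "nat \<Rightarrow> (nat \<Rightarrow> nat) \<Rightarrow> 'a" where
  "path_sum 0 s = (if s = restrict N {..<n} then 1 else 0)"
| "path_sum (Suc t) s =
    (\<Sum>s' | s' \<in> states t \<and> step t s' s. (\<Prod>p<k t. q ^ s' p) * path_sum t s')"

definition rows :: "nat \<Rightarrow> nat set" where
  "rows t = (if t \<le> L then {..<k t} else row_of ` {..<k t})"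

lemma row_of_less: "p < p' \<Longrightarrow> row_of p < row_of p'"
  using r_le by (auto simp: row_of_def)

lemma row_of_inverse: "particle_of (row_of p) = p"
  using r_le by (auto simp: row_of_def particle_of_def)

lemma row_of_bound: "p < m \<Longrightarrow> row_of p < n + m - r"
  using r_le by (auto simp: row_of_def)

lemma k_upper_range:
  assumes "t \<le> L" shows "r \<le> k t" "k t \<le> n"
proof -
  show "k t \<le> n" using assms
  proof (induction t)
    case (Suc t)
    then show ?case using k_upper[of t] by force
  qed (simp add: k_ends)
  show "r \<le> k t" using assms
  proof (induction rule: inc_induct)
    case (step t)
    then show ?case using k_upper[of t] by force
  qed (simp add: k_ends)
qed

lemma k_lower_range:
  assumes "L \<le> t" "t \<le> 2 * L" shows "r \<le> k t" "k t \<le> m"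
proof -
  show "r \<le> k t" using assms
  proof (induction rule: dec_induct)
    case (step t)
    then show ?case using k_lower[of t] by force
  qed (simp add: k_ends)
  show "k t \<le> m" using assms(2,1)
  proof (induction rule: inc_induct)
    case (step t)
    then show ?case using k_lower[of t] by force
  qed (simp add: k_ends)
qed

lemma rows_lower: "L \<le> t \<Longrightarrow> rows t = row_of ` {..<k t}"
  by (auto simp: rows_def k_ends row_of_def image_iff)

lemma amp_upper_right: "t \<le> L \<Longrightarrow> n \<le> j \<Longrightarrow> amp t x j = 0"
  by (induction t arbitrary: x) auto

lemma amp_unborn:
  assumes "L \<le> t" "t \<le> 2 * L" "k t \<le> p" shows "amp t x (row_of p) = 0"
  using assms
proof (induction t arbitrary: x rule: dec_induct)
  case base
  then show ?case using r_le by (simp add: amp_upper_right row_of_def k_ends)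
next
  case (step t)
  have "k t \<le> k (Suc t)" using k_lower[of t] step by force
  moreover have "row_of p = row_of (k t) \<Longrightarrow> p = k t" by (metis row_of_inverse)
  ultimately show ?case using step by auto
qed

lemma states_less:
  assumes "x \<in> states t" "p < p'" "p' < k t" shows "x p < x p'"
  using assms(2,3)
proof (induction p')
  case (Suc p')
  then have "x p' < x (Suc p')" using assms(1) by (simp add: states_def)
  then show ?case using Suc by (cases "p = p'") auto
qed simp

lemma states_le: "x \<in> states t \<Longrightarrow> p < k t \<Longrightarrow> x p \<le> H"
  by (auto simp: states_def PiE_iff)

text \<open>A missing neighbour is replaced by the ceiling. It serves as an inclusive bound here and
  as an exclusive one in \<open>ceil_below\<close>, hence \<open>H\<close> against
  \<open>Suc H\<close>.\<close>

definition ceil_above :: "nat \<Rightarrow> (nat \<Rightarrow> nat) \<Rightarrow> nat \<Rightarrow> nat" where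
  "ceil_above l x p = (if p < l then x p else H)"

definition ceil_below :: "nat \<Rightarrow> (nat \<Rightarrow> nat) \<Rightarrow> nat \<Rightarrow> nat" where
  "ceil_below l y p = (if p < l then y p else Suc H)"

text \<open>Given the next slice, the earlier particles range over independent intervals between its
  neighbouring positions; they increase strictly because these intervals are disjoint and
  ordered.\<close>

lemma states_step_upper:
  assumes t: "t < L" and x: "x \<in> states (Suc t)"
  shows "{y. y \<in> states t \<and> step t y x} =
    (\<Pi>\<^sub>E p\<in>{..<k t}. {if p = 0 then 0 else Suc (ceil_above (k (Suc t)) x (p - 1))..ceil_above (k (Suc t)) x p})"
    (is "?L = ?R")
proof (intro equalityI subsetI)
  fix y assume "y \<in> ?L"
  then have y: "y \<in> states t" "interlace (k t) (k (Suc t)) y x" using t by (auto simp: step_def)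
  show "y \<in> ?R"
  proof (rule PiE_I)
    fix p assume p: "p \<in> {..<k t}"
    then have "0 < p \<longrightarrow> p - 1 < k (Suc t)" using k_upper[OF t] by auto
    then show "y p \<in> {if p = 0 then 0 else Suc (ceil_above (k (Suc t)) x (p - 1))..ceil_above (k (Suc t)) x p}"
      using y p states_le[OF y(1), of p] by (auto simp: interlace_def ceil_above_def Suc_le_eq)
  qed (use y(1) in \<open>auto simp: states_def PiE_iff extensional_def\<close>)
next
  fix y assume y: "y \<in> ?R"
  have b: "y p \<le> ceil_above (k (Suc t)) x p" "0 < p \<Longrightarrow> ceil_above (k (Suc t)) x (p - 1) < y p" if "p < k t" for p
    using PiE_mem[OF y, of p] that by (auto split: if_splits)
  have ks: "p - 1 < k (Suc t)" if "p < k t" "0 < p" for p using k_upper[OF t] that by auto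
  have "y p < y (Suc p)" if "Suc p < k t" for p
    using b(1)[of p] b(2)[of "Suc p"] that by simp
  moreover have "y p \<le> H" if "p < k t" for p
    using b(1)[OF that] states_le[OF x, of p] by (auto simp: ceil_above_def split: if_splits)
  ultimately have "y \<in> states t" using y by (auto simp: states_def PiE_iff)
  moreover have "interlace (k t) (k (Suc t)) y x"
    using b ks by (force simp: interlace_def ceil_above_def split: if_splits)
  ultimately show "y \<in> ?L" using t by (simp add: step_def)
qed

lemma states_step_lower:
  assumes t: "L \<le> t" "t < 2 * L" and y: "y \<in> states (Suc t)"
  shows "{x. x \<in> states t \<and> step t x y} =
    (\<Pi>\<^sub>E p\<in>{..<k t}. {ceil_below (k (Suc t)) y p..<ceil_below (k (Suc t)) y (Suc p)})"
    (is "?L = ?R")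
proof (intro equalityI subsetI)
  fix x assume "x \<in> ?L"
  then have x: "x \<in> states t" "interlace (k (Suc t)) (k t) y x" using t by (auto simp: step_def)
  show "x \<in> ?R"
  proof (rule PiE_I)
    fix p assume p: "p \<in> {..<k t}"
    then have "p < k (Suc t)" using k_lower[OF t] by auto
    then show "x p \<in> {ceil_below (k (Suc t)) y p..<ceil_below (k (Suc t)) y (Suc p)}"
      using x p states_le[OF x(1), of p] by (force simp: interlace_def ceil_below_def)
  qed (use x(1) in \<open>auto simp: states_def PiE_iff extensional_def\<close>)
next
  fix x assume x: "x \<in> ?R"
  have kk: "p < k t \<Longrightarrow> p < k (Suc t)" for p using k_lower[OF t] by auto
  have b: "y p \<le> x p" "x p < ceil_below (k (Suc t)) y (Suc p)" if "p < k t" for p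
    using PiE_mem[OF x, of p] that kk[of p] by (auto simp: ceil_below_def)
  have "x p < x (Suc p)" if "Suc p < k t" for p
    using b(2)[of p] b(1)[of "Suc p"] that kk[of "Suc p"] by (simp add: ceil_below_def)
  moreover have "x p \<le> H" if "p < k t" for p
    using b(2)[OF that] states_le[OF y, of "Suc p"] by (auto simp: ceil_below_def split: if_splits)
  ultimately have "x \<in> states t" using x by (auto simp: states_def PiE_iff)
  moreover have "interlace (k (Suc t)) (k t) y x"
    unfolding interlace_def
  proof (intro allI impI conjI)
    fix p assume p: "p < k (Suc t)" "0 < p"
    then have "p - 1 < k t" using k_lower[OF t] by auto
    then show "x (p - 1) < y p" using b(2)[of "p - 1"] p by (simp add: ceil_below_def)
  qed (use b in auto)
  ultimately show "x \<in> ?L" using t by (simp add: step_def)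
qed

text \<open>Apart from unit rows this is the indicator matrix of two increasing families. At their
  first disagreement \<open>p\<close> it has a zero row or column: if \<open>s p\<close> is smaller
  it equals no \<open>N j\<close>, otherwise \<open>N p\<close> equals no
  \<open>s i\<close>.\<close>

lemma det_start:
  assumes s: "s \<in> states 0"
  shows "fdet (n + m - r) (\<lambda>i j. if i \<in> rows 0 then amp 0 (s (particle_of i)) j else rest i j) =
    (if s = restrict N {..<n} then 1 else 0)" (is "fdet _ ?A = _")
proof -
  have rows0: "rows 0 = {..<n}" by (simp add: rows_def k_ends)
  have nK: "n \<le> n + m - r" using r_le by simp
  show ?thesis
  proof (cases "s = restrict N {..<n}")
    case True
    have "N p = N p' \<longleftrightarrow> p = p'" if "p < n" "p' < n" for p p'
      using N_mono that by (metis less_irrefl linorder_neqE_nat)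
    then have "fdet (n + m - r) ?A = fdet (n + m - r) (\<lambda>i j. if i = j then 1 else 0)"
      by (intro fdet_cong) (auto simp: True rows0 particle_of_def rest_def)
    then show ?thesis using True by (simp add: fdet_identity)
  next
    case False
    have "\<exists>p<n. s p \<noteq> N p"
    proof (rule ccontr)
      assume "\<not> ?thesis"
      then have "s = restrict N {..<n}"
        using s by (intro ext) (auto simp: states_def k_ends PiE_iff extensional_def)
      then show False using False by simp
    qed
    then obtain p where p: "p < n" "s p \<noteq> N p" and min: "\<And>i. i < p \<Longrightarrow> s i = N i"
      using exists_least_iff[of "\<lambda>p. p < n \<and> s p \<noteq> N p"] by (metis order.strict_trans)
    have "fdet (n + m - r) ?A = 0"
    proof (cases "s p < N p")
      case True
      have "s p \<noteq> N j" if "j < n" for j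
      proof (cases j p rule: linorder_cases)
        case less
        then show ?thesis using states_less[OF s less] min[OF less] p by (simp add: k_ends)
      next
        case equal
        then show ?thesis using p by simp
      next
        case greater
        then show ?thesis using N_mono[OF greater that] True by simp
      qed
      then show ?thesis using p nK
        by (intro fdet_zero_row[of p]) (auto simp: rows0 particle_of_def)
    next
      case F: False
      have "s i \<noteq> N p" if "i < n" for i
      proof (cases i p rule: linorder_cases)
        case less
        then show ?thesis using N_mono[OF less p(1)] min[OF less] by simp
      next
        case equal
        then show ?thesis using p by simp
      next
        case greater
        then show ?thesis using states_less[OF s greater] that F p by (simp add: k_ends)
      qed
      then show ?thesis using p nK
        by (intro fdet_zero_column[of p]) (auto simp: rows0 particle_of_def rest_def)
    qed
    then show ?thesis using False by simp
  qed
qed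

text \<open>The claim is made for all slices \<open>s\<close>, not only for the prescribed final
  one, because the next summation needs the determinant as a function of all current
  positions.\<close>

lemma path_sum_det:
  assumes "t \<le> 2 * L" "s \<in> states t"
  shows "path_sum t s =
    fdet (n + m - r) (\<lambda>i j. if i \<in> rows t then amp t (s (particle_of i)) j else rest i j)"
  using assms
proof (induction t arbitrary: s)
  case 0
  then show ?case using det_start by simp
next
  case (Suc t)
  let ?K = "n + m - r"
  let ?D = "\<lambda>y. fdet ?K (\<lambda>i j. if i \<in> rows t then amp t (y (particle_of i)) j else rest i j)"
  have sum: "path_sum (Suc t) s = (\<Sum>y | y \<in> states t \<and> step t y s. (\<Prod>p<k t. q ^ y p) * ?D y)"
    using Suc by (auto intro!: sum.cong)
  show ?case
  proof (cases "t < L")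
    case True
    let ?x = "ceil_above (k (Suc t)) s"
    have kn: "k t \<le> n" "k (Suc t) \<le> n" using k_upper_range[of t] k_upper_range[of "Suc t"] True by auto
    have rows_t: "rows t = {..<k t}" "rows (Suc t) = {..<k (Suc t)}" using True by (auto simp: rows_def)
    have part: "i < k t \<Longrightarrow> particle_of i = i" for i using kn by (simp add: particle_of_def)
    have xmono: "?x p \<le> ?x (Suc p)" if "Suc p < k t" for p
      using states_less[OF Suc.prems(2), of p "Suc p"] states_le[OF Suc.prems(2), of p]
      by (auto simp: ceil_above_def)
    have "path_sum (Suc t) s =
        (\<Sum>y\<in>(\<Pi>\<^sub>E p\<in>{..<k t}. {if p = 0 then 0 else Suc (?x (p - 1))..?x p}).
          (\<Prod>p<k t. q ^ y p) * fdet ?K (\<lambda>i j. if i \<in> {..<k t} then amp t (y i) j else rest i j))"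
      unfolding sum states_step_upper[OF True Suc.prems(2)]
      by (intro sum.cong arg_cong2[of _ _ _ _ "(*)"] fdet_cong) (auto simp: rows_t part)
    also have "\<dots> = fdet ?K (\<lambda>i j. if i \<in> {..<k t} then (\<Sum>z\<le>?x i. q ^ z * amp t z j) else rest i j)"
    proof (rule fdet_sum_interlacing_below)
      show "k t \<le> ?K" using kn r_le by simp
    qed (rule xmono)
    also have "\<dots> = fdet ?K (\<lambda>i j. if i \<in> rows (Suc t) then amp (Suc t) (s (particle_of i)) j else rest i j)"
    proof (rule fdet_cong)
      fix i j
      have ex: "rest i j = amp (Suc t) H j" if "i < k t" "\<not> i < k (Suc t)"
      proof -
        have "i = k (Suc t)" using k_upper[OF True] that by linarith
        then have "\<tau> i = Suc t" using k_upper[OF True] that by auto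
        then show ?thesis using that kn by (simp add: rest_def del: amp.simps)
      qed
      have "k (Suc t) \<le> k t" using k_upper[OF True] by auto
      then show "(if i \<in> {..<k t} then (\<Sum>z\<le>?x i. q ^ z * amp t z j) else rest i j) =
          (if i \<in> rows (Suc t) then amp (Suc t) (s (particle_of i)) j else rest i j)"
        using ex True by (auto simp: rows_t ceil_above_def part)
    qed
    finally show ?thesis .
  next
    case False
    then have t: "L \<le> t" "t < 2 * L" using Suc.prems by auto
    let ?y = "ceil_below (k (Suc t)) s"
    let ?b = "of_bool (k (Suc t) \<noteq> k t) :: 'a"
    let ?c = "row_of (k t)"
    have km: "k t \<le> m" "k (Suc t) \<le> m" "r \<le> k t"
      using k_lower_range[of t] k_lower_range[of "Suc t"] t by auto
    have rows_t: "rows t = row_of ` {..<k t}" "rows (Suc t) = row_of ` {..<k (Suc t)}"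
      using t by (auto simp: rows_lower)
    have ymono: "?y p \<le> ?y (Suc p)" if "p < k t" for p
      using states_less[OF Suc.prems(2), of p "Suc p"] states_le[OF Suc.prems(2), of p]
      by (auto simp: ceil_below_def)
    have yT: "?y (k t) \<le> Suc H"
      using states_le[OF Suc.prems(2), of "k t"] by (auto simp: ceil_below_def)
    have A: "{..<k (Suc t)} = (if ?b = 0 \<and> ?y (k t) = Suc H then {..<k t} else {..k t})"
      using k_lower[OF t] by (auto simp: ceil_below_def)
    \<comment> \<open>Without a birth the boundary after the last particle is \<open>Suc H\<close>,
      the end of the whole range. With a birth, \<open>row_of (k t)\<close> is still a unit row and
      its column vanishes in all other rows.\<close>
    have birth: "?b = 0 \<and> ?y (k t) = Suc H \<or>
      ?c = ?c \<and> ?c < ?K \<and> (\<forall>j<?K. rest ?c j = (if j = ?c then ?b else 0)) \<and> (\<forall>v. amp t v ?c = 0) \<and>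
      (\<forall>i<?K. i \<notin> row_of ` {..k t} \<longrightarrow> rest i ?c = 0)"
    proof (cases "k (Suc t) = k t")
      case True
      then show ?thesis by (simp add: ceil_below_def)
    next
      case F: False
      then have ktm: "k t < m" "k (Suc t) = Suc (k t)" using k_lower[OF t] km by auto
      have cn: "n \<le> ?c" using km(3) by (simp add: row_of_def)
      have "rest i ?c = 0" if "i \<notin> row_of ` {..k t}" for i
      proof (cases "i < n")
        case True
        have "r \<le> i"
        proof (rule ccontr)
          assume "\<not> r \<le> i"
          then have "i = row_of i" "i \<le> k t" using km by (auto simp: row_of_def)
          then show False using that by blast
        qed
        \<comment> \<open>The count passes from \<open>n\<close> to \<open>r\<close>, so row
          \<open>i\<close> lost its particle at some step of the upper half, when all birth columns
          were still zero.\<close>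
        have "\<exists>t'<L. k (Suc t') \<le> i \<and> i < k t'"
        proof (rule ccontr)
          assume no: "\<not> ?thesis"
          have "i < k t'" if "t' \<le> L" for t'
            using that
          proof (induction t')
            case 0
            then show ?case using True by (simp add: k_ends)
          next
            case (Suc u)
            then show ?case using no by (metis Suc_le_eq Suc_leD not_le)
          qed
          from this[of L] show False using \<open>r \<le> i\<close> by (simp add: k_ends)
        qed
        then obtain t' where "t' < L" "k (Suc t') \<le> i" "i < k t'" by blast
        then have "\<tau> i = Suc t'" using k_upper[of t'] by (metis le_less_Suc_eq not_le)
        then show ?thesis using True \<open>t' < L\<close> cn amp_upper_right[of "Suc t'" ?c H]
          by (simp add: rest_def del: amp.simps)
      next
        case False
        then show ?thesis using that by (auto simp: rest_def)
      qed
      then show ?thesis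
        using F cn row_of_bound[OF ktm(1)] amp_unborn[OF t(1), of "k t"] t by (auto simp: rest_def)
    qed
    have "path_sum (Suc t) s = (\<Sum>x\<in>(\<Pi>\<^sub>E p\<in>{..<k t}. {?y p..<?y (Suc p)}).
          (\<Prod>p<k t. q ^ x p) *
          fdet ?K (\<lambda>i j. if i \<in> row_of ` {..<k t} then amp t (x (particle_of i)) j else rest i j))"
      unfolding sum states_step_lower[OF t Suc.prems(2)] by (simp add: rows_t)
    also have "\<dots> = fdet ?K (\<lambda>i j. if i \<in> row_of ` {..<k (Suc t)}
        then (\<Sum>z\<in>{?y (particle_of i)..<Suc H}. q ^ z * amp t z j) + (if j = ?c then ?b else 0) else rest i j)"
    proof (rule fdet_sum_interlacing_above)
      show "strict_mono_on {..k t} row_of" using row_of_less by (simp add: strict_mono_on_def)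
      show "row_of p < ?K" if "p < k t" for p using row_of_bound[of p] that km by simp
      show "particle_of (row_of p) = p" for p by (rule row_of_inverse)
    qed (use ymono yT birth A in blast)+
    also have "\<dots> = fdet ?K (\<lambda>i j. if i \<in> rows (Suc t) then amp (Suc t) (s (particle_of i)) j else rest i j)"
      using t by (intro fdet_cong) (auto simp: rows_t row_of_inverse ceil_below_def)
    finally show ?thesis .
  qed
qed

end

section \<open>Single path weights\<close>

definition qpoch :: "'a::field \<Rightarrow> nat \<Rightarrow> 'a" where
  "qpoch q k = (\<Prod>i<k. 1 - q ^ Suc i)"

text \<open>The Gaussian binomial coefficient with top \<open>s + k\<close> and bottom
  \<open>k\<close>. It counts weakly monotone sequences of \<open>s\<close> values in
  \<open>0..k\<close> by their sum, hence paths with \<open>s\<close> free positions.\<close>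

definition qbin :: "'a::field \<Rightarrow> nat \<Rightarrow> nat \<Rightarrow> 'a" where
  "qbin q s k = qpoch q (s + k) / (qpoch q s * qpoch q k)"

lemma qpoch_0 [simp]: "qpoch q 0 = 1"
  by (simp add: qpoch_def)

lemma qpoch_Suc: "qpoch q (Suc k) = (1 - q ^ Suc k) * qpoch q k"
  by (simp add: qpoch_def)

context
  fixes q :: "'a::field"
  assumes q: "\<And>i. q ^ Suc i \<noteq> 1"
begin

lemma qpoch_nonzero: "qpoch q k \<noteq> 0"
  using q by (auto simp: qpoch_def simp del: power_Suc)

lemma qbin_0: "qbin q 0 k = 1" "qbin q s 0 = 1"
  using qpoch_nonzero by (auto simp: qbin_def)

text \<open>Up to a common factor the two rules are \<open>1 - u * v = (1 - v) + v * (1 - u)\<close>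
  and \<open>1 - u * v = (1 - u) + u * (1 - v)\<close>.\<close>

lemma qbin_pascal:
  shows "qbin q (Suc s) (Suc k) = qbin q (Suc s) k + q ^ Suc k * qbin q s (Suc k)"
    and "qbin q (Suc s) (Suc k) = qbin q s (Suc k) + q ^ Suc s * qbin q (Suc s) k"
proof -
  define u v w where "u = q ^ Suc s" and "v = q ^ Suc k" and "w = qpoch q (Suc (s + k))"
  have "1 - u \<noteq> 0" "1 - v \<noteq> 0" using q by (auto simp: u_def v_def simp del: power_Suc)
  moreover have "qpoch q (Suc s + Suc k) = (1 - u * v) * w"
    by (simp add: u_def v_def w_def qpoch_Suc[of _ "Suc _"] power_add)
  moreover have "qpoch q (Suc s + k) = w" "qpoch q (s + Suc k) = w" by (simp_all add: w_def)
  moreover have "qpoch q (Suc s) = (1 - u) * qpoch q s" "qpoch q (Suc k) = (1 - v) * qpoch q k"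
    by (simp_all add: u_def v_def qpoch_Suc)
  moreover note qpoch_nonzero[of s] qpoch_nonzero[of k]
  ultimately show "qbin q (Suc s) (Suc k) = qbin q (Suc s) k + q ^ Suc k * qbin q s (Suc k)"
    and "qbin q (Suc s) (Suc k) = qbin q s (Suc k) + q ^ Suc s * qbin q (Suc s) k"
    unfolding qbin_def u_def[symmetric] v_def[symmetric] by (simp_all add: divide_simps) (simp_all add: algebra_simps)
qed

lemma qbin_sum_left: "(\<Sum>y\<le>k. q ^ y * qbin q s y) = qbin q (Suc s) k"
  by (induction k) (simp_all add: qbin_0 qbin_pascal(1))

text \<open>The sequences are split by their smallest value \<open>y\<close>, which is subtracted
  from all \<open>Suc s\<close> values; \<open>qbin_sum_left\<close> splits them by the largest
  value.\<close>

lemma qbin_sum_right: "(\<Sum>y\<le>k. q ^ (Suc s * y) * qbin q s (k - y)) = qbin q (Suc s) k"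
proof (induction k)
  case (Suc k)
  have "(\<Sum>y\<le>Suc k. q ^ (Suc s * y) * qbin q s (Suc k - y)) =
      qbin q s (Suc k) + q ^ Suc s * (\<Sum>y\<le>k. q ^ (Suc s * y) * qbin q s (k - y))"
    by (subst sum.atMost_Suc_shift) (simp add: sum_distrib_left power_add mult_ac)
  then show ?case by (simp only: Suc.IH qbin_pascal(2))
qed (simp add: qbin_0)

end

locale slices_field = slices n m r L H k N \<tau> q
  for n m r L H :: nat and k :: "nat \<Rightarrow> nat" and N \<tau> :: "nat \<Rightarrow> nat" and q :: "'a::field" +
  assumes q_not_root: "\<And>i. q ^ Suc i \<noteq> 1"
begin

text \<open>The path has \<open>Suc t\<close> weighted positions, the first being
  \<open>N j\<close>. Lowering all of them by \<open>N j\<close> leaves \<open>t\<close> free weakly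
  increasing values in \<open>0..x - N j\<close>.\<close>

lemma amp_upper:
  assumes "t < L" "j < n"
  shows "amp (Suc t) x j = (if N j \<le> x then q ^ (Suc t * N j) * qbin q t (x - N j) else 0)"
  using assms
proof (induction t arbitrary: x)
  case 0
  have "amp (Suc 0) x j = (\<Sum>z\<le>x. if z = N j then q ^ z else 0)"
    using 0 by (simp add: if_distrib[of "(*) _"] cong: if_cong)
  then show ?case using qbin_0[OF q_not_root] by simp
next
  case (Suc t)
  have "amp (Suc (Suc t)) x j = (\<Sum>z\<le>x. q ^ z * (if N j \<le> z then q ^ (Suc t * N j) * qbin q t (z - N j) else 0))"
    using Suc by (subst amp.simps(2)) (auto simp del: amp.simps intro!: sum.cong)
  also have "\<dots> = (\<Sum>z\<in>{N j..x}. q ^ z * (q ^ (Suc t * N j) * qbin q t (z - N j)))"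
    by (rule sum.mono_neutral_cong_right) auto
  also have "\<dots> = (if N j \<le> x then q ^ (Suc (Suc t) * N j) * (\<Sum>y\<le>x - N j. q ^ y * qbin q t y) else 0)"
  proof (cases "N j \<le> x")
    case True
    have "(\<Sum>z\<in>{N j..x}. q ^ z * (q ^ (Suc t * N j) * qbin q t (z - N j))) =
        (\<Sum>y\<le>x - N j. q ^ (N j + y) * (q ^ (Suc t * N j) * qbin q t y))"
      by (rule sum.reindex_bij_witness[where i = "\<lambda>y. N j + y" and j = "\<lambda>z. z - N j"]) (use True in auto)
    then show ?thesis using True by (simp add: sum_distrib_left power_add mult_ac)
  qed auto
  finally show ?case using qbin_sum_left[OF q_not_root] by simp
qed

text \<open>Here \<open>x\<close> is the position on the main diagonal. Between it and the end
  \<open>y\<close> there are \<open>s\<close> free positions in \<open>y..x\<close>, lowered by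
  \<open>y\<close> to form the q-binomial.\<close>

lemma amp_lower_left:
  assumes "L + Suc s \<le> 2 * L" "j < n"
  shows "amp (L + Suc s) y j = (\<Sum>x\<in>{y..<Suc H}. q ^ x * amp L x j * (q ^ (s * y) * qbin q s (x - y)))"
  using assms
proof (induction s arbitrary: y)
  case 0
  have "j \<noteq> row_of (k L)" using 0 r_le by (simp add: k_ends row_of_def)
  then show ?case using qbin_0[OF q_not_root] by simp
next
  case (Suc s)
  have "r \<le> k (L + Suc s)" using k_lower_range(1)[of "L + Suc s"] Suc.prems by simp
  then have j: "j \<noteq> row_of (k (L + Suc s))" using Suc.prems r_le by (auto simp: row_of_def)
  have "amp (L + Suc (Suc s)) y j = (\<Sum>z\<in>{y..<Suc H}. q ^ z * amp (L + Suc s) z j)"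
    using j by simp
  also have "\<dots> = (\<Sum>z\<in>{y..<Suc H}. \<Sum>x\<in>{z..<Suc H}. q ^ z * (q ^ x * amp L x j * (q ^ (s * z) * qbin q s (x - z))))"
    using Suc.IH Suc.prems by (simp add: sum_distrib_left del: amp.simps sum.op_ivl_Suc)
  also have "\<dots> = (\<Sum>x\<in>{y..<Suc H}. \<Sum>z\<in>{y..x}. q ^ z * (q ^ x * amp L x j * (q ^ (s * z) * qbin q s (x - z))))"
    by (subst sum.Sigma, simp, simp, subst sum.Sigma, simp, simp)
      (rule sum.reindex_bij_witness[where i = "\<lambda>(x, z). (z, x)" and j = "\<lambda>(z, x). (x, z)"]; auto)
  also have "\<dots> = (\<Sum>x\<in>{y..<Suc H}. q ^ x * amp L x j * (q ^ (Suc s * y) * qbin q (Suc s) (x - y)))"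
  proof (rule sum.cong[OF refl])
    fix x assume x: "x \<in> {y..<Suc H}"
    have "(\<Sum>z\<in>{y..x}. q ^ z * (q ^ x * amp L x j * (q ^ (s * z) * qbin q s (x - z)))) =
        (\<Sum>u\<le>x - y. q ^ (y + u) * (q ^ x * amp L x j * (q ^ (s * (y + u)) * qbin q s (x - y - u))))"
      by (rule sum.reindex_bij_witness[where i = "\<lambda>u. y + u" and j = "\<lambda>z. z - y"]) (use x in auto)
    also have "\<dots> = q ^ x * amp L x j * (q ^ (Suc s * y) * (\<Sum>u\<le>x - y. q ^ (Suc s * u) * qbin q s (x - y - u)))"
      by (simp add: sum_distrib_left power_add distrib_left mult_ac)
    finally show "(\<Sum>z\<in>{y..x}. q ^ z * (q ^ x * amp L x j * (q ^ (s * z) * qbin q s (x - z)))) =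
        q ^ x * amp L x j * (q ^ (Suc s * y) * qbin q (Suc s) (x - y))"
      unfolding qbin_sum_right[OF q_not_root] .
  qed
  finally show ?case .
qed

text \<open>A newborn particle behaves like one released from the ceiling: its \<open>s\<close>
  weighted positions range over the weakly decreasing sequences in \<open>y..H\<close>.\<close>

lemma amp_born:
  assumes t: "L \<le> t" "k t = p" "k (Suc t) = Suc p"
    and "Suc t + s \<le> 2 * L" "y \<le> H"
  shows "amp (Suc t + s) y (row_of p) = q ^ (s * y) * qbin q s (H - y)"
  using assms(4,5)
proof (induction s arbitrary: y)
  case 0
  then have "amp t z (row_of p) = 0" for z using amp_unborn[of t p z] t by simp
  then show ?case using t qbin_0[OF q_not_root] by simp
next
  case (Suc s)
  have "Suc p \<le> k (Suc t + s)"
    using Suc.prems(1)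
  proof (induction s)
    case (Suc s)
    then show ?case using k_lower[of "Suc t + s"] t(1) by force
  qed (simp add: t)
  then have j: "row_of p \<noteq> row_of (k (Suc t + s))" using row_of_inverse by (metis not_less_eq_eq order_refl)
  have "amp (Suc t + Suc s) y (row_of p) = (\<Sum>z\<in>{y..<Suc H}. q ^ z * amp (Suc t + s) z (row_of p))"
    by (subst add_Suc_right, subst amp.simps(2)) (use j t in simp)
  also have "\<dots> = (\<Sum>z\<in>{y..H}. q ^ z * (q ^ (s * z) * qbin q s (H - z)))"
    using Suc by (intro sum.cong) (auto simp del: amp.simps)
  also have "\<dots> = (\<Sum>u\<le>H - y. q ^ (y + u) * (q ^ (s * (y + u)) * qbin q s (H - y - u)))"
    by (rule sum.reindex_bij_witness[where i = "\<lambda>u. y + u" and j = "\<lambda>z. z - y"]) (use Suc in auto)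
  also have "\<dots> = q ^ (Suc s * y) * (\<Sum>u\<le>H - y. q ^ (Suc s * u) * qbin q s (H - y - u))"
    by (simp add: sum_distrib_left power_add distrib_left mult_ac)
  finally show ?case unfolding qbin_sum_right[OF q_not_root] .
qed

end

section \<open>Expansion of the recursive sum into whole particle histories\<close>

context slices
begin

definition chains :: "nat \<Rightarrow> (nat \<Rightarrow> nat) \<Rightarrow> (nat \<Rightarrow> nat \<Rightarrow> nat) set" where
  "chains t s = {X \<in> (\<Pi>\<^sub>E u\<in>{..t}. states u).
     X 0 = restrict N {..<n} \<and> X t = s \<and> (\<forall>u<t. step u (X u) (X (Suc u)))}"

lemma finite_states: "finite (states t)"
proof (rule finite_subset)
  show "states t \<subseteq> {..<k t} \<rightarrow>\<^sub>E {..H}" by (auto simp: states_def)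
qed (auto intro: finite_PiE)

lemma finite_chains: "finite (chains t s)"
proof (rule finite_subset)
  show "chains t s \<subseteq> (\<Pi>\<^sub>E u\<in>{..t}. states u)" by (auto simp: chains_def)
qed (auto intro: finite_PiE finite_states)

lemma path_sum_chains:
  assumes "s \<in> states t"
  shows "path_sum t s = (\<Sum>X\<in>chains t s. \<Prod>u<t. \<Prod>p<k u. q ^ X u p)"
  using assms
proof (induction t arbitrary: s)
  case 0
  show ?case
  proof (cases "s = restrict N {..<n}")
    case True
    have "chains 0 s = {\<lambda>u\<in>{..0}. s}"
    proof (intro equalityI subsetI)
      fix X assume "X \<in> chains 0 s"
      then have "X \<in> extensional {..0}" "X 0 = s" by (auto simp: chains_def PiE_def)
      then show "X \<in> {\<lambda>u\<in>{..0}. s}" by (auto simp: extensional_def)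
    qed (use 0 True[symmetric] in \<open>simp add: chains_def\<close>)
    then have "(\<Sum>X\<in>chains 0 s. \<Prod>u<0. \<Prod>p<k u. q ^ X u p) = 1" by simp
    moreover have "path_sum 0 s = 1" by (simp only: path_sum.simps True simp_thms if_True)
    ultimately show ?thesis by (simp only:)
  next
    case False
    then have "chains 0 s = {}" by (auto simp: chains_def)
    then show ?thesis using False by simp
  qed
next
  case (Suc t)
  let ?S = "{s'. s' \<in> states t \<and> step t s' s}"
  have "path_sum (Suc t) s = (\<Sum>s'\<in>?S. \<Sum>X\<in>chains t s'. (\<Prod>u<Suc t. \<Prod>p<k u. q ^ X u p))"
    using Suc.IH by (auto simp: sum_distrib_left chains_def mult_ac intro!: sum.cong)
  also have "\<dots> = (\<Sum>(s', X)\<in>(SIGMA s':?S. chains t s'). (\<Prod>u<Suc t. \<Prod>p<k u. q ^ X u p))"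
    by (rule sum.Sigma) (auto simp: finite_chains intro: finite_subset[OF _ finite_states])
  also have "\<dots> = (\<Sum>X\<in>chains (Suc t) s. \<Prod>u<Suc t. \<Prod>p<k u. q ^ X u p)"
  proof (rule sum.reindex_bij_witness[where j = "\<lambda>(s', X). X(Suc t := s)" and i = "\<lambda>X. (X t, restrict X {..t})"])
    fix z assume z: "z \<in> (SIGMA s':?S. chains t s')"
    obtain s' X where zX: "z = (s', X)" by force
    then have X: "X \<in> extensional {..t}" "\<And>u. u \<le> t \<Longrightarrow> X u \<in> states u" "X 0 = restrict N {..<n}" "X t = s'"
      "\<And>u. u < t \<Longrightarrow> step u (X u) (X (Suc u))" "step t s' s"
      using z by (auto simp: chains_def PiE_iff)
    show "(case z of (s', X) \<Rightarrow> X(Suc t := s)) \<in> chains (Suc t) s"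
      using X Suc.prems by (auto simp: zX chains_def PiE_iff extensional_def less_Suc_eq)
    show "((case z of (s', X) \<Rightarrow> X(Suc t := s)) t, restrict (case z of (s', X) \<Rightarrow> X(Suc t := s)) {..t}) = z"
      using X by (auto simp: zX extensional_def)
    show "(\<Prod>u<Suc t. \<Prod>p<k u. q ^ (case z of (s', X) \<Rightarrow> X(Suc t := s)) u p) =
        (case z of (s', X) \<Rightarrow> \<Prod>u<Suc t. \<Prod>p<k u. q ^ X u p)"
      by (simp add: zX)
  next
    fix X assume X: "X \<in> chains (Suc t) s"
    show "(case (X t, restrict X {..t}) of (s', X) \<Rightarrow> X(Suc t := s)) = X"
      using X by (auto simp: chains_def PiE_iff extensional_def fun_eq_iff)
    show "(X t, restrict X {..t}) \<in> (SIGMA s':?S. chains t s')"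
      using X by (auto simp: chains_def PiE_iff)
  qed
  finally show ?case .
qed

end

section \<open>The determinant of a truncated pit\<close>

lemma fls_X_power_neq_1: "(fls_X :: 'a::field fls) ^ Suc i \<noteq> 1"
proof
  assume "(fls_X :: 'a fls) ^ Suc i = 1"
  then have "fls_subdegree ((fls_X :: 'a fls) ^ Suc i) = fls_subdegree (1 :: 'a fls)" by (rule arg_cong)
  then show False by (simp add: fls_subdegree_pow del: power_Suc)
qed

text \<open>At most one index has value exactly \<open>d\<close>, and it must be the first one
  outside the sublevel set. This is why at most one particle dies or is born per diagonal.\<close>

lemma sublevel_count_step:
  fixes f :: "nat \<Rightarrow> int"
  assumes f: "\<And>p p'. p < p' \<Longrightarrow> p' < b \<Longrightarrow> f p < f p'"
    and c: "\<And>p. p < b \<and> f p < d \<longleftrightarrow> p < c"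
  shows "(\<forall>p. p < b \<and> f p < d + 1 \<longleftrightarrow> p < c) \<or>
    (\<forall>p. p < b \<and> f p < d + 1 \<longleftrightarrow> p < Suc c) \<and> c < b \<and> f c = d"
proof (cases "c < b \<and> f c < d + 1")
  case True
  then have d: "f c = d" using c[of c] by auto
  have "p < b \<and> f p < d + 1 \<longleftrightarrow> p < Suc c" for p
    using c[of p] f[of c p] d True by (cases p c rule: linorder_cases) auto
  then show ?thesis using True d by blast
next
  case False
  have "p < b \<and> f p < d + 1 \<longleftrightarrow> p < c" for p
    using c[of p] f[of c p] False by (cases p c rule: linorder_cases) auto
  then show ?thesis by blast
qed

text \<open>\<open>P p\<close> and \<open>Q p\<close> are the last diagonals, above and below the main one, on which the cell with
  index \<open>p\<close> is infinite; they are negative for the indices that are finite on the main diagonal.\<close>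

locale truncated_pit =
  fixes n m r L H :: nat and N M :: "nat \<Rightarrow> nat" and P Q :: "nat \<Rightarrow> int"
  assumes r_le_n: "r \<le> n" and r_le_m: "r \<le> m" and L_pos: "0 < L"
    and N_less: "\<And>p p'. p < p' \<Longrightarrow> p' < n \<Longrightarrow> N p < N p'"
    and M_less: "\<And>p p'. p < p' \<Longrightarrow> p' < m \<Longrightarrow> M p < M p'"
    and P_less: "\<And>p p'. p < p' \<Longrightarrow> p' < n \<Longrightarrow> P p < P p'"
    and Q_less: "\<And>p p'. p < p' \<Longrightarrow> p' < m \<Longrightarrow> Q p < Q p'"
    and N_bound: "\<And>p. p < n \<Longrightarrow> N p \<le> H"
    and M_bound: "\<And>p. p < m \<Longrightarrow> M p \<le> H"
    and P_neg: "\<And>p. p < n \<Longrightarrow> P p < 0 \<longleftrightarrow> p < r"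
    and Q_neg: "\<And>p. p < m \<Longrightarrow> Q p < 0 \<longleftrightarrow> p < r"
    and P_bound: "\<And>p. p < n \<Longrightarrow> P p < int L"
    and Q_bound: "\<And>p. p < m \<Longrightarrow> Q p < int L"
begin

definition alive :: "nat \<Rightarrow> nat \<Rightarrow> bool" where
  "alive t p \<longleftrightarrow> (if t \<le> L then p < n \<and> P p < int L - int t else p < m \<and> Q p < int t - int L)"

text \<open>The living indices form an initial segment because \<open>P\<close> and \<open>Q\<close>
  increase, so the least dead index is their number.\<close>

definition count :: "nat \<Rightarrow> nat" where "count t = (LEAST p. \<not> alive t p)"

definition death :: "nat \<Rightarrow> nat" where "death p = nat (int L - P p)"

lemma alive_mid: "t = L \<Longrightarrow> alive t p \<longleftrightarrow> p < r"
  using P_neg r_le_n by (force simp: alive_def)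

lemma alive_lower: "L \<le> t \<Longrightarrow> alive t p \<longleftrightarrow> p < m \<and> Q p < int t - int L"
  using alive_mid[of t p] Q_neg[of p] r_le_m by (cases "t = L") (auto simp: alive_def)

lemma less_count: "p < count t \<longleftrightarrow> alive t p"
proof
  assume "alive t p"
  then have "alive t p'" if "p' \<le> p" for p'
    using that P_less[of p' p] Q_less[of p' p] by (cases "p' = p") (auto simp: alive_def split: if_splits)
  moreover have "\<not> alive t (n + m)" using r_le_n r_le_m by (auto simp: alive_def)
  then have "\<not> alive t (count t)" unfolding count_def by (rule LeastI)
  ultimately show "p < count t" using not_le by blast
next
  show "p < count t \<Longrightarrow> alive t p" unfolding count_def using not_less_Least by blast
qed

lemma count_eqI: "(\<And>p. alive t p \<longleftrightarrow> p < c) \<Longrightarrow> count t = c"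
  by (metis less_count less_irrefl linorder_neqE_nat)

sublocale slices n m r L H count N death "fls_X :: rat fls"
proof
  show "count 0 = n" using P_bound by (intro count_eqI) (auto simp: alive_def)
  show "count L = r" by (intro count_eqI alive_mid) simp
  show "count (2 * L) = m" using Q_bound L_pos by (intro count_eqI) (auto simp: alive_def)
  fix t
  show "count t = count (Suc t) \<or> count t = Suc (count (Suc t)) \<and> death (count (Suc t)) = Suc t" if t: "t < L"
  proof -
    define c where "c = count (Suc t)"
    have c: "p < n \<and> P p < int L - int t - 1 \<longleftrightarrow> p < c" for p
      using less_count[of p "Suc t"] t by (auto simp: c_def alive_def)
    have al: "alive t p \<longleftrightarrow> p < n \<and> P p < int L - int t - 1 + 1" for p using t by (simp add: alive_def)
    from sublevel_count_step[of n P, OF P_less c]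
    have "count t = c \<or> count t = Suc c \<and> P c = int L - int t - 1"
      unfolding al[symmetric] by (auto intro: count_eqI)
    then show ?thesis by (auto simp: c_def death_def)
  qed
  show "count (Suc t) = count t \<or> count (Suc t) = Suc (count t)" if t: "L \<le> t" "t < 2 * L"
  proof -
    define c where "c = count t"
    have c: "p < m \<and> Q p < int t - int L \<longleftrightarrow> p < c" for p
      using less_count[of p t] t alive_lower by (auto simp: c_def)
    have al: "alive (Suc t) p \<longleftrightarrow> p < m \<and> Q p < int t - int L + 1" for p using t alive_lower by auto
    from sublevel_count_step[of m Q, OF Q_less c]
    have "count (Suc t) = c \<or> count (Suc t) = Suc c"
      unfolding al[symmetric] by (auto intro: count_eqI)
    then show ?thesis by (simp add: c_def)
  qed
qed (use r_le_n r_le_m N_less N_bound in auto)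

sublocale slices_field n m r L H count N death "fls_X :: rat fls"
  by unfold_locales (rule fls_X_power_neq_1)

lemma M_state: "restrict M {..<m} \<in> states (2 * L)"
  using M_bound M_less by (auto simp: states_def k_ends)

text \<open>The sum over the position \<open>x\<close> on the main diagonal. The two q-binomials
  account for the \<open>L - 1\<close> free positions before and after the crossing.\<close>

definition meet :: "nat \<Rightarrow> nat \<Rightarrow> rat fls" where
  "meet p j = (\<Sum>x\<in>{M p..<Suc H}. if N j \<le> x
     then fls_X ^ (x - N j) * (qbin fls_X (L - 1) (x - N j) * qbin fls_X (L - 1) (x - M p)) else 0)"

text \<open>The final amplitudes without a factor \<open>fls_X ^ ((L + 1) * N j)\<close> per column
  \<open>j < n\<close> and a factor \<open>fls_X ^ ((L - 1) * M p)\<close> per row of a final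
  particle; these powers are later cancelled by the asymptotic positions.\<close>

definition entry :: "nat \<Rightarrow> nat \<Rightarrow> rat fls" where
  "entry i j =
    (if r \<le> i \<and> i < n then
       (if j < n then fls_X powi (- (int (N j) * (P i + 1))) * qbin fls_X (nat (int L - P i - 1)) (H - N j) else 0)
     else if j < n then meet (particle_of i) j
     else fls_X powi (- (int (M (particle_of i)) * Q (particle_of j))) *
        qbin fls_X (nat (int L - Q (particle_of j) - 1)) (H - M (particle_of i)))"

lemma rows_end: "rows (2 * L) = {..<n + m - r} - {r..<n}"
proof -
  have "row_of ` {..<m} = {..<n + m - r} - {r..<n}"
  proof (intro equalityI subsetI)
    fix i assume i: "i \<in> {..<n + m - r} - {r..<n}"
    then have "i = row_of (particle_of i)" "particle_of i < m"
      using r_le by (auto simp: row_of_def particle_of_def)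
    then show "i \<in> row_of ` {..<m}" by blast
  qed (use r_le in \<open>auto simp: row_of_def split: if_splits\<close>)
  then show ?thesis by (simp add: rows_lower k_ends)
qed

lemma amp_final_meet:
  assumes "p < m" "j < n"
  shows "amp (2 * L) (M p) j = fls_X ^ ((L - 1) * M p) * fls_X ^ ((L + 1) * N j) * meet p j"
proof -
  obtain L' where L: "L = Suc L'" using L_pos gr0_implies_Suc by blast
  have "amp (2 * L) (M p) j =
      (\<Sum>x\<in>{M p..<Suc H}. fls_X ^ x * amp L x j * (fls_X ^ (L' * M p) * qbin fls_X L' (x - M p)))"
    using amp_lower_left[of L' j "M p"] assms by (simp add: L mult_2)
  also have "\<dots> = (\<Sum>x\<in>{M p..<Suc H}. fls_X ^ ((L - 1) * M p) * fls_X ^ ((L + 1) * N j) * (if N j \<le> x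
     then fls_X ^ (x - N j) * (qbin fls_X (L - 1) (x - N j) * qbin fls_X (L - 1) (x - M p)) else 0))"
  proof (rule sum.cong[OF refl])
    fix x
    have *: "amp L x j = (if N j \<le> x then fls_X ^ (L * N j) * qbin fls_X L' (x - N j) else 0)"
      using amp_upper[of L' j x] assms by (simp add: L del: amp.simps)
    \<comment> \<open>Splitting the weight of the main diagonal as \<open>N j + (x - N j)\<close>
      raises the multiple of \<open>N j\<close> from \<open>L\<close> to
      \<open>L + 1\<close>.\<close>
    have "(fls_X :: rat fls) ^ x = fls_X ^ N j * fls_X ^ (x - N j)" if "N j \<le> x"
      using that by (simp flip: power_add)
    then show "fls_X ^ x * amp L x j * (fls_X ^ (L' * M p) * qbin fls_X L' (x - M p)) =
        fls_X ^ ((L - 1) * M p) * fls_X ^ ((L + 1) * N j) * (if N j \<le> x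
          then fls_X ^ (x - N j) * (qbin fls_X (L - 1) (x - N j) * qbin fls_X (L - 1) (x - M p)) else 0)"
      unfolding * using L by (simp add: power_add mult_ac)
  qed
  finally show ?thesis by (simp only: meet_def sum_distrib_left)
qed

lemma fls_X_powi_add: "fls_X powi (a + b) = (fls_X powi a * fls_X powi b :: rat fls)"
  by (rule power_int_add) simp

lemma amp_final_born:
  assumes "p < m" "r \<le> p'" "p' < m"
  shows "amp (2 * L) (M p) (row_of p') = fls_X ^ ((L - 1) * M p) *
    (fls_X powi (- (int (M p) * Q p')) * qbin fls_X (nat (int L - Q p' - 1)) (H - M p))"
proof -
  \<comment> \<open>Time \<open>t\<close> is diagonal \<open>- Q p'\<close>, the last one on which
    the cell is infinite, so the birth is at \<open>Suc t\<close> and \<open>s\<close> steps remain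
    until \<open>2 * L\<close>.\<close>
  define t where "t = L + nat (Q p')"
  define s where "s = nat (int L - Q p' - 1)"
  have Q: "0 \<le> Q p'" "Q p' < int L" using Q_neg[OF assms(3)] Q_bound[OF assms(3)] assms by auto
  have t: "int t = int L + Q p'" "L \<le> t" "2 * L = Suc t + s" using Q by (auto simp: t_def s_def)
  have less: "p < p' \<longleftrightarrow> p < m \<and> Q p < Q p'" "p < Suc p' \<longleftrightarrow> p < m \<and> Q p < Q p' + 1" for p
    using Q_less[of p p'] Q_less[of p' p] assms(3) by (cases p p' rule: linorder_cases; force)+
  have "alive t p \<longleftrightarrow> p < p'" for p
    unfolding alive_lower[OF t(2)] less(1)[of p] using t(1) by simp
  moreover have "alive (Suc t) p \<longleftrightarrow> p < Suc p'" for p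
    unfolding alive_lower[OF le_SucI[OF t(2)]] less(2)[of p] using t(1) by auto
  ultimately have "count t = p'" "count (Suc t) = Suc p'" by (auto intro: count_eqI)
  then have "amp (2 * L) (M p) (row_of p') = fls_X ^ (s * M p) * qbin fls_X s (H - M p)"
    using amp_born[OF t(2), of p' s "M p"] t(3) M_bound[OF assms(1)] by (metis order_refl)
  also have "(fls_X :: rat fls) ^ (s * M p) = fls_X powi (int ((L - 1) * M p) + - (int (M p) * Q p'))"
  proof -
    have "int (s * M p) = int ((L - 1) * M p) + - (int (M p) * Q p')"
      using Q L_pos by (simp add: s_def of_nat_diff algebra_simps)
    then show ?thesis by (metis power_int_of_nat)
  qed
  finally show ?thesis by (simp only: fls_X_powi_add power_int_of_nat s_def mult.assoc)
qed

text \<open>The particle is weighted at \<open>L - P i\<close> times; writing this as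
  \<open>(L + 1) - (P i + 1)\<close> separates the column factor from the exponent of the border
  block.\<close>

lemma amp_dead:
  assumes "r \<le> i" "i < n" "j < n"
  shows "amp (death i) H j = fls_X ^ ((L + 1) * N j) *
    (fls_X powi (- (int (N j) * (P i + 1))) * qbin fls_X (nat (int L - P i - 1)) (H - N j))"
proof -
  define s where "s = nat (int L - P i - 1)"
  have P: "0 \<le> P i" "P i < int L" using P_neg[OF assms(2)] P_bound[OF assms(2)] assms by auto
  have s: "death i = Suc s" "s < L" "int s = int L - P i - 1" using P by (auto simp: s_def death_def)
  have "amp (death i) H j = fls_X ^ (Suc s * N j) * qbin fls_X s (H - N j)"
    unfolding s(1) using amp_upper[OF s(2) assms(3), of H] N_bound[OF assms(3)] by simp
  also have "(fls_X :: rat fls) ^ (Suc s * N j) = fls_X powi (int ((L + 1) * N j) + - (int (N j) * (P i + 1)))"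
  proof -
    have "int (Suc s * N j) = (int L - P i) * int (N j)" using s(3) by (simp only: of_nat_mult) simp
    then have "int (Suc s * N j) = int ((L + 1) * N j) + - (int (N j) * (P i + 1))"
      by (simp add: algebra_simps)
    then show ?thesis by (metis power_int_of_nat)
  qed
  finally show ?thesis by (simp only: fls_X_powi_add power_int_of_nat s_def mult.assoc)
qed

theorem chains_det:
  "(\<Sum>X\<in>chains (2 * L) (restrict M {..<m}). \<Prod>u<2 * L. \<Prod>p<count u. fls_X ^ X u p) =
    fls_X ^ ((L - 1) * (\<Sum>p<m. M p) + (L + 1) * (\<Sum>p<n. N p)) * fdet (n + m - r) entry"
proof -
  define f where "f i = (if i \<in> rows (2 * L) then fls_X ^ ((L - 1) * M (particle_of i)) else 1 :: rat fls)" for i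
  define g where "g j = (if j < n then fls_X ^ ((L + 1) * N j) else 1 :: rat fls)" for j
  have "(\<Sum>X\<in>chains (2 * L) (restrict M {..<m}). \<Prod>u<2 * L. \<Prod>p<count u. fls_X ^ X u p) =
      path_sum (2 * L) (restrict M {..<m})"
    by (rule path_sum_chains[OF M_state, symmetric])
  also have "\<dots> = fdet (n + m - r) (\<lambda>i j. if i \<in> rows (2 * L)
      then amp (2 * L) (restrict M {..<m} (particle_of i)) j else rest i j)"
    by (rule path_sum_det[OF _ M_state]) simp
  also have "\<dots> = fdet (n + m - r) (\<lambda>i j. f i * g j * entry i j)"
  proof (rule fdet_cong)
    fix i j assume ij: "i < n + m - r" "j < n + m - r"
    show "(if i \<in> rows (2 * L) then amp (2 * L) (restrict M {..<m} (particle_of i)) j else rest i j) =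
        f i * g j * entry i j"
    proof (cases "r \<le> i \<and> i < n")
      case True
      then have i: "i \<notin> rows (2 * L)" by (simp add: rows_end)
      show ?thesis
      proof (cases "j < n")
        case jn: True
        show ?thesis using amp_dead[of i j] True jn i by (simp add: rest_def f_def g_def entry_def)
      next
        case False
        have "death i \<le> L" using P_neg[of i] True by (auto simp: death_def)
        then show ?thesis using True False i amp_upper_right[of "death i" j H]
          by (simp add: rest_def entry_def)
      qed
    next
      case False
      then have i: "i \<in> rows (2 * L)" using ij by (auto simp: rows_end)
      have p: "particle_of i < m" using False ij r_le by (auto simp: particle_of_def)
      show ?thesis
      proof (cases "j < n")
        case True
        show ?thesis using amp_final_meet[OF p True] False True i p
          by (auto simp: f_def g_def entry_def mult.assoc)
      next
        case jn: False
        then have j: "row_of (particle_of j) = j" "r \<le> particle_of j" "particle_of j < m"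
          using ij r_le by (auto simp: row_of_def particle_of_def)
        show ?thesis using amp_final_born[OF p j(2,3)] False jn i p
          by (auto simp: f_def g_def entry_def j(1))
      qed
    qed
  qed
  also have "\<dots> = (\<Prod>i<n + m - r. f i) * (\<Prod>j<n + m - r. g j) * fdet (n + m - r) entry"
    by (rule fdet_scale)
  also have "(\<Prod>i<n + m - r. f i) = (\<Prod>i\<in>row_of ` {..<m}. fls_X ^ ((L - 1) * M (particle_of i)))"
    unfolding f_def by (rule prod.mono_neutral_cong_right)
      (use row_of_bound in \<open>auto simp: rows_lower k_ends\<close>)
  also have "\<dots> = (\<Prod>p<m. fls_X ^ ((L - 1) * M p))"
    by (subst prod.reindex) (auto simp: row_of_inverse intro!: inj_on_inverseI[of _ particle_of])
  also have "(\<Prod>j<n + m - r. g j) = (\<Prod>j<n. fls_X ^ ((L + 1) * N j))"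
    unfolding g_def by (rule prod.mono_neutral_cong_right) (use r_le in auto)
  finally show ?thesis by (simp only: power_add sum_distrib_left power_sum)
qed

end

section \<open>Arrays as interlacing families\<close>

text \<open>The rows that reach column \<open>j\<close> form an initial segment, so membership is a
  comparison with their number.\<close>

lemma diagram_transpose:
  assumes \<Lambda>: "is_partition \<Lambda>" and ij: "1 \<le> i" "1 \<le> j"
  shows "(i, j) \<in> diagram \<Lambda> \<longleftrightarrow> i \<le> part_transpose \<Lambda> j"
proof -
  define S where "S = {i. 1 \<le> i \<and> j \<le> \<Lambda> i}"
  have "finite S"
    by (rule finite_subset[of _ "{i. 1 \<le> i \<and> \<Lambda> i \<noteq> 0}"]) (use \<Lambda> ij in \<open>auto simp: S_def is_partition_def\<close>)
  have "i \<in> S \<longleftrightarrow> i \<le> card S"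
  proof
    assume i: "i \<in> S"
    have "{1..i} \<subseteq> S"
    proof
      fix i' assume "i' \<in> {1..i}"
      then show "i' \<in> S" using i is_partition_antimono[OF \<Lambda>, of i' i] by (simp add: S_def)
    qed
    then have "card {1..i} \<le> card S" by (rule card_mono[OF \<open>finite S\<close>])
    then show "i \<le> card S" by simp
  next
    assume i: "i \<le> card S"
    show "i \<in> S"
    proof (rule ccontr)
      assume n: "i \<notin> S"
      have "S \<subseteq> {1..<i}"
      proof
        fix i' assume i': "i' \<in> S"
        have "i' < i"
        proof (rule ccontr)
          assume "\<not> i' < i"
          then have "\<Lambda> i' \<le> \<Lambda> i" using is_partition_antimono[OF \<Lambda> ij(1)] by simp
          then show False using i' n ij by (simp add: S_def)
        qed
        then show "i' \<in> {1..<i}" using i' by (simp add: S_def)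
      qed
      then have "card S \<le> i - 1" using card_mono[of "{1..<i}" S] by simp
      then show False using i ij by simp
    qed
  qed
  then show ?thesis using ij by (simp add: diagram_def S_def part_transpose_def)
qed

lemma part_transpose_antimono:
  assumes "is_partition \<Lambda>" "1 \<le> j" "j \<le> j'"
  shows "part_transpose \<Lambda> j' \<le> part_transpose \<Lambda> j"
  unfolding part_transpose_def
proof (rule card_mono)
  show "finite {i. 1 \<le> i \<and> j \<le> \<Lambda> i}"
    by (rule finite_subset[of _ "{i. 1 \<le> i \<and> \<Lambda> i \<noteq> 0}"]) (use assms in \<open>auto simp: is_partition_def\<close>)
qed (use assms in auto)

text \<open>Indices \<open>p\<close> count rows and columns backwards from \<open>n\<close> and \<open>m\<close>: \<open>N p\<close>, \<open>M p\<close>, \<open>P p\<close> and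
  \<open>Q p\<close> are \<open>N\<^sub>i\<close>, \<open>M\<^sub>j\<close>, \<open>P\<^sub>i\<close> and \<open>Q\<^sub>j\<close> of the paper with \<open>i = n - p\<close> and \<open>j = m - p\<close>.
  Positions depend increasingly on \<open>p\<close>.\<close>

locale pit =
  fixes n m :: nat and \<nu> \<mu> \<Lambda> :: "nat \<Rightarrow> nat"
  assumes parts: "is_partition \<nu>" "is_partition \<mu>" "is_partition \<Lambda>"
    and lens: "part_length \<nu> \<le> n" "part_length \<mu> \<le> m"
    and corner: "\<Lambda> (n + 1) < m + 1"
begin

definition N :: "nat \<Rightarrow> nat" where "N p = \<nu> (n - p) + p"
definition M :: "nat \<Rightarrow> nat" where "M p = \<mu> (m - p) + p"
definition P :: "nat \<Rightarrow> int" where "P p = int (\<Lambda> (n - p)) - int m + int p"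
definition Q :: "nat \<Rightarrow> int" where "Q p = int (part_transpose \<Lambda> (m - p)) - int n + int p"

text \<open>The exponent Delta in backward indexing, which \<open>Delta_shift\<close>
  confirms.\<close>

definition shift :: int where
  "shift = (\<Sum>p\<in>{diag_r n m \<Lambda>..<m}. int (M p) * Q p) + (\<Sum>p\<in>{diag_r n m \<Lambda>..<n}. int (N p) * (P p + 1))"

definition live :: "int \<Rightarrow> nat \<Rightarrow> bool" where
  "live d p \<longleftrightarrow> (if 0 \<le> d then p < n \<and> P p < d else p < m \<and> Q p < - d)"

text \<open>On the upper side \<open>p\<close> fixes the row \<open>n - p\<close>, on the lower side
  the column \<open>m - p\<close>; the other coordinate is moved outward by the distance from the
  main diagonal.\<close>

definition cell :: "int \<Rightarrow> nat \<Rightarrow> nat \<times> nat" where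
  "cell d p = (nat (int n - int p + max 0 (- d)), nat (int m - int p + max 0 d))"

definition diag :: "nat \<Rightarrow> nat \<Rightarrow> int" where "diag i j = (int n - int i) - (int m - int j)"
text \<open>Negative exactly for cells with \<open>i > n\<close> and \<open>j > m\<close>, whose
  entries are zero; these carry no particle.\<close>

definition idx :: "nat \<Rightarrow> nat \<Rightarrow> int" where "idx i j = max (int n - int i) (int m - int j)"

lemma N_less: "p < p' \<Longrightarrow> p' < n \<Longrightarrow> N p < N p'"
  using is_partition_antimono[OF parts(1), of "n - p'" "n - p"] by (simp add: N_def Suc_le_eq diff_le_mono2)

lemma M_less: "p < p' \<Longrightarrow> p' < m \<Longrightarrow> M p < M p'"
  using is_partition_antimono[OF parts(2), of "m - p'" "m - p"] by (simp add: M_def Suc_le_eq diff_le_mono2)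

lemma P_less: "p < p' \<Longrightarrow> p' < n \<Longrightarrow> P p < P p'"
  using is_partition_antimono[OF parts(3), of "n - p'" "n - p"] by (simp add: P_def Suc_le_eq diff_le_mono2)

lemma Q_less: "p < p' \<Longrightarrow> p' < m \<Longrightarrow> Q p < Q p'"
  using part_transpose_antimono[OF parts(3), of "m - p'" "m - p"] by (simp add: Q_def Suc_le_eq diff_le_mono2)

lemma P_less_iff:
  assumes "p < n" "0 \<le> d"
  shows "P p < d \<longleftrightarrow> int p < int m + d \<and> (n - p, nat (int m - int p + d)) \<notin> diagram \<Lambda>"
  using assms by (auto simp: P_def diagram_def)

lemma Q_less_iff:
  assumes "p < m" "0 \<le> d"
  shows "Q p < d \<longleftrightarrow> int p < int n + d \<and> (nat (int n - int p + d), m - p) \<notin> diagram \<Lambda>"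
proof (cases "int p < int n + d")
  case True
  then show ?thesis
    using diagram_transpose[OF parts(3), of "nat (int n - int p + d)" "m - p"] assms
    by (auto simp: Q_def)
qed (auto simp: Q_def)

lemma P_neg: "p < n \<Longrightarrow> P p < 0 \<longleftrightarrow> p < diag_r n m \<Lambda>"
proof -
  assume p: "p < n"
  let ?A = "\<lambda>t. n \<le> t \<or> int (\<Lambda> (n - t)) \<ge> int m - int t"
  have A: "?A (diag_r n m \<Lambda>)" unfolding diag_r_def by (rule LeastI[of ?A n]) simp
  show ?thesis
  proof
    assume "p < diag_r n m \<Lambda>"
    then have "\<not> ?A p" unfolding diag_r_def by (rule not_less_Least)
    then show "P p < 0" by (simp add: P_def)
  next
    assume "P p < 0"
    show "p < diag_r n m \<Lambda>"
    proof (rule ccontr)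
      assume "\<not> ?thesis"
      then have "diag_r n m \<Lambda> \<le> p" by simp
      then have "P (diag_r n m \<Lambda>) \<le> P p" using P_less[of "diag_r n m \<Lambda>" p] p by (cases "diag_r n m \<Lambda> = p") auto
      moreover have "0 \<le> P (diag_r n m \<Lambda>)" using A \<open>diag_r n m \<Lambda> \<le> p\<close> p by (auto simp: P_def)
      ultimately show False using \<open>P p < 0\<close> by simp
    qed
  qed
qed

text \<open>For \<open>p < n\<close>, both \<open>P p < 0\<close> and \<open>Q p < 0\<close> say
  that the cell \<open>(n - p, m - p)\<close> exists and lies outside the diagram, once by rows and
  once by columns.\<close>

lemma Q_neg: "p < m \<Longrightarrow> Q p < 0 \<longleftrightarrow> p < diag_r n m \<Lambda>"
  using Q_less_iff[of p 0] P_less_iff[of p 0] P_neg[of p] diag_r_le(1)[of n m \<Lambda>]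
  by (cases "p < n") (auto simp: nat_diff_distrib)

lemma live_nonpos: "d \<le> 0 \<Longrightarrow> live d p \<longleftrightarrow> p < m \<and> Q p < - d"
  using P_neg[of p] Q_neg[of p] diag_r_le[of n m \<Lambda>] by (cases "d = 0") (auto simp: live_def)

lemma live_cell:
  assumes "live d p" "cell d p = (i, j)"
  shows "1 \<le> i" "1 \<le> j" "(i, j) \<notin> diagram \<Lambda>" "diag i j = d" "idx i j = int p"
proof -
  have "1 \<le> i \<and> 1 \<le> j \<and> (i, j) \<notin> diagram \<Lambda> \<and> diag i j = d \<and> idx i j = int p"
  proof (cases "0 \<le> d")
    case True
    then have p: "p < n" "P p < d" using assms(1) by (auto simp: live_def)
    then have "int p < int m + d \<and> (n - p, nat (int m - int p + d)) \<notin> diagram \<Lambda>" using P_less_iff True by blast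
    moreover have "i = n - p" "j = nat (int m - int p + d)" using assms(2) True p by (auto simp: cell_def)
    ultimately show ?thesis using p True by (auto simp: diag_def idx_def)
  next
    case False
    then have p: "p < m" "Q p < - d" using assms(1) by (auto simp: live_def)
    then have "int p < int n - d \<and> (nat (int n - int p - d), m - p) \<notin> diagram \<Lambda>"
      using Q_less_iff[of p "- d"] False by simp
    moreover have "i = nat (int n - int p - d)" "j = m - p" using assms(2) False p by (auto simp: cell_def)
    ultimately show ?thesis using p False by (auto simp: diag_def idx_def)
  qed
  then show "1 \<le> i" "1 \<le> j" "(i, j) \<notin> diagram \<Lambda>" "diag i j = d" "idx i j = int p" by auto
qed

lemma cell_diag:
  assumes "1 \<le> i" "1 \<le> j" "(i, j) \<notin> diagram \<Lambda>" "0 \<le> idx i j"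
  shows "live (diag i j) (nat (idx i j))" "cell (diag i j) (nat (idx i j)) = (i, j)"
proof -
  show c: "cell (diag i j) (nat (idx i j)) = (i, j)"
    using assms(4) by (auto simp: cell_def diag_def idx_def max_def)
  show "live (diag i j) (nat (idx i j))"
  proof (cases "0 \<le> diag i j")
    case True
    then have "idx i j = int n - int i" "nat (idx i j) = n - i" "i \<le> n" using assms(4) by (auto simp: diag_def idx_def)
    moreover from this have "nat (int m - int (n - i) + diag i j) = j" "n - (n - i) = i" by (auto simp: diag_def)
    ultimately show ?thesis using P_less_iff[of "n - i" "diag i j"] True assms(1-3)
      by (auto simp: live_def diag_def)
  next
    case False
    then have "idx i j = int m - int j" "nat (idx i j) = m - j" "j \<le> m" using assms(4) by (auto simp: diag_def idx_def)
    moreover from this have "nat (int n - int (m - j) - diag i j) = i" "m - (m - j) = j" by (auto simp: diag_def)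
    ultimately show ?thesis using Q_less_iff[of "m - j" "- diag i j"] False assms(1-3)
      by (auto simp: live_def diag_def)
  qed
qed

definition interlacing :: "(int \<Rightarrow> nat \<Rightarrow> nat) \<Rightarrow> bool" where
  "interlacing Y \<longleftrightarrow>
    (\<forall>d\<ge>0. \<forall>p. live (d + 1) p \<longrightarrow> (live d p \<longrightarrow> Y (d + 1) p \<le> Y d p) \<and> (0 < p \<longrightarrow> Y d (p - 1) < Y (d + 1) p)) \<and>
    (\<forall>d\<le>0. \<forall>p. live (d - 1) p \<longrightarrow> (live d p \<longrightarrow> Y (d - 1) p \<le> Y d p) \<and> (0 < p \<longrightarrow> Y d (p - 1) < Y (d - 1) p))"

definition array_of :: "(int \<Rightarrow> nat \<Rightarrow> nat) \<Rightarrow> nat \<times> nat \<Rightarrow> enat" where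
  "array_of Y = (\<lambda>(i, j). if 1 \<le> i \<and> 1 \<le> j then
      if (i, j) \<in> diagram \<Lambda> then \<infinity> else if idx i j < 0 then 0
      else enat (Y (diag i j) (nat (idx i j)) - nat (idx i j)) else undefined)"

definition positions :: "(nat \<times> nat \<Rightarrow> enat) \<Rightarrow> int \<Rightarrow> nat \<Rightarrow> nat" where
  "positions a d p = the_enat (a (cell d p)) + p"

text \<open>A step to the right raises the diagonal by one. On or above the main diagonal it keeps
  the index and the weak inequality applies; below, it lowers the index by one, which absorbs the
  strict inequality. Downward steps are the mirror image.\<close>

lemma array_of_step:
  assumes Y: "interlacing Y" and pos: "\<And>d p. live d p \<Longrightarrow> p \<le> Y d p" and ij: "1 \<le> i" "1 \<le> j"
  shows "array_of Y (i, Suc j) \<le> array_of Y (i, j)" "array_of Y (Suc i, j) \<le> array_of Y (i, j)"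
proof -
  let ?d = "diag i j" and ?p = "nat (idx i j)"
  have Y1: "live (d + 1) p \<Longrightarrow> live d p \<Longrightarrow> 0 \<le> d \<Longrightarrow> Y (d + 1) p \<le> Y d p"
    and Y2: "live (d + 1) p \<Longrightarrow> 0 \<le> d \<Longrightarrow> 0 < p \<Longrightarrow> Y d (p - 1) < Y (d + 1) p"
    and Y3: "live (d - 1) p \<Longrightarrow> live d p \<Longrightarrow> d \<le> 0 \<Longrightarrow> Y (d - 1) p \<le> Y d p"
    and Y4: "live (d - 1) p \<Longrightarrow> d \<le> 0 \<Longrightarrow> 0 < p \<Longrightarrow> Y d (p - 1) < Y (d - 1) p" for d p
    using Y by (auto simp: interlacing_def)
  show "array_of Y (i, Suc j) \<le> array_of Y (i, j)"
  proof (cases "(i, j) \<in> diagram \<Lambda> \<or> idx i (Suc j) < 0")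
    case True
    have "(i, Suc j) \<in> diagram \<Lambda> \<Longrightarrow> (i, j) \<in> diagram \<Lambda>" using ij by (auto simp: diagram_def)
    then show ?thesis using True ij by (auto simp: array_of_def)
  next
    case False
    then have D: "(i, j) \<notin> diagram \<Lambda>" "(i, Suc j) \<notin> diagram \<Lambda>" using ij by (auto simp: diagram_def)
    have I: "0 \<le> idx i (Suc j)" "0 \<le> idx i j" using False by (auto simp: idx_def)
    have l: "live ?d ?p" "live (diag i (Suc j)) (nat (idx i (Suc j)))"
      using cell_diag(1)[of i j] cell_diag(1)[of i "Suc j"] D I ij by auto
    have d: "diag i (Suc j) = ?d + 1" by (simp add: diag_def)
    have "Y (?d + 1) (nat (idx i (Suc j))) - nat (idx i (Suc j)) \<le> Y ?d ?p - ?p"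
    proof (cases "0 \<le> ?d")
      case True
      then have "idx i (Suc j) = idx i j" by (auto simp: diag_def idx_def)
      then show ?thesis using Y1[of ?d ?p] l d True by (simp add: diff_le_mono)
    next
      case F: False
      then have "idx i (Suc j) = idx i j - 1" by (auto simp: diag_def idx_def)
      then have p: "nat (idx i (Suc j)) = ?p - 1" "0 < ?p" using I by auto
      then have "Y (?d + 1) (?p - 1) < Y ?d ?p" using Y4[of "?d + 1" ?p] l F by simp
      then show ?thesis unfolding p(1) using p(2) pos[OF l(1)] by linarith
    qed
    then show ?thesis using D I ij d by (simp add: array_of_def)
  qed
  show "array_of Y (Suc i, j) \<le> array_of Y (i, j)"
  proof (cases "(i, j) \<in> diagram \<Lambda> \<or> idx (Suc i) j < 0")
    case True
    have "(Suc i, j) \<in> diagram \<Lambda> \<Longrightarrow> (i, j) \<in> diagram \<Lambda>"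
      using ij is_partition_antimono[OF parts(3), of i "Suc i"] by (auto simp: diagram_def)
    then show ?thesis using True ij by (auto simp: array_of_def)
  next
    case False
    then have D: "(i, j) \<notin> diagram \<Lambda>" "(Suc i, j) \<notin> diagram \<Lambda>"
      using ij is_partition_antimono[OF parts(3), of i "Suc i"] by (auto simp: diagram_def)
    have I: "0 \<le> idx (Suc i) j" "0 \<le> idx i j" using False by (auto simp: idx_def)
    have l: "live ?d ?p" "live (diag (Suc i) j) (nat (idx (Suc i) j))"
      using cell_diag(1)[of i j] cell_diag(1)[of "Suc i" j] D I ij by auto
    have d: "diag (Suc i) j = ?d - 1" by (simp add: diag_def)
    have "Y (?d - 1) (nat (idx (Suc i) j)) - nat (idx (Suc i) j) \<le> Y ?d ?p - ?p"
    proof (cases "?d \<le> 0")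
      case True
      then have "idx (Suc i) j = idx i j" by (auto simp: diag_def idx_def)
      then show ?thesis using Y3[of ?d ?p] l d True by (simp add: diff_le_mono)
    next
      case F: False
      then have "idx (Suc i) j = idx i j - 1" by (auto simp: diag_def idx_def)
      then have p: "nat (idx (Suc i) j) = ?p - 1" "0 < ?p" using I by auto
      then have "Y (?d - 1) (?p - 1) < Y ?d ?p" using Y2[of "?d - 1" ?p] l F by simp
      then show ?thesis unfolding p(1) using p(2) pos[OF l(1)] by linarith
    qed
    then show ?thesis using D I ij d by (simp add: array_of_def)
  qed
qed

text \<open>The positions are constant from diagonal \<open>L\<close> outward on either side, so the
  array attains its asymptotic values there; cells of negative index are covered by
  \<open>corner\<close> and the bounds on the lengths of \<nu> and \<mu>.\<close>

lemma array_of_arrays: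
  assumes Y: "interlacing Y" and pos: "\<And>d p. live d p \<Longrightarrow> p \<le> Y d p"
    and L: "\<And>p. p < n \<Longrightarrow> P p < L" "\<And>p. p < m \<Longrightarrow> Q p < L"
    and up: "\<And>d p. L \<le> d \<Longrightarrow> p < n \<Longrightarrow> Y d p = N p"
    and low: "\<And>d p. d \<le> - L \<Longrightarrow> p < m \<Longrightarrow> Y d p = M p"
  shows "array_of Y \<in> arrays n m \<mu> \<nu> \<Lambda>"
    and "1 \<le> i \<Longrightarrow> 1 \<le> j \<Longrightarrow> max 1 L \<le> diag i j \<Longrightarrow> array_of Y (i, j) = enat (\<nu> i)"
    and "1 \<le> i \<Longrightarrow> 1 \<le> j \<Longrightarrow> diag i j \<le> - max 1 L \<Longrightarrow> array_of Y (i, j) = enat (\<mu> j)"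
proof -
  show U: "array_of Y (i, j) = enat (\<nu> i)" if ij: "1 \<le> i" "1 \<le> j" "max 1 L \<le> diag i j" for i j
  proof (cases "i \<le> n")
    case True
    then have i: "idx i j = int (n - i)" "n - i < n" using ij by (auto simp: idx_def diag_def)
    have "(i, j) \<notin> diagram \<Lambda>"
      using P_less_iff[OF i(2), of "diag i j"] L(1)[OF i(2)] ij True by (auto simp: diag_def)
    moreover have "nat (idx i j) = n - i" "\<not> idx i j < 0" using i(1) by simp_all
    moreover have "Y (diag i j) (n - i) = \<nu> i + (n - i)" using up[of "diag i j" "n - i"] i ij True by (simp add: N_def)
    ultimately show ?thesis using ij by (simp only: array_of_def) simp
  next
    case False
    then have "idx i j < 0" using ij by (auto simp: idx_def diag_def)
    moreover have "(i, j) \<notin> diagram \<Lambda>"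
      using False ij corner is_partition_antimono[OF parts(3), of "n + 1" i] by (auto simp: diagram_def diag_def)
    moreover have "\<nu> i = 0" using False lens(1) by (intro is_partition_eq_0[OF parts(1)]) simp
    ultimately show ?thesis using ij by (simp add: array_of_def zero_enat_def)
  qed
  show W: "array_of Y (i, j) = enat (\<mu> j)" if ij: "1 \<le> i" "1 \<le> j" "diag i j \<le> - max 1 L" for i j
  proof (cases "j \<le> m")
    case True
    then have i: "idx i j = int (m - j)" "m - j < m" using ij by (auto simp: idx_def diag_def)
    have e: "nat (int n - int (m - j) + - diag i j) = i" "m - (m - j) = j" using True by (auto simp: diag_def)
    have "0 \<le> - diag i j" "L \<le> - diag i j" using ij(3) by linarith+
    then have "(i, j) \<notin> diagram \<Lambda>"
      using Q_less_iff[OF i(2), of "- diag i j"] L(2)[OF i(2)] unfolding e by auto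
    moreover have "nat (idx i j) = m - j" "\<not> idx i j < 0" using i(1) by simp_all
    moreover have "Y (diag i j) (m - j) = \<mu> j + (m - j)" using low[of "diag i j" "m - j"] i ij True by (simp add: M_def)
    ultimately show ?thesis using ij by (simp only: array_of_def) simp
  next
    case False
    then have neg: "idx i j < 0" using ij by (auto simp: idx_def diag_def)
    have "n + 1 \<le> i" using False ij by (auto simp: diag_def)
    then have "(i, j) \<notin> diagram \<Lambda>"
      using False corner is_partition_antimono[OF parts(3), of "n + 1" i] by (auto simp: diagram_def)
    moreover have "\<mu> j = 0" using False lens(2) by (intro is_partition_eq_0[OF parts(2)]) simp
    ultimately show ?thesis using ij neg by (simp add: array_of_def zero_enat_def)
  qed
  show "array_of Y \<in> arrays n m \<mu> \<nu> \<Lambda>"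
    unfolding arrays_def
  proof (intro CollectI conjI allI impI)
    show "array_of Y \<in> {1..} \<times> {1..} \<rightarrow>\<^sub>E UNIV"
      by (auto simp: array_of_def PiE_def extensional_def)
    show "array_of Y (n + 1, m + 1) = 0"
      using corner by (auto simp: array_of_def idx_def diagram_def)
    fix i :: nat assume i: "1 \<le> i"
    show "\<forall>\<^sub>F j in sequentially. array_of Y (i, j) = enat (\<nu> i)"
      unfolding eventually_sequentially
    proof (intro exI allI impI)
      fix j assume "nat (max 1 L + int m + int i) \<le> j"
      then show "array_of Y (i, j) = enat (\<nu> i)" using i by (intro U) (auto simp: diag_def)
    qed
  next
    fix j :: nat assume j: "1 \<le> j"
    show "\<forall>\<^sub>F i in sequentially. array_of Y (i, j) = enat (\<mu> j)"
      unfolding eventually_sequentially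
    proof (intro exI allI impI)
      fix i assume "nat (max 1 L + int n + int j) \<le> i"
      then show "array_of Y (i, j) = enat (\<mu> j)" using j by (intro W) (auto simp: diag_def)
    qed
  next
    fix i j :: nat assume ij: "1 \<le> i" "1 \<le> j"
    show "array_of Y (Suc i, j) \<le> array_of Y (i, j)"
      by (rule array_of_step(2)[OF Y _ ij]) (rule pos)
    show "array_of Y (i, Suc j) \<le> array_of Y (i, j)"
      by (rule array_of_step(1)[OF Y _ ij]) (rule pos)
    show "array_of Y (i, j) = \<infinity> \<longleftrightarrow> (i, j) \<in> diagram \<Lambda>"
      using ij by (auto simp: array_of_def zero_enat_def)
  qed
qed

lemma array_of_cell:
  assumes "live d p" "p \<le> Y d p"
  shows "positions (array_of Y) d p = Y d p"
proof -
  obtain i j where ij: "cell d p = (i, j)" by force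
  note c = live_cell[OF assms(1) ij]
  then show ?thesis using assms(2) by (simp add: positions_def ij array_of_def)
qed

lemma positions_interlacing:
  assumes a: "a \<in> arrays n m \<mu> \<nu> \<Lambda>"
  shows "interlacing (positions a)"
proof -
  note step = arrays_step[OF parts lens a]
  have fin: "a (cell d p) = enat (the_enat (a (cell d p)))" if "live d p" for d p
  proof -
    obtain i j where "cell d p = (i, j)" by force
    then show ?thesis using live_cell[OF that] step(3)[of i j] by (cases "a (i, j)") auto
  qed
  have le: "the_enat (a (cell d p)) \<le> the_enat (a (cell d' p'))"
    if "live d p" "live d' p'" "a (cell d p) \<le> a (cell d' p')" for d p d' p'
    using that fin[of d p] fin[of d' p'] by (metis enat_ord_simps(1))
  have cell_right: "cell (d + 1) p = (i, Suc j)" if "cell d p = (i, j)" "live d p" "0 \<le> d" for d p i j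
    using that live_cell(2)[OF that(2,1)] by (auto simp: cell_def)
  have cell_down: "cell (d - 1) p = (Suc i, j)" if "cell d p = (i, j)" "live d p" "d \<le> 0" for d p i j
    using that live_cell(1)[OF that(2,1)] by (auto simp: cell_def)
  have cell_down': "cell d (p - 1) = (Suc i, j)" if "cell (d + 1) p = (i, j)" "live (d + 1) p" "0 \<le> d" "0 < p" for d p i j
    using that live_cell(1,2)[OF that(2,1)] by (auto simp: cell_def)
  have cell_right': "cell d (p - 1) = (i, Suc j)" if "cell (d - 1) p = (i, j)" "live (d - 1) p" "d \<le> 0" "0 < p" for d p i j
    using that live_cell(1,2)[OF that(2,1)] by (auto simp: cell_def)
  show ?thesis
    unfolding interlacing_def
  proof (intro conjI allI impI)
    fix d :: int and p assume d: "0 \<le> d" and l: "live (d + 1) p"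
    show "positions a (d + 1) p \<le> positions a d p" if l': "live d p"
    proof -
      obtain i j where ij: "cell d p = (i, j)" by force
      show ?thesis using le[OF l l'] step(1)[of i j] live_cell(1,2)[OF l' ij] cell_right[OF ij l' d] ij
        by (simp add: positions_def)
    qed
    show "positions a d (p - 1) < positions a (d + 1) p" if p: "0 < p"
    proof -
      \<comment> \<open>Strict increase of \<open>P\<close> makes the preceding index finite one
        diagonal further inward.\<close>
      have l': "live d (p - 1)"
        using l d p P_less[of "p - 1" p] by (auto simp: live_def)
      obtain i j where ij: "cell (d + 1) p = (i, j)" by force
      show ?thesis using le[OF l' l] step(2)[of i j] live_cell(1,2)[OF l ij] cell_down'[OF ij l d p] ij p
        by (simp add: positions_def)
    qed
  next
    fix d :: int and p assume d: "d \<le> 0" and l: "live (d - 1) p"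
    show "positions a (d - 1) p \<le> positions a d p" if l': "live d p"
    proof -
      obtain i j where ij: "cell d p = (i, j)" by force
      show ?thesis using le[OF l l'] step(2)[of i j] live_cell(1,2)[OF l' ij] cell_down[OF ij l' d] ij
        by (simp add: positions_def)
    qed
    show "positions a d (p - 1) < positions a (d - 1) p" if p: "0 < p"
    proof -
      have l': "live d (p - 1)"
        using l d p Q_less[of "p - 1" p] by (auto simp: live_nonpos)
      obtain i j where ij: "cell (d - 1) p = (i, j)" by force
      show ?thesis using le[OF l' l] step(1)[of i j] live_cell(1,2)[OF l ij] cell_right'[OF ij l d p] ij p
        by (simp add: positions_def)
    qed
  qed
qed

lemma array_of_positions:
  assumes a: "a \<in> arrays n m \<mu> \<nu> \<Lambda>" and Y: "\<And>d p. live d p \<Longrightarrow> Y d p = positions a d p"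
  shows "array_of Y = a"
proof
  fix x :: "nat \<times> nat"
  obtain i j where x: "x = (i, j)" by force
  show "array_of Y x = a x"
  proof (cases "1 \<le> i \<and> 1 \<le> j")
    case False
    then show ?thesis using PiE_arb[OF arrays_extensional[OF parts lens a], of x] by (auto simp: x array_of_def)
  next
    case True
    note s = arrays_step(3)[OF parts lens a, of i j]
    consider "(i, j) \<in> diagram \<Lambda>" | "(i, j) \<notin> diagram \<Lambda>" "idx i j < 0" | "(i, j) \<notin> diagram \<Lambda>" "0 \<le> idx i j"
      by linarith
    then show ?thesis
    proof cases
      case 1
      then show ?thesis using s True by (simp add: x array_of_def)
    next
      case 2
      then show ?thesis using arrays_eq_0[OF parts lens a, of i j] True by (simp add: x array_of_def idx_def)
    next
      case 3
      then obtain v where "a (i, j) = enat v" using s True by (cases "a (i, j)") auto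
      then show ?thesis using 3 True cell_diag[of i j] Y[OF cell_diag(1)[of i j]]
        by (simp add: x array_of_def positions_def)
    qed
  qed
qed

end

section \<open>Total of the asymptotic positions over the finite cells\<close>

context truncated_pit
begin

lemma alive_count_upper:
  assumes "p < n"
  shows "int (card {t. t \<le> L \<and> alive t p}) = int L + 1 - (if p < r then 0 else P p + 1)"
proof (cases "p < r")
  case True
  then have "alive t p" if "t \<le> L" for t using P_neg[OF assms] that assms by (auto simp: alive_def)
  then have "{t. t \<le> L \<and> alive t p} = {..L}" by auto
  then show ?thesis using True by simp
next
  case False
  then have P: "0 \<le> P p" "P p < int L" using P_neg[OF assms] P_bound[OF assms] by auto
  have "{t. t \<le> L \<and> alive t p} = {..<nat (int L - P p)}" using P assms by (auto simp: alive_def)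
  then show ?thesis using False P by simp
qed

text \<open>The main diagonal belongs to the upper count and the last slice carries no weight, which
  leaves \<open>L - 1\<close> diagonals; the pit occupies \<open>Q p\<close> of them.\<close>

lemma alive_count_lower:
  assumes "p < m"
  shows "int (card {t. L < t \<and> t < 2 * L \<and> alive t p}) = int L - 1 - (if p < r then 0 else Q p)"
proof (cases "p < r")
  case True
  then have "alive t p" if "L < t" for t using Q_neg[OF assms] that assms by (auto simp: alive_def)
  then have "{t. L < t \<and> t < 2 * L \<and> alive t p} = {L<..<2 * L}" by auto
  then show ?thesis using True L_pos by (simp add: of_nat_diff)
next
  case False
  then have Q: "0 \<le> Q p" "Q p < int L" using Q_neg[OF assms] Q_bound[OF assms] by auto
  have "{t. L < t \<and> t < 2 * L \<and> alive t p} = {L + nat (Q p)<..<2 * L}"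
    using Q assms by (auto simp: alive_def)
  then show ?thesis using False Q by (simp add: of_nat_diff)
qed

lemma sum_count_swap:
  assumes "finite T" "\<And>t. t \<in> T \<Longrightarrow> count t \<le> b"
  shows "(\<Sum>t\<in>T. \<Sum>p<count t. f p) = (\<Sum>p<b. int (card {t \<in> T. alive t p}) * f p)"
proof -
  have "(\<Sum>t\<in>T. \<Sum>p<count t. f p) = (\<Sum>t\<in>T. \<Sum>p<b. if alive t p then f p else 0)"
  proof (rule sum.cong[OF refl])
    fix t assume "t \<in> T"
    then show "(\<Sum>p<count t. f p) = (\<Sum>p<b. if alive t p then f p else 0)"
      using assms(2) by (intro sum.mono_neutral_cong_left) (auto simp: less_count[symmetric] intro: less_le_trans)
  qed
  also have "\<dots> = (\<Sum>p<b. \<Sum>t\<in>T. if alive t p then f p else 0)" by (rule sum.swap)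
  also have "\<dots> = (\<Sum>p<b. int (card {t \<in> T. alive t p}) * f p)"
    using assms(1) by (intro sum.cong[OF refl]) (simp add: sum.If_cases Int_def)
  finally show ?thesis .
qed

lemma sum_tail: "r \<le> b \<Longrightarrow> (\<Sum>p<b. (if p < r then 0 else g p)) = (\<Sum>p\<in>{r..<b}. g p :: int)"
  by (rule sum.mono_neutral_cong_right) auto

lemma sum_ground_upper:
  "(\<Sum>t\<le>L. \<Sum>p<count t. int (N p)) =
    (int L + 1) * (\<Sum>p<n. int (N p)) - (\<Sum>p\<in>{r..<n}. int (N p) * (P p + 1))"
proof -
  have "(\<Sum>t\<le>L. \<Sum>p<count t. int (N p)) = (\<Sum>p<n. int (card {t \<in> {..L}. alive t p}) * int (N p))"
    by (rule sum_count_swap) (use k_upper_range(2) in auto)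
  also have "\<dots> = (\<Sum>p<n. (int L + 1) * int (N p) - (if p < r then 0 else int (N p) * (P p + 1)))"
    by (intro sum.cong[OF refl]) (simp add: alive_count_upper algebra_simps)
  finally show ?thesis by (simp add: sum_subtractf sum_distrib_left sum_tail[OF r_le_n])
qed

lemma sum_ground_lower:
  "(\<Sum>t\<in>{L<..<2 * L}. \<Sum>p<count t. int (M p)) =
    (int L - 1) * (\<Sum>p<m. int (M p)) - (\<Sum>p\<in>{r..<m}. int (M p) * Q p)"
proof -
  have "(\<Sum>t\<in>{L<..<2 * L}. \<Sum>p<count t. int (M p)) =
      (\<Sum>p<m. int (card {t \<in> {L<..<2 * L}. alive t p}) * int (M p))"
    by (rule sum_count_swap) (use k_lower_range(2) in auto)
  also have "\<dots> = (\<Sum>p<m. (int L - 1) * int (M p) - (if p < r then 0 else int (M p) * Q p))"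
  proof (rule sum.cong[OF refl])
    fix p assume "p \<in> {..<m}"
    then have p: "p < m" by simp
    have eq: "{t \<in> {L<..<2 * L}. alive t p} = {t. L < t \<and> t < 2 * L \<and> alive t p}" by auto
    show "int (card {t \<in> {L<..<2 * L}. alive t p}) * int (M p) =
        (int L - 1) * int (M p) - (if p < r then 0 else int (M p) * Q p)"
      unfolding eq alive_count_lower[OF p] by (simp add: algebra_simps)
  qed
  finally show ?thesis by (simp add: sum_subtractf sum_distrib_left sum_tail[OF r_le_m])
qed

end

section \<open>Bijection between bounded arrays and particle histories\<close>

locale big_pit = pit +
  fixes L H :: nat
  assumes L_pos: "0 < L"
    and P_bound: "\<And>p. p < n \<Longrightarrow> P p < int L" and Q_bound: "\<And>p. p < m \<Longrightarrow> Q p < int L"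
    and N_bound: "\<And>p. p < n \<Longrightarrow> N p \<le> H" and M_bound: "\<And>p. p < m \<Longrightarrow> M p \<le> H"
begin

sublocale tp: truncated_pit n m "diag_r n m \<Lambda>" L H N M P Q
  by unfold_locales
    (use diag_r_le L_pos N_less M_less P_less Q_less N_bound M_bound P_neg Q_neg P_bound Q_bound in auto)

lemma less_count_live: "t \<le> 2 * L \<Longrightarrow> p < tp.count t \<longleftrightarrow> live (int L - int t) p"
  by (auto simp: tp.less_count tp.alive_def live_def)

definition trunc :: "(nat \<times> nat \<Rightarrow> enat) set" where
  "trunc = {a \<in> arrays n m \<mu> \<nu> \<Lambda>.
     (\<forall>i\<ge>1. \<forall>j\<ge>1. int L \<le> diag i j \<longrightarrow> a (i, j) = enat (\<nu> i)) \<and>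
     (\<forall>i\<ge>1. \<forall>j\<ge>1. diag i j \<le> - int L \<longrightarrow> a (i, j) = enat (\<mu> j)) \<and>
     (\<forall>d p. live d p \<longrightarrow> positions a d p \<le> H)}"

definition slices_of :: "(nat \<times> nat \<Rightarrow> enat) \<Rightarrow> nat \<Rightarrow> nat \<Rightarrow> nat" where
  "slices_of a = (\<lambda>t\<in>{..2 * L}. \<lambda>p\<in>{..<tp.count t}. positions a (int L - int t) p)"

text \<open>Beyond the recorded diagonals the positions are the asymptotic ones. For a chain the end
  slices already have these values, so the clauses agree at \<open>L\<close> and
  \<open>- L\<close>.\<close>

definition extend :: "(nat \<Rightarrow> nat \<Rightarrow> nat) \<Rightarrow> int \<Rightarrow> nat \<Rightarrow> nat" where
  "extend X d p = (if int L \<le> d then N p else if d \<le> - int L then M p else X (nat (int L - d)) p)"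

lemma live_upper: "0 \<le> d \<Longrightarrow> live d p \<Longrightarrow> p < n"
  by (simp add: live_def)

lemma live_lower: "d \<le> 0 \<Longrightarrow> live d p \<Longrightarrow> p < m"
  by (simp add: live_nonpos)

lemma states_ge: "x \<in> tp.states t \<Longrightarrow> p < tp.count t \<Longrightarrow> p \<le> x p"
proof (induction p)
  case (Suc p)
  then show ?case using tp.states_less[of x t p "Suc p"] by simp
qed simp

lemma positions_end:
  assumes "a \<in> trunc" "live d p"
  shows "int L \<le> d \<Longrightarrow> positions a d p = N p" "d \<le> - int L \<Longrightarrow> positions a d p = M p"
proof -
  obtain i j where ij: "cell d p = (i, j)" by force
  note c = live_cell[OF assms(2) ij]
  show "positions a d p = N p" if d: "int L \<le> d"
  proof -
    have "i = n - p" using ij d live_upper[of d p] assms(2) by (auto simp: cell_def)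
    moreover have "a (i, j) = enat (\<nu> i)" using assms(1) c d by (auto simp: trunc_def)
    ultimately show ?thesis by (simp add: positions_def ij N_def)
  qed
  show "positions a d p = M p" if d: "d \<le> - int L"
  proof -
    have "j = m - p" using ij d live_lower[of d p] assms(2) by (auto simp: cell_def)
    moreover have "a (i, j) = enat (\<mu> j)" using assms(1) c d by (auto simp: trunc_def)
    ultimately show ?thesis by (simp add: positions_def ij M_def)
  qed
qed

lemma extend_slices_of:
  assumes "a \<in> trunc" "live d p"
  shows "extend (slices_of a) d p = positions a d p"
proof -
  consider "int L \<le> d" | "d \<le> - int L" | "- int L < d" "d < int L" by linarith
  then show ?thesis
  proof cases
    case 3
    define t where "t = nat (int L - d)"
    have t: "t \<le> 2 * L" "d = int L - int t" using 3 by (auto simp: t_def)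
    have "p < tp.count t" using assms(2) less_count_live[OF t(1)] by (simp add: t(2))
    then have "slices_of a t p = positions a d p" using t by (simp add: slices_of_def)
    then show ?thesis using 3 by (simp add: extend_def t_def)
  qed (use positions_end[OF assms] L_pos in \<open>auto simp: extend_def\<close>)
qed

context
  fixes X assumes X: "X \<in> tp.chains (2 * L) (restrict M {..<m})"
begin

lemma chain_states: "t \<le> 2 * L \<Longrightarrow> X t \<in> tp.states t"
  using X by (auto simp: tp.chains_def)

lemma chain_step: "t < 2 * L \<Longrightarrow> tp.step t (X t) (X (Suc t))"
  using X by (auto simp: tp.chains_def)

lemma extend_chain:
  assumes "t \<le> 2 * L" "p < tp.count t"
  shows "extend X (int L - int t) p = X t p"
proof -
  consider "t = 0" | "t = 2 * L" | "0 < t" "t < 2 * L" using assms by linarith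
  then show ?thesis
  proof cases
    case 1
    then have "p < n" using assms(2) tp.k_ends by simp
    then show ?thesis using X 1 by (simp add: extend_def tp.chains_def)
  next
    case 2
    then have "p < m" using assms(2) tp.k_ends by simp
    then show ?thesis using X 2 L_pos by (simp add: extend_def tp.chains_def)
  next
    case 3
    have "nat (int L - (int L - int t)) = t" by simp
    then show ?thesis using 3 by (simp add: extend_def del: diff_diff_eq2)
  qed
qed

lemma extend_bounds:
  assumes l: "live d p" shows "p \<le> extend X d p" "extend X d p \<le> H"
proof -
  have "p \<le> extend X d p \<and> extend X d p \<le> H"
  proof -
    consider "int L \<le> d" | "d \<le> - int L" | "- int L < d" "d < int L" by linarith
    then show ?thesis
    proof cases
      case 1
      then show ?thesis using N_bound live_upper[OF _ l] by (simp add: extend_def N_def)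
    next
      case 2
      then show ?thesis using M_bound live_lower[OF _ l] L_pos by (simp add: extend_def M_def)
    next
      case 3
      define t where "t = nat (int L - d)"
      have t: "t \<le> 2 * L" "d = int L - int t" using 3 by (auto simp: t_def)
      then have p: "p < tp.count t" using l less_count_live by simp
      then show ?thesis
        using extend_chain[OF t(1) p] states_ge[OF chain_states[OF t(1)] p] tp.states_le[OF chain_states[OF t(1)] p]
        by (simp add: t(2))
    qed
  qed
  then show "p \<le> extend X d p" "extend X d p \<le> H" by auto
qed

lemma extend_interlacing: "interlacing (extend X)"
  unfolding interlacing_def
proof (intro conjI allI impI)
  fix d :: int and p assume d: "0 \<le> d" and l: "live (d + 1) p"
  have pn: "p < n" using live_upper[OF _ l] d by simp
  have "(live d p \<longrightarrow> extend X (d + 1) p \<le> extend X d p) \<and>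
      (0 < p \<longrightarrow> extend X d (p - 1) < extend X (d + 1) p)"
  proof (cases "int L \<le> d")
    case True
    then show ?thesis using N_less[of "p - 1" p] pn by (simp add: extend_def)
  next
    case False
    define t where "t = nat (int L - d - 1)"
    have t: "t < L" "d + 1 = int L - int t" "d = int L - int (Suc t)" using False d by (auto simp: t_def)
    have pt: "p < tp.count t" using l t less_count_live[of t p] by simp
    have pt': "live d q \<longleftrightarrow> q < tp.count (Suc t)" for q
      using less_count_live[of "Suc t" q] t by simp
    have "tp.step t (X t) (X (Suc t))" using chain_step t by simp
    then have s: "p < tp.count (Suc t) \<longrightarrow> X t p \<le> X (Suc t) p" "0 < p \<longrightarrow> X (Suc t) (p - 1) < X t p"
      using pt t(1) by (auto simp: tp.step_def interlace_def)
    have "0 < p \<longrightarrow> p - 1 < tp.count (Suc t)" using tp.k_upper[OF t(1)] pt by auto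
    then show ?thesis
      using s pt pt' extend_chain[of t] extend_chain[of "Suc t"] t by simp
  qed
  then show "live d p \<Longrightarrow> extend X (d + 1) p \<le> extend X d p"
    "0 < p \<Longrightarrow> extend X d (p - 1) < extend X (d + 1) p" by auto
next
  fix d :: int and p assume d: "d \<le> 0" and l: "live (d - 1) p"
  have pm: "p < m" using live_lower[OF _ l] d by simp
  have "(live d p \<longrightarrow> extend X (d - 1) p \<le> extend X d p) \<and>
      (0 < p \<longrightarrow> extend X d (p - 1) < extend X (d - 1) p)"
  proof (cases "d \<le> - int L")
    case True
    then show ?thesis using M_less[of "p - 1" p] pm L_pos by (simp add: extend_def)
  next
    case False
    define t where "t = nat (int L - d)"
    have t: "L \<le> t" "t < 2 * L" "d = int L - int t" "d - 1 = int L - int (Suc t)" using False d by (auto simp: t_def)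
    have pt: "p < tp.count (Suc t)" using l less_count_live[of "Suc t" p] t(2) unfolding t(4) by simp
    have pt': "live d q \<longleftrightarrow> q < tp.count t" for q
      using less_count_live[of t q] t by simp
    have e: "extend X (d - 1) p = X (Suc t) p" "q < tp.count t \<Longrightarrow> extend X d q = X t q" for q
      using extend_chain[of "Suc t" p] extend_chain[of t q] t(2) pt unfolding t(4) unfolding t(3) by simp_all
    have "tp.step t (X t) (X (Suc t))" using chain_step t by simp
    then have s: "p < tp.count t \<longrightarrow> X (Suc t) p \<le> X t p" "0 < p \<longrightarrow> X t (p - 1) < X (Suc t) p"
      using pt t(1) by (auto simp: tp.step_def interlace_def)
    have "0 < p \<longrightarrow> p - 1 < tp.count t" using tp.k_lower[OF t(1,2)] pt by auto
    then show ?thesis using s pt' e by simp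
  qed
  then show "live d p \<Longrightarrow> extend X (d - 1) p \<le> extend X d p"
    "0 < p \<Longrightarrow> extend X d (p - 1) < extend X (d - 1) p" by auto
qed

lemma chain_trunc: "array_of (extend X) \<in> trunc"
proof -
  have up: "\<And>d p. int L \<le> d \<Longrightarrow> p < n \<Longrightarrow> extend X d p = N p" by (simp add: extend_def)
  have low: "\<And>d p. d \<le> - int L \<Longrightarrow> p < m \<Longrightarrow> extend X d p = M p" using L_pos by (simp add: extend_def)
  note facts = extend_interlacing extend_bounds P_bound Q_bound up low
  have "array_of (extend X) \<in> arrays n m \<mu> \<nu> \<Lambda>"
    by (rule array_of_arrays(1)[where L = "int L"]) (use facts in auto)
  moreover have "array_of (extend X) (i, j) = enat (\<nu> i)" if "1 \<le> i" "1 \<le> j" "int L \<le> diag i j" for i j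
    by (rule array_of_arrays(2)[where L = "int L"]) (use facts that L_pos in auto)
  moreover have "array_of (extend X) (i, j) = enat (\<mu> j)" if "1 \<le> i" "1 \<le> j" "diag i j \<le> - int L" for i j
    by (rule array_of_arrays(3)[where L = "int L"]) (use facts that L_pos in auto)
  moreover have "positions (array_of (extend X)) d p \<le> H" if "live d p" for d p
    using array_of_cell[OF that, of "extend X"] extend_bounds[OF that] by simp
  ultimately show ?thesis by (simp add: trunc_def)
qed

lemma slices_of_chain: "slices_of (array_of (extend X)) = X"
proof (intro ext)
  fix t p
  consider "2 * L < t" | "t \<le> 2 * L" "tp.count t \<le> p" | "t \<le> 2 * L" "p < tp.count t" by linarith
  then show "slices_of (array_of (extend X)) t p = X t p"
  proof cases
    case 1
    then have "X t = undefined" using X by (auto simp: tp.chains_def PiE_def extensional_def)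
    then show ?thesis using 1 by (simp add: slices_of_def)
  next
    case 2
    then have "X t p = undefined" using chain_states[OF 2(1)] by (auto simp: tp.states_def PiE_def extensional_def)
    then show ?thesis using 2 by (simp add: slices_of_def)
  next
    case 3
    then have l: "live (int L - int t) p" using less_count_live by simp
    then show ?thesis using array_of_cell[OF l, of "extend X"] extend_bounds[OF l] extend_chain[OF 3] 3
      by (simp add: slices_of_def)
  qed
qed

end

lemma slices_of_chains:
  assumes a: "a \<in> trunc"
  shows "slices_of a \<in> tp.chains (2 * L) (restrict M {..<m})"
proof -
  have arr: "a \<in> arrays n m \<mu> \<nu> \<Lambda>" and H: "\<And>d p. live d p \<Longrightarrow> positions a d p \<le> H"
    using a by (auto simp: trunc_def)
  note I = positions_interlacing[OF arr]
  have Y1: "live (d + 1) p \<Longrightarrow> live d p \<Longrightarrow> 0 \<le> d \<Longrightarrow> positions a (d + 1) p \<le> positions a d p"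
    and Y2: "live (d + 1) p \<Longrightarrow> 0 \<le> d \<Longrightarrow> 0 < p \<Longrightarrow> positions a d (p - 1) < positions a (d + 1) p"
    and Y3: "live (d - 1) p \<Longrightarrow> live d p \<Longrightarrow> d \<le> 0 \<Longrightarrow> positions a (d - 1) p \<le> positions a d p"
    and Y4: "live (d - 1) p \<Longrightarrow> d \<le> 0 \<Longrightarrow> 0 < p \<Longrightarrow> positions a d (p - 1) < positions a (d - 1) p" for d p
    using I by (auto simp: interlacing_def)
  have S: "slices_of a t p = positions a (int L - int t) p" if "t \<le> 2 * L" "p < tp.count t" for t p
    using that by (simp add: slices_of_def)
  \<comment> \<open>\<open>interlacing\<close> only relates neighbouring diagonals, so the strict
    increase within one comes from a detour through the next outer diagonal, where index
    \<open>Suc p\<close> is still finite: strictly up, weakly back.\<close>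
  have incr: "positions a d p < positions a d (Suc p)" if l: "live d (Suc p)" for d p
  proof (cases "0 \<le> d")
    case True
    then have l': "live (d + 1) (Suc p)" using l by (auto simp: live_def)
    show ?thesis using Y2[OF l' True] Y1[OF l' l True] by simp
  next
    case False
    then have l': "live (d - 1) (Suc p)" using l by (auto simp: live_def)
    show ?thesis using Y4[OF l'] Y3[OF l' l] False by simp
  qed
  have states: "slices_of a t \<in> tp.states t" if t: "t \<le> 2 * L" for t
  proof -
    have "slices_of a t \<in> {..<tp.count t} \<rightarrow>\<^sub>E {..H}"
      using t H less_count_live[OF t] by (auto simp: slices_of_def)
    moreover have "slices_of a t p < slices_of a t (Suc p)" if "Suc p < tp.count t" for p
      using S[OF t, of p] S[OF t, of "Suc p"] incr less_count_live[OF t, of "Suc p"] that by simp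
    ultimately show ?thesis by (simp add: tp.states_def)
  qed
  have start: "slices_of a 0 = restrict N {..<n}"
    using positions_end(1)[OF a, of "int L"] less_count_live[of 0] tp.k_ends(1)
    by (auto simp: slices_of_def fun_eq_iff)
  have "slices_of a (2 * L) p = restrict M {..<m} p" for p
  proof (cases "p < m")
    case True
    then have "p < tp.count (2 * L)" using tp.k_ends by simp
    moreover have "live (- int L) p" using less_count_live[of "2 * L" p] calculation by simp
    ultimately show ?thesis using S[of "2 * L" p] positions_end(2)[OF a, of "- int L" p] True by simp
  next
    case False
    then show ?thesis using tp.k_ends by (simp add: slices_of_def)
  qed
  then have finish: "slices_of a (2 * L) = restrict M {..<m}" by blast
  have "tp.step t (slices_of a t) (slices_of a (Suc t))" if t: "t < 2 * L" for t
  proof (cases "t < L")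
    case True
    define d where "d = int L - int (Suc t)"
    have d: "0 \<le> d" "d + 1 = int L - int t" using True by (auto simp: d_def)
    have l: "live (d + 1) p \<longleftrightarrow> p < tp.count t" "live d p \<longleftrightarrow> p < tp.count (Suc t)" for p
      using less_count_live[of t p] less_count_live[of "Suc t" p] t d(2) d_def by auto
    have "interlace (tp.count t) (tp.count (Suc t)) (slices_of a t) (slices_of a (Suc t))"
      unfolding interlace_def
    proof (intro allI impI conjI)
      fix p assume p: "p < tp.count t"
      show "slices_of a t p \<le> slices_of a (Suc t) p" if p': "p < tp.count (Suc t)"
        using S[of t p] S[of "Suc t" p] t p p' Y1[of d p] l d d_def by simp
      show "slices_of a (Suc t) (p - 1) < slices_of a t p" if "0 < p"
      proof -
        have "p - 1 < tp.count (Suc t)" using tp.k_upper[OF True] p that by auto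
        then show ?thesis using S[of t p] S[of "Suc t" "p - 1"] t p that Y2[of d p] l d d_def by simp
      qed
    qed
    then show ?thesis using True by (simp add: tp.step_def)
  next
    case False
    define d where "d = int L - int t"
    have d: "d \<le> 0" "d - 1 = int L - int (Suc t)" using False by (auto simp: d_def)
    have l: "live (d - 1) p \<longleftrightarrow> p < tp.count (Suc t)" "live d p \<longleftrightarrow> p < tp.count t" for p
      using less_count_live[of "Suc t" p] less_count_live[of t p] t unfolding d(2) unfolding d_def by simp_all
    have S': "p < tp.count (Suc t) \<Longrightarrow> slices_of a (Suc t) p = positions a (d - 1) p"
      "p < tp.count t \<Longrightarrow> slices_of a t p = positions a d p" for p
      using S[of "Suc t" p] S[of t p] t unfolding d(2) unfolding d_def by simp_all
    have "interlace (tp.count (Suc t)) (tp.count t) (slices_of a (Suc t)) (slices_of a t)"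
      unfolding interlace_def
    proof (intro allI impI conjI)
      fix p assume p: "p < tp.count (Suc t)"
      show "slices_of a (Suc t) p \<le> slices_of a t p" if p': "p < tp.count t"
        using S'[of p] p p' Y3[of d p] l d(1) by simp
      show "slices_of a t (p - 1) < slices_of a (Suc t) p" if "0 < p"
      proof -
        have "p - 1 < tp.count t" using tp.k_lower[of t] False t p that by auto
        then show ?thesis using S'(1)[of p] S'(2)[of "p - 1"] p that Y4[of d p] l d(1) by simp
      qed
    qed
    then show ?thesis using False by (simp add: tp.step_def)
  qed
  then show ?thesis using states start finish
    by (auto simp: tp.chains_def slices_of_def)
qed

lemma slices_of_bij: "bij_betw slices_of trunc (tp.chains (2 * L) (restrict M {..<m}))"
proof (rule bij_betw_byWitness[where f' = "array_of \<circ> extend"])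
  show "\<forall>a\<in>trunc. (array_of \<circ> extend) (slices_of a) = a"
  proof
    fix a assume a: "a \<in> trunc"
    then have "a \<in> arrays n m \<mu> \<nu> \<Lambda>" by (simp add: trunc_def)
    then show "(array_of \<circ> extend) (slices_of a) = a"
      using array_of_positions extend_slices_of[OF a] by simp
  qed
qed (use slices_of_chain chain_trunc slices_of_chains in auto)

lemma finite_trunc: "finite trunc"
  using bij_betw_finite[OF slices_of_bij] tp.finite_chains by blast

lemma cell_inj: "inj_on (\<lambda>(t, p). cell (int L - int t) p) (SIGMA t:{..2 * L}. {..<tp.count t})"
proof (rule inj_onI, clarify)
  fix t p t' p'
  assume t: "t \<le> 2 * L" "t' \<le> 2 * L" and p: "p < tp.count t" "p' < tp.count t'"
    and eq: "cell (int L - int t) p = cell (int L - int t') p'"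
  obtain i j where ij: "cell (int L - int t) p = (i, j)" by force
  show "t = t' \<and> p = p'"
    using live_cell(4,5)[of "int L - int t" p i j] live_cell(4,5)[of "int L - int t'" p' i j]
      less_count_live[of t p] less_count_live[of t' p'] t p eq ij by simp
qed

text \<open>Cells outside the listed slices contribute nothing: either their index is negative and
  entry and limit are both zero, or they lie at diagonal \<open>L\<close> or farther out, at the
  asymptotic value. Time \<open>0\<close> contributes zero too, but is kept so that the range
  matches the weighted times of a path.\<close>

lemma weight_trunc:
  assumes a: "a \<in> trunc"
  shows "weight n m \<mu> \<nu> \<Lambda> a =
    (\<Sum>t\<le>L. \<Sum>p<tp.count t. int (slices_of a t p) - int (N p)) +
    (\<Sum>t\<in>{L<..<2 * L}. \<Sum>p<tp.count t. int (slices_of a t p) - int (M p))"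
proof -
  have arr: "a \<in> arrays n m \<mu> \<nu> \<Lambda>" using a by (simp add: trunc_def)
  define c where "c = (\<lambda>(t, p). cell (int L - int t) p)"
  define U where "U = (SIGMA t:{..L}. {..<tp.count t})"
  define V where "V = (SIGMA t:{L<..<2 * L}. {..<tp.count t})"
  have inj: "inj_on c U" "inj_on c V"
    unfolding c_def U_def V_def by (rule inj_on_subset[OF cell_inj]; force)+
  have live_U: "live (int L - int t) p" if "(t, p) \<in> U" for t p
    using that less_count_live[of t p] by (auto simp: U_def)
  have live_V: "live (int L - int t) p" if "(t, p) \<in> V" for t p
    using that less_count_live[of t p] by (auto simp: V_def)
  have cellE: "(i, j) = c (nat (int L - diag i j), nat (idx i j)) \<and> live (diag i j) (nat (idx i j))"
    if "1 \<le> i" "1 \<le> j" "(i, j) \<notin> diagram \<Lambda>" "0 \<le> idx i j" "diag i j \<le> int L" for i j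
    using cell_diag[OF that(1-4)] that(5) by (simp add: c_def)
  have "(\<Sum>\<^sub>\<infinity>(i, j)\<in>upper_cells n m \<Lambda>. int (the_enat (a (i, j))) - int (\<nu> i)) =
      (\<Sum>\<^sub>\<infinity>(i, j)\<in>c ` U. int (the_enat (a (i, j))) - int (\<nu> i))"
  proof (rule infsum_cong_neutral)
    fix x assume x: "x \<in> upper_cells n m \<Lambda> - c ` U"
    obtain i j where ij: "x = (i, j)" by force
    then have i: "1 \<le> i" "1 \<le> j" "(i, j) \<notin> diagram \<Lambda>" "0 \<le> diag i j"
      using x by (auto simp: upper_cells_def diag_def)
    have "a (i, j) = enat (\<nu> i)"
    proof (cases "idx i j < 0")
      case True
      then have n: "n < i" "m < j" by (auto simp: idx_def)
      then have "\<nu> i = 0" using lens(1) by (intro is_partition_eq_0[OF parts(1)]) simp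
      then show ?thesis using arrays_eq_0[OF parts lens arr n] by (simp add: zero_enat_def)
    next
      case F: False
      have "int L \<le> diag i j"
      proof (rule ccontr)
        assume "\<not> int L \<le> diag i j"
        then have d: "nat (int L - diag i j) \<le> L" "int L - int (nat (int L - diag i j)) = diag i j" "diag i j \<le> int L"
          using i by auto
        have "(nat (int L - diag i j), nat (idx i j)) \<in> U"
          using less_count_live[of "nat (int L - diag i j)" "nat (idx i j)"] cellE[OF i(1-3) _ d(3)] F d
          by (auto simp: U_def)
        then show False using cellE[OF i(1-3) _ d(3)] F x ij by auto
      qed
      then show ?thesis using a i by (simp add: trunc_def)
    qed
    then show "(case x of (i, j) \<Rightarrow> int (the_enat (a (i, j))) - int (\<nu> i)) = 0" by (simp add: ij)
  next
    fix x assume x: "x \<in> c ` U - upper_cells n m \<Lambda>"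
    then obtain t p where tp: "(t, p) \<in> U" "x = c (t, p)" by auto
    obtain i j where ij: "cell (int L - int t) p = (i, j)" by force
    have "x \<in> upper_cells n m \<Lambda>"
      using live_cell[OF live_U[OF tp(1)] ij] tp ij by (auto simp: c_def upper_cells_def diag_def U_def)
    then show "(case x of (i, j) \<Rightarrow> int (the_enat (a (i, j))) - int (\<nu> i)) = 0" using x by blast
  qed simp
  also have "\<dots> = (\<Sum>(i, j)\<in>c ` U. int (the_enat (a (i, j))) - int (\<nu> i))"
    by (rule infsum_finite) (auto simp: U_def)
  also have "\<dots> = (\<Sum>(t, p)\<in>U. int (slices_of a t p) - int (N p))"
  proof (subst sum.reindex[OF inj(1)], rule sum.cong[OF refl])
    fix x assume x: "x \<in> U"
    obtain t p where tp: "x = (t, p)" by force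
    obtain i j where ij: "cell (int L - int t) p = (i, j)" by force
    have "live (int L - int t) p" "t \<le> L" "p < tp.count t" using x tp live_U by (auto simp: U_def)
    moreover from this have "i = n - p" using ij live_upper[of "int L - int t" p] by (auto simp: cell_def)
    ultimately show "((\<lambda>(i, j). int (the_enat (a (i, j))) - int (\<nu> i)) \<circ> c) x =
        (case x of (t, p) \<Rightarrow> int (slices_of a t p) - int (N p))"
      by (simp add: tp c_def ij slices_of_def positions_def N_def)
  qed
  also have "\<dots> = (\<Sum>t\<le>L. \<Sum>p<tp.count t. int (slices_of a t p) - int (N p))"
    unfolding U_def by (rule sum.Sigma[symmetric]) auto
  finally have up: "(\<Sum>\<^sub>\<infinity>(i, j)\<in>upper_cells n m \<Lambda>. int (the_enat (a (i, j))) - int (\<nu> i)) =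
      (\<Sum>t\<le>L. \<Sum>p<tp.count t. int (slices_of a t p) - int (N p))" .
  have "(\<Sum>\<^sub>\<infinity>(i, j)\<in>lower_cells n m \<Lambda>. int (the_enat (a (i, j))) - int (\<mu> j)) =
      (\<Sum>\<^sub>\<infinity>(i, j)\<in>c ` V. int (the_enat (a (i, j))) - int (\<mu> j))"
  proof (rule infsum_cong_neutral)
    fix x assume x: "x \<in> lower_cells n m \<Lambda> - c ` V"
    obtain i j where ij: "x = (i, j)" by force
    then have i: "1 \<le> i" "1 \<le> j" "(i, j) \<notin> diagram \<Lambda>" "diag i j < 0"
      using x by (auto simp: lower_cells_def diag_def)
    have "a (i, j) = enat (\<mu> j)"
    proof (cases "idx i j < 0")
      case True
      then have n: "n < i" "m < j" by (auto simp: idx_def)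
      then have "\<mu> j = 0" using lens(2) by (intro is_partition_eq_0[OF parts(2)]) simp
      then show ?thesis using arrays_eq_0[OF parts lens arr n] by (simp add: zero_enat_def)
    next
      case F: False
      have "diag i j \<le> - int L"
      proof (rule ccontr)
        assume "\<not> diag i j \<le> - int L"
        then have d: "nat (int L - diag i j) < 2 * L" "L < nat (int L - diag i j)"
          "int L - int (nat (int L - diag i j)) = diag i j" "diag i j \<le> int L"
          using i by auto
        have "(nat (int L - diag i j), nat (idx i j)) \<in> V"
          using less_count_live[of "nat (int L - diag i j)" "nat (idx i j)"] cellE[OF i(1-3) _ d(4)] F d
          by (auto simp: V_def)
        then show False using cellE[OF i(1-3) _ d(4)] F x ij by auto
      qed
      then show ?thesis using a i by (simp add: trunc_def)
    qed
    then show "(case x of (i, j) \<Rightarrow> int (the_enat (a (i, j))) - int (\<mu> j)) = 0" by (simp add: ij)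
  next
    fix x assume x: "x \<in> c ` V - lower_cells n m \<Lambda>"
    then obtain t p where tp: "(t, p) \<in> V" "x = c (t, p)" by auto
    obtain i j where ij: "cell (int L - int t) p = (i, j)" by force
    have "x \<in> lower_cells n m \<Lambda>"
      using live_cell[OF live_V[OF tp(1)] ij] tp ij by (auto simp: c_def lower_cells_def diag_def V_def)
    then show "(case x of (i, j) \<Rightarrow> int (the_enat (a (i, j))) - int (\<mu> j)) = 0" using x by blast
  qed simp
  also have "\<dots> = (\<Sum>(i, j)\<in>c ` V. int (the_enat (a (i, j))) - int (\<mu> j))"
    by (rule infsum_finite) (auto simp: V_def)
  also have "\<dots> = (\<Sum>(t, p)\<in>V. int (slices_of a t p) - int (M p))"
  proof (subst sum.reindex[OF inj(2)], rule sum.cong[OF refl])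
    fix x assume x: "x \<in> V"
    obtain t p where tp: "x = (t, p)" by force
    obtain i j where ij: "cell (int L - int t) p = (i, j)" by force
    have "live (int L - int t) p" "L < t" "t \<le> 2 * L" "p < tp.count t" using x tp live_V by (auto simp: V_def)
    moreover from this have "j = m - p" using ij live_lower[of "int L - int t" p] by (auto simp: cell_def)
    ultimately show "((\<lambda>(i, j). int (the_enat (a (i, j))) - int (\<mu> j)) \<circ> c) x =
        (case x of (t, p) \<Rightarrow> int (slices_of a t p) - int (M p))"
      by (simp add: tp c_def ij slices_of_def positions_def M_def)
  qed
  also have "\<dots> = (\<Sum>t\<in>{L<..<2 * L}. \<Sum>p<tp.count t. int (slices_of a t p) - int (M p))"
    unfolding V_def by (rule sum.Sigma[symmetric]) auto
  finally show ?thesis unfolding weight_def up by simp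
qed

text \<open>The total of the asymptotic positions is \<open>C - shift\<close>, while
  \<open>tp.chains_det\<close> supplies a factor with exponent \<open>C\<close>; only
  \<open>shift\<close> survives.\<close>

theorem sum_trunc:
  "(\<Sum>a\<in>trunc. fls_X ^ nat (weight n m \<mu> \<nu> \<Lambda> a)) =
    fls_X powi shift * fdet (n + m - diag_r n m \<Lambda>) tp.entry"
proof -
  define C where "C = (L - 1) * (\<Sum>p<m. M p) + (L + 1) * (\<Sum>p<n. N p)"
  have intC: "int C = (int L - 1) * (\<Sum>p<m. int (M p)) + (int L + 1) * (\<Sum>p<n. int (N p))"
    using L_pos by (simp only: C_def of_nat_add of_nat_mult of_nat_sum of_nat_diff Suc_le_eq One_nat_def) simp
  have "fls_X ^ nat (weight n m \<mu> \<nu> \<Lambda> a) =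
      fls_X powi (shift - int C) * (\<Prod>u<2 * L. \<Prod>p<tp.count u. (fls_X :: rat fls) ^ slices_of a u p)"
    if a: "a \<in> trunc" for a
  proof -
    have arr: "a \<in> arrays n m \<mu> \<nu> \<Lambda>" using a by (simp add: trunc_def)
    have eq: "{..<2 * L} = {..L} \<union> {L<..<2 * L}" using L_pos by auto
    have "(\<Sum>u<2 * L. \<Sum>p<tp.count u. int (slices_of a u p)) =
        (\<Sum>u\<le>L. \<Sum>p<tp.count u. int (slices_of a u p)) + (\<Sum>u\<in>{L<..<2 * L}. \<Sum>p<tp.count u. int (slices_of a u p))"
      unfolding eq by (rule sum.union_disjoint) auto
    then have "int (\<Sum>u<2 * L. \<Sum>p<tp.count u. slices_of a u p) = weight n m \<mu> \<nu> \<Lambda> a +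
        ((\<Sum>t\<le>L. \<Sum>p<tp.count t. int (N p)) + (\<Sum>t\<in>{L<..<2 * L}. \<Sum>p<tp.count t. int (M p)))"
      unfolding weight_trunc[OF a] of_nat_sum sum_subtractf by linarith
    also have "\<dots> = weight n m \<mu> \<nu> \<Lambda> a + (int C - shift)"
      unfolding tp.sum_ground_upper tp.sum_ground_lower intC shift_def by linarith
    finally have w: "int (nat (weight n m \<mu> \<nu> \<Lambda> a)) =
        shift - int C + int (\<Sum>u<2 * L. \<Sum>p<tp.count u. slices_of a u p)"
      using weight_nonneg[OF parts lens arr] by simp
    have "(fls_X :: rat fls) ^ nat (weight n m \<mu> \<nu> \<Lambda> a) = fls_X powi int (nat (weight n m \<mu> \<nu> \<Lambda> a))"
      by (simp only: power_int_of_nat)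
    also have "\<dots> = fls_X powi (shift - int C) * fls_X ^ (\<Sum>u<2 * L. \<Sum>p<tp.count u. slices_of a u p)"
      unfolding w by (simp only: tp.fls_X_powi_add power_int_of_nat)
    finally show ?thesis by (simp only: power_sum)
  qed
  then have "(\<Sum>a\<in>trunc. fls_X ^ nat (weight n m \<mu> \<nu> \<Lambda> a)) =
      fls_X powi (shift - int C) * (\<Sum>a\<in>trunc. \<Prod>u<2 * L. \<Prod>p<tp.count u. (fls_X :: rat fls) ^ slices_of a u p)"
    unfolding sum_distrib_left by (rule sum.cong[OF refl])
  also have "(\<Sum>a\<in>trunc. \<Prod>u<2 * L. \<Prod>p<tp.count u. (fls_X :: rat fls) ^ slices_of a u p) =
      (\<Sum>X\<in>tp.chains (2 * L) (restrict M {..<m}). \<Prod>u<2 * L. \<Prod>p<tp.count u. fls_X ^ X u p)"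
    by (rule sum.reindex_bij_betw[OF slices_of_bij])
  also have "\<dots> = fls_X ^ C * fdet (n + m - diag_r n m \<Lambda>) tp.entry"
    unfolding C_def by (rule tp.chains_det)
  also have "fls_X powi (shift - int C) * (fls_X ^ C * fdet (n + m - diag_r n m \<Lambda>) tp.entry) =
      fls_X powi (shift - int C + int C) * fdet (n + m - diag_r n m \<Lambda>) tp.entry"
    by (simp only: tp.fls_X_powi_add power_int_of_nat mult.assoc)
  finally show ?thesis by (simp only: diff_add_cancel)
qed

end

section \<open>Limits of Laurent series and the q-series identity\<close>

definition fls_vanish :: "int \<Rightarrow> 'a::field fls \<Rightarrow> bool" where
  "fls_vanish K f \<longleftrightarrow> (\<forall>k<K. fls_nth f k = 0)"

text \<open>Convergence in the X-adic sense. As \<open>fls_vanish\<close> covers all orders below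
  \<open>K\<close> at once, the poles are eventually uniformly bounded, which multiplication needs
  and coefficientwise convergence would not give.\<close>

definition fls_lim :: "(nat \<Rightarrow> 'a::field fls) \<Rightarrow> 'a fls \<Rightarrow> bool" where
  "fls_lim F f \<longleftrightarrow> (\<forall>K. \<forall>\<^sub>F L in sequentially. fls_vanish K (F L - f))"

lemma fls_vanish_mono: "fls_vanish K f \<Longrightarrow> J \<le> K \<Longrightarrow> fls_vanish J f"
  by (auto simp: fls_vanish_def)

lemma fls_vanish_0 [simp]: "fls_vanish K 0"
  by (simp add: fls_vanish_def)

lemma fls_vanish_add: "fls_vanish K f \<Longrightarrow> fls_vanish K g \<Longrightarrow> fls_vanish K (f + g)"
  and fls_vanish_diff: "fls_vanish K f \<Longrightarrow> fls_vanish K g \<Longrightarrow> fls_vanish K (f - g)"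
  and fls_vanish_uminus: "fls_vanish K f \<Longrightarrow> fls_vanish K (- f)"
  by (auto simp: fls_vanish_def)

lemma fls_vanish_sum: "(\<And>x. x \<in> A \<Longrightarrow> fls_vanish K (f x)) \<Longrightarrow> fls_vanish K (sum f A)"
  by (induction A rule: infinite_finite_induct) (auto intro: fls_vanish_add)

lemma fls_vanish_iff: "fls_vanish K f \<longleftrightarrow> f = 0 \<or> K \<le> fls_subdegree f"
  unfolding fls_vanish_def using fls_subdegree_geI[of f K] by fastforce

lemma fls_vanish_mult: "fls_vanish J f \<Longrightarrow> fls_vanish K g \<Longrightarrow> fls_vanish (J + K) (f * g)"
  unfolding fls_vanish_iff by (cases "f * g = 0") auto

lemma fls_vanish_subdegree: "fls_vanish (fls_subdegree f) f"
  by (simp add: fls_vanish_iff)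

lemma fls_vanish_all:
  assumes "\<And>K. fls_vanish K f" shows "f = 0"
proof (rule fls_eqI)
  fix k show "fls_nth f k = fls_nth 0 k" using assms[of "k + 1"] by (simp add: fls_vanish_def)
qed

lemma fls_vanish_powi: "fls_vanish K (fls_X powi e :: 'a::field fls)" if "K \<le> e"
  using that by (auto simp: fls_X_powi fls_vanish_def)

lemma fls_lim_const: "fls_lim (\<lambda>_. f) f"
  by (simp add: fls_lim_def)

lemma fls_lim_cong: "(\<forall>\<^sub>F L in sequentially. F L = G L) \<Longrightarrow> fls_lim F f \<Longrightarrow> fls_lim G f"
  unfolding fls_lim_def
proof
  fix K assume "\<forall>\<^sub>F L in sequentially. F L = G L" and "\<forall>K. \<forall>\<^sub>F L in sequentially. fls_vanish K (F L - f)"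
  then have "\<forall>\<^sub>F L in sequentially. F L = G L" "\<forall>\<^sub>F L in sequentially. fls_vanish K (F L - f)" by auto
  then show "\<forall>\<^sub>F L in sequentially. fls_vanish K (G L - f)" by eventually_elim simp
qed

lemma fls_lim_unique:
  assumes "fls_lim F f" "fls_lim F g" shows "f = g"
proof -
  have "fls_vanish K (f - g)" for K
  proof -
    from assms have "\<forall>\<^sub>F L in sequentially. fls_vanish K (F L - f) \<and> fls_vanish K (F L - g)"
      by (simp add: fls_lim_def eventually_conj_iff)
    then obtain L where "fls_vanish K (F L - f)" "fls_vanish K (F L - g)"
      by (auto simp: eventually_sequentially)
    from fls_vanish_diff[OF this(2,1)] show ?thesis by simp
  qed
  then show ?thesis using fls_vanish_all by fastforce
qed

lemma fls_lim_add:
  assumes "fls_lim F f" "fls_lim G g" shows "fls_lim (\<lambda>L. F L + G L) (f + g)"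
  unfolding fls_lim_def
proof
  fix K
  from assms have "\<forall>\<^sub>F L in sequentially. fls_vanish K (F L - f)" "\<forall>\<^sub>F L in sequentially. fls_vanish K (G L - g)"
    by (simp_all add: fls_lim_def)
  then show "\<forall>\<^sub>F L in sequentially. fls_vanish K (F L + G L - (f + g))"
  proof eventually_elim
    case (elim L)
    from fls_vanish_add[OF this] show ?case by (simp add: algebra_simps)
  qed
qed

text \<open>In \<open>F G - f g = (F - f) G + f (G - g)\<close> each difference must be small enough
  to offset the order of its cofactor; the bound \<open>max b (K - a)\<close> also keeps the order
  of \<open>G L\<close> at least \<open>b\<close>.\<close>

lemma fls_lim_mult:
  assumes "fls_lim F f" "fls_lim G g" shows "fls_lim (\<lambda>L. F L * G L) (f * g)"
  unfolding fls_lim_def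
proof
  fix K
  define a where "a = fls_subdegree f"
  define b where "b = fls_subdegree g"
  have a: "fls_vanish a f" and b: "fls_vanish b g"
    unfolding a_def b_def by (rule fls_vanish_subdegree)+
  from assms have "\<forall>\<^sub>F L in sequentially. fls_vanish (K - b) (F L - f)"
    "\<forall>\<^sub>F L in sequentially. fls_vanish (max b (K - a)) (G L - g)"
    by (simp_all add: fls_lim_def)
  then show "\<forall>\<^sub>F L in sequentially. fls_vanish K (F L * G L - f * g)"
  proof eventually_elim
    case (elim L)
    have "fls_vanish b (G L - g + g)" using elim(2) b by (intro fls_vanish_add) (auto intro: fls_vanish_mono)
    then have "fls_vanish ((K - b) + b) ((F L - f) * G L)" using elim(1) by (intro fls_vanish_mult) simp_all
    moreover have "fls_vanish (a + (K - a)) (f * (G L - g))"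
      using elim(2) a by (intro fls_vanish_mult) (auto intro: fls_vanish_mono)
    ultimately have "fls_vanish K ((F L - f) * G L + f * (G L - g))" by (intro fls_vanish_add) simp_all
    then show ?case by (simp add: algebra_simps)
  qed
qed

lemma fls_lim_diff:
  assumes "fls_lim F f" "fls_lim G g" shows "fls_lim (\<lambda>L. F L - G L) (f - g)"
  using fls_lim_add[OF assms(1) fls_lim_mult[OF fls_lim_const[of "- 1"] assms(2)]] by simp

lemma fls_lim_sum: "(\<And>x. x \<in> A \<Longrightarrow> fls_lim (F x) (f x)) \<Longrightarrow> fls_lim (\<lambda>L. \<Sum>x\<in>A. F x L) (\<Sum>x\<in>A. f x)"
  by (induction A rule: infinite_finite_induct) (auto intro: fls_lim_add fls_lim_const)

lemma fls_lim_prod: "(\<And>x. x \<in> A \<Longrightarrow> fls_lim (F x) (f x)) \<Longrightarrow> fls_lim (\<lambda>L. \<Prod>x\<in>A. F x L) (\<Prod>x\<in>A. f x)"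
  by (induction A rule: infinite_finite_induct) (auto intro: fls_lim_mult fls_lim_const)

lemma fls_lim_fdet:
  assumes "\<And>i j. i < K \<Longrightarrow> j < K \<Longrightarrow> fls_lim (\<lambda>L. R L i j) (R' i j)"
  shows "fls_lim (\<lambda>L. fdet K (R L)) (fdet K R')"
  unfolding fdet_leibniz
proof (intro fls_lim_sum fls_lim_mult fls_lim_const fls_lim_prod)
  fix p i assume "p \<in> {p. p permutes {0..<K}}" "i \<in> {..<K}"
  then show "fls_lim (\<lambda>L. R L i (p i)) (R' i (p i))"
    using assms permutes_in_image[of p "{0..<K}" i] by auto
qed

text \<open>Subdegree zero makes every inverse a power series, so
  \<open>1 / F - 1 / f = (f - F) / (F f)\<close> loses no accuracy.\<close>

lemma fls_lim_inverse:
  assumes F: "fls_lim F f" and f: "f \<noteq> 0" "fls_subdegree f = 0" and FL: "\<And>L. F L \<noteq> 0" "\<And>L. fls_subdegree (F L) = 0"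
  shows "fls_lim (\<lambda>L. inverse (F L)) (inverse f)"
  unfolding fls_lim_def
proof
  fix K
  have inv: "fls_vanish 0 (inverse g)" if "fls_subdegree g = 0" for g :: "'a fls"
    using that by (simp add: fls_vanish_iff)
  from F have "\<forall>\<^sub>F L in sequentially. fls_vanish K (F L - f)" by (simp add: fls_lim_def)
  then show "\<forall>\<^sub>F L in sequentially. fls_vanish K (inverse (F L) - inverse f)"
  proof eventually_elim
    case (elim L)
    have "fls_vanish (K + 0 + 0) ((- (F L - f)) * inverse (F L) * inverse f)"
      using elim inv f FL by (intro fls_vanish_mult fls_vanish_uminus) auto
    moreover have "(- (F L - f)) * inverse (F L) * inverse f = inverse (F L) - inverse f"
      using f FL[of L] by (simp add: field_simps)
    ultimately show ?case by simp
  qed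
qed

lemma LIMSEQ_fls_lim:
  assumes "F \<longlonglongrightarrow> f" shows "fls_lim F (f :: 'a::field fls)"
  unfolding fls_lim_def
proof
  fix K :: int
  have "\<forall>\<^sub>F L in sequentially. dist (F L) f < inverse (2 ^ nat K)"
    using assms by (rule tendstoD) simp
  then show "\<forall>\<^sub>F L in sequentially. fls_vanish K (F L - f)"
  proof eventually_elim
    case (elim L)
    have "K \<le> fls_subdegree (F L - f)" if "F L \<noteq> f"
    proof (cases "0 \<le> fls_subdegree (F L - f)")
      case True
      then have "inverse (2 ^ nat (fls_subdegree (F L - f))) < (inverse (2 ^ nat K) :: real)"
        using elim that by (simp add: dist_fls_def)
      then have "nat K < nat (fls_subdegree (F L - f))" by simp
      then show ?thesis by simp
    next
      case False
      then have "(2 :: real) ^ nat (- fls_subdegree (F L - f)) < inverse (2 ^ nat K)"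
        using elim that by (simp add: dist_fls_def)
      moreover have "inverse (2 ^ nat K) \<le> (1 :: real)" by (simp add: inverse_le_1_iff)
      moreover have "(1 :: real) \<le> 2 ^ nat (- fls_subdegree (F L - f))" by simp
      ultimately show ?thesis by linarith
    qed
    then show ?case by (auto simp: fls_vanish_iff)
  qed
qed

lemma fls_lim_suminf: "summable F \<Longrightarrow> fls_lim (\<lambda>n. \<Sum>a<n. F a) (suminf F :: 'a::field fls)"
  by (rule LIMSEQ_fls_lim) (rule summable_LIMSEQ)

lemma fls_lim_subseq:
  assumes "fls_lim F f" "filterlim g at_top sequentially" shows "fls_lim (\<lambda>L. F (g L)) f"
  using assms unfolding fls_lim_def filterlim_iff by blast

lemma fls_lim_vanish:
  assumes "fls_lim F f" "\<And>L. fls_vanish K (F L)" shows "fls_vanish K f"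
proof -
  from assms(1) obtain L where "fls_vanish K (F L - f)" by (auto simp: fls_lim_def eventually_sequentially)
  from fls_vanish_diff[OF assms(2)[of L] this] show ?thesis by simp
qed

section \<open>Finite and infinite q-Pochhammer symbols\<close>

abbreviation (input) poch :: "nat \<Rightarrow> rat fls" where "poch \<equiv> qpoch fls_X"
abbreviation (input) Qinf :: "rat fls" where "Qinf \<equiv> fps_to_fls q_inf"

lemma poch_fps: "poch k = fps_to_fls (\<Prod>i<k. 1 - fps_X ^ Suc i)"
  by (induction k) (simp_all add: qpoch_Suc fls_times_fps_to_fls fps_to_fls_power fps_to_fls_minus algebra_simps)

lemma poch_prod_nth_0: "fps_nth (\<Prod>i<k. 1 - fps_X ^ Suc i :: rat fps) 0 = 1"
  by (induction k) simp_all

lemma poch_props: "poch k \<noteq> 0" "fls_subdegree (poch k) = 0"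
proof -
  have "fps_nth (\<Prod>i<k. 1 - fps_X ^ Suc i :: rat fps) 0 \<noteq> 0" by (simp only: poch_prod_nth_0 one_neq_zero simp_thms)
  then show "fls_subdegree (poch k) = 0"
    unfolding poch_fps fls_subdegree_fls_to_fps by (simp add: subdegree_eq_0)
  show "poch k \<noteq> 0" by (rule qpoch_nonzero[OF fls_X_power_neq_1])
qed

text \<open>Convergence of a product may be witnessed after dropping \<open>M\<close> factors. As no
  factor is zero, they can be multiplied back, which identifies \<open>q_inf\<close> with the limit
  of the full partial products.\<close>

lemma q_inf_LIMSEQ: "(\<lambda>n. \<Prod>i\<le>n. 1 - fps_X ^ Suc i :: rat fps) \<longlonglongrightarrow> q_inf"
proof -
  let ?f = "\<lambda>k. 1 - fps_X ^ Suc k :: rat fps"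
  have nz: "?f k \<noteq> 0" for k
  proof
    assume "?f k = 0"
    then have "fps_nth (?f k) 0 = fps_nth 0 0" by (simp only:)
    then show False by simp
  qed
  obtain M p where p: "raw_has_prod ?f M p" using convergent_q_inf by (auto simp: convergent_prod_def)
  let ?c = "\<Prod>i<M. ?f i"
  have mult: "\<forall>\<^sub>F n in sequentially. fps_nth (\<Prod>i\<le>n. ?f i) k = fps_nth (?c * p) k" for k
  proof -
    have ev: "\<forall>\<^sub>F n in sequentially. fps_nth (\<Prod>i\<le>n. ?f (i + M)) l = fps_nth p l" for l
      using p by (simp only: raw_has_prod_def tendsto_fps_iff)
    have "\<forall>\<^sub>F n in sequentially. \<forall>l\<in>{..k}. fps_nth (\<Prod>i\<le>n. ?f (i + M)) l = fps_nth p l"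
      by (rule eventually_ball_finite) (use ev in auto)
    then have "\<forall>\<^sub>F n in sequentially. fps_nth (\<Prod>i\<le>n + M. ?f i) k = fps_nth (?c * p) k"
    proof eventually_elim
      case (elim n)
      have "{..n + M} = {..<M} \<union> {M..n + M}" by auto
      then have "(\<Prod>i\<le>n + M. ?f i) = ?c * (\<Prod>i\<in>{M..n + M}. ?f i)"
        by (simp only:) (rule prod.union_disjoint; auto)
      also have "(\<Prod>i\<in>{M..n + M}. ?f i) = (\<Prod>i\<le>n. ?f (i + M))"
        by (rule prod.reindex_bij_witness[where i = "\<lambda>i. i + M" and j = "\<lambda>i. i - M"]) auto
      finally show ?case using elim by (simp only: fps_mult_nth) (auto intro!: sum.cong)
    qed
    then show ?thesis by (rule eventually_sequentially_seg[THEN iffD1])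
  qed
  then have lim: "(\<lambda>n. \<Prod>i\<le>n. ?f i) \<longlonglongrightarrow> ?c * p" by (simp only: tendsto_fps_iff) simp
  moreover have "?c * p \<noteq> 0" using p nz by (simp add: raw_has_prod_def del: power_Suc)
  ultimately have has: "raw_has_prod ?f 0 (?c * p)" by (simp add: raw_has_prod_def del: power_Suc)
  then have "?f has_prod (?c * p)" by (simp only: has_prod_def simp_thms)
  then have "q_inf = ?c * p" unfolding q_inf_def by (rule has_prod_unique[symmetric])
  then show ?thesis using lim by (simp only:)
qed

lemma poch_lim: "fls_lim poch Qinf" and Qinf_props: "Qinf \<noteq> 0" "fls_subdegree Qinf = 0"
proof -
  have "(\<lambda>n. \<Prod>i\<le>n. 1 - fps_X ^ Suc i :: rat fps) \<longlonglongrightarrow> q_inf"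
    by (rule q_inf_LIMSEQ)
  then have ev: "\<forall>\<^sub>F n in sequentially. fps_nth (\<Prod>i\<le>n. 1 - fps_X ^ Suc i) k = fps_nth q_inf k" for k
    by (simp only: tendsto_fps_iff)
  have "\<forall>\<^sub>F n in sequentially. \<forall>k\<in>{..<K}. fps_nth (\<Prod>i\<le>n. 1 - fps_X ^ Suc i) k = fps_nth q_inf k" for K :: nat
    by (rule eventually_ball_finite) (use ev in auto)
  then have "fls_lim (\<lambda>n. poch (Suc n)) Qinf"
    unfolding fls_lim_def
  proof (intro allI)
    fix K :: int
    assume *: "\<And>K. \<forall>\<^sub>F n in sequentially. \<forall>k\<in>{..<K}. fps_nth (\<Prod>i\<le>n. 1 - fps_X ^ Suc i) k = fps_nth q_inf k"
    from *[of "nat K"] show "\<forall>\<^sub>F n in sequentially. fls_vanish K (poch (Suc n) - Qinf)"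
    proof eventually_elim
      case (elim n)
      then show ?case by (auto simp: fls_vanish_def poch_fps lessThan_Suc_atMost)
    qed
  qed
  then have "fls_lim (\<lambda>n. poch (Suc (n - 1))) Qinf"
    by (rule fls_lim_subseq) (simp add: filterlim_minus_const_nat_at_top)
  then show "fls_lim poch Qinf"
    by (rule fls_lim_cong[rotated]) (auto simp: eventually_sequentially intro!: exI[of _ 1])
  have "fps_nth q_inf 0 = 1"
  proof -
    obtain n where "fps_nth (\<Prod>i\<le>n. 1 - fps_X ^ Suc i) 0 = fps_nth q_inf 0"
      using ev[of 0] by (auto simp: eventually_sequentially)
    then show ?thesis using poch_prod_nth_0[of "Suc n"] by (simp only: lessThan_Suc_atMost)
  qed
  then show "Qinf \<noteq> 0" "fls_subdegree Qinf = 0"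
    by (auto simp: fls_subdegree_fls_to_fps subdegree_eq_0_iff)
qed

lemma inverse_poch_lim: "fls_lim (\<lambda>L. inverse (poch L)) (inverse Qinf)"
  by (rule fls_lim_inverse[OF poch_lim Qinf_props poch_props])

text \<open>\<open>1 / (q)\<^sub>j\<close> with the convention that it vanishes for negative \<open>j\<close>, which makes the recursion
  below hold for all integers.\<close>

definition ipoch :: "int \<Rightarrow> rat fls" where
  "ipoch j = (if j < 0 then 0 else inverse (poch (nat j)))"

lemma ipoch_rec: "ipoch j = (1 - fls_X powi (j + 1)) * ipoch (j + 1)"
proof (cases "0 \<le> j")
  case True
  have "(fls_X :: rat fls) ^ Suc (nat j) \<noteq> 1" by (rule fls_X_power_neq_1)
  then have "1 - (fls_X :: rat fls) ^ Suc (nat j) \<noteq> 0" by (metis eq_iff_diff_eq_0)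
  moreover have "nat (j + 1) = Suc (nat j)" "(fls_X :: rat fls) powi (j + 1) = fls_X ^ Suc (nat j)"
    using True by (auto simp: power_int_def nat_add_distrib simp del: power_Suc)
  moreover have "\<not> j + 1 < 0" "\<not> j < 0" using True by auto
  ultimately show ?thesis
    by (simp only: ipoch_def qpoch_Suc if_False inverse_mult_distrib mult.assoc[symmetric] right_inverse mult_1 simp_thms)
next
  case False
  then show ?thesis by (cases "j = - 1") (auto simp: ipoch_def)
qed

lemma ipoch_vanish: "fls_vanish 0 (ipoch j)"
  using poch_props by (simp add: ipoch_def fls_vanish_iff)

lemma ipoch_lim: "filterlim g at_top sequentially \<Longrightarrow> fls_lim (\<lambda>L. ipoch (g L)) (inverse Qinf)"
proof -
  assume g: "filterlim g at_top sequentially"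
  then have "fls_lim (\<lambda>L. inverse (poch (nat (g L)))) (inverse Qinf)"
    by (intro fls_lim_subseq[OF inverse_poch_lim] filterlim_compose[OF filterlim_nat_sequentially])
  moreover have "\<forall>\<^sub>F L in sequentially. 0 \<le> g L" using g by (simp add: filterlim_at_top)
  then have "\<forall>\<^sub>F L in sequentially. inverse (poch (nat (g L))) = ipoch (g L)"
  proof eventually_elim
    case (elim L)
    then show ?case by (simp add: ipoch_def)
  qed
  ultimately show ?thesis by (rule fls_lim_cong[rotated])
qed

section \<open>The series of q^k / ((q)_k (q)_(k+D)) and its functional equation\<close>

definition meet_term :: "int \<Rightarrow> nat \<Rightarrow> rat fls" where
  "meet_term D k = fls_X ^ k * ipoch (int k) * ipoch (int k + D)"

lemma meet_term_vanish: "fls_vanish (int k) (meet_term D k)"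
proof -
  have "fls_vanish (int k + 0 + 0) (meet_term D k)"
    unfolding meet_term_def using fls_vanish_powi[of "int k" "int k"]
    by (intro fls_vanish_mult ipoch_vanish) simp
  then show ?thesis by simp
qed

definition meet_sum :: "int \<Rightarrow> rat fls" where "meet_sum D = suminf (meet_term D)"

lemma meet_sum_lim: "fls_lim (\<lambda>n. \<Sum>k<n. meet_term D k) (meet_sum D)"
  unfolding meet_sum_def
proof (rule fls_lim_suminf, rule fls_summableI)
  fix K :: int
  show "\<forall>\<^sub>F a in sequentially. \<forall>k<K. fls_nth (meet_term D a) k = 0"
    unfolding eventually_sequentially
  proof (intro exI allI impI)
    fix a k assume "nat K \<le> a" "k < K"
    then show "fls_nth (meet_term D a) k = 0" using meet_term_vanish[of a D] by (auto simp: fls_vanish_def)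
  qed
qed

text \<open>After \<open>ipoch (k + D)\<close> is expressed by \<open>ipoch (k + D + 1)\<close>, the
  terms on the left combine to a multiple of \<open>1 - fls_X ^ k\<close>, which turns
  \<open>ipoch k\<close> into \<open>ipoch (k - 1)\<close>. Shifting \<open>k\<close> gives the
  series for \<open>D + 2\<close>, with one term fewer.\<close>

lemma meet_term_rec:
  "(\<Sum>k<Suc n. meet_term D k) + fls_X powi (1 + D) * (\<Sum>k<Suc n. meet_term (D + 1) k) - (\<Sum>k<Suc n. meet_term (D + 1) k) =
    fls_X powi (2 + D) * (\<Sum>k<n. meet_term (D + 2) k)"
proof -
  have t: "meet_term D k + fls_X powi (1 + D) * meet_term (D + 1) k - meet_term (D + 1) k =
      fls_X powi (1 + D) * (fls_X ^ k * ipoch (int k - 1) * ipoch (int k + D + 1))" for k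
  proof -
    have x: "(fls_X :: rat fls) powi (int k + D + 1) = fls_X ^ k * fls_X powi (1 + D)"
      using power_int_add[of "fls_X :: rat fls" "int k" "1 + D"] by (simp add: add_ac)
    have 1: "ipoch (int k + D) = (1 - fls_X ^ k * fls_X powi (1 + D)) * ipoch (int k + D + 1)"
      using ipoch_rec[of "int k + D"] x by simp
    have 2: "ipoch (int k - 1) = (1 - fls_X ^ k) * ipoch (int k)"
      using ipoch_rec[of "int k - 1"] by simp
    show ?thesis unfolding meet_term_def 1 2 by (simp add: algebra_simps)
  qed
  have "(\<Sum>k<Suc n. meet_term D k) + fls_X powi (1 + D) * (\<Sum>k<Suc n. meet_term (D + 1) k) - (\<Sum>k<Suc n. meet_term (D + 1) k) =
      (\<Sum>k<Suc n. fls_X powi (1 + D) * (fls_X ^ k * ipoch (int k - 1) * ipoch (int k + D + 1)))"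
    unfolding t[symmetric] by (simp only: sum_distrib_left sum.distrib sum_subtractf)
  also have "\<dots> = (\<Sum>k<n. fls_X powi (1 + D) * (fls_X ^ Suc k * ipoch (int k) * ipoch (int k + (D + 2))))"
    by (subst sum.lessThan_Suc_shift) (simp add: ipoch_def[of "- 1"] add_ac)
  also have "\<dots> = fls_X powi (2 + D) * (\<Sum>k<n. meet_term (D + 2) k)"
  proof -
    have "(fls_X :: rat fls) powi (2 + D) = fls_X * fls_X powi (1 + D)"
      using power_int_add[of "fls_X :: rat fls" 1 "1 + D"] by simp
    then show ?thesis by (simp add: meet_term_def sum_distrib_left mult_ac)
  qed
  finally show ?thesis .
qed

text \<open>Both sides are the same expression at \<open>D\<close> and at \<open>D + 1\<close>: a
  second-order recursion written as the invariance of a first-order expression.\<close>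

lemma meet_sum_rec:
  "meet_sum D + fls_X powi (1 + D) * meet_sum (D + 1) = meet_sum (D + 1) + fls_X powi (2 + D) * meet_sum (D + 2)"
proof -
  have S: "fls_lim (\<lambda>n. \<Sum>k<Suc n. meet_term D k) (meet_sum D)" for D
    by (rule fls_lim_subseq[OF meet_sum_lim]) (rule filterlim_Suc)
  have "fls_lim (\<lambda>n. (\<Sum>k<Suc n. meet_term D k) + fls_X powi (1 + D) * (\<Sum>k<Suc n. meet_term (D + 1) k) - (\<Sum>k<Suc n. meet_term (D + 1) k))
      (meet_sum D + fls_X powi (1 + D) * meet_sum (D + 1) - meet_sum (D + 1))"
    by (intro fls_lim_add fls_lim_diff fls_lim_mult fls_lim_const S)
  moreover have "fls_lim (\<lambda>n. fls_X powi (2 + D) * (\<Sum>k<n. meet_term (D + 2) k)) (fls_X powi (2 + D) * meet_sum (D + 2))"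
    by (intro fls_lim_mult fls_lim_const meet_sum_lim)
  ultimately have "meet_sum D + fls_X powi (1 + D) * meet_sum (D + 1) - meet_sum (D + 1) = fls_X powi (2 + D) * meet_sum (D + 2)"
    unfolding meet_term_rec by (rule fls_lim_unique)
  then show ?thesis by (simp add: algebra_simps)
qed

lemma sum_X_ipoch: "(\<Sum>k<Suc n. fls_X ^ k * ipoch (int k)) = ipoch (int n)"
proof (induction n)
  case (Suc n)
  have "ipoch (int n) = (1 - fls_X ^ Suc n) * ipoch (int (Suc n))"
    using ipoch_rec[of "int n"] by (simp add: power_int_def nat_add_distrib add_ac)
  then show ?case using Suc by (simp add: algebra_simps)
qed (simp add: ipoch_def)

lemma meet_sum_vanish: "fls_vanish 0 (meet_sum D)"
proof (rule fls_lim_vanish[OF meet_sum_lim], rule fls_vanish_sum)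
  fix k show "fls_vanish 0 (meet_term D k)" by (rule fls_vanish_mono[OF meet_term_vanish]) simp
qed

text \<open>For large \<open>D\<close> the factor \<open>ipoch (k + D)\<close> is close to
  \<open>inverse Qinf\<close> uniformly in \<open>k\<close>, and the series without it sums to
  \<open>inverse Qinf\<close> by \<open>sum_X_ipoch\<close>.\<close>

lemma meet_sum_limit: "fls_lim (\<lambda>D. meet_sum (int D)) (inverse Qinf * inverse Qinf)"
  unfolding fls_lim_def
proof
  fix K
  have "\<forall>\<^sub>F D in sequentially. fls_vanish K (ipoch (int D) - inverse Qinf)"
    using ipoch_lim[of int] by (auto simp: fls_lim_def filterlim_int_sequentially)
  then obtain D0 where D0: "\<And>D. D0 \<le> D \<Longrightarrow> fls_vanish K (ipoch (int D) - inverse Qinf)"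
    by (auto simp: eventually_sequentially)
  have "fls_vanish K (meet_sum (int D) - inverse Qinf * inverse Qinf)" if D: "D0 \<le> D" for D
  proof (rule fls_lim_vanish)
    have "fls_lim (\<lambda>n. ipoch (int n)) (inverse Qinf)" by (rule ipoch_lim) (rule filterlim_int_sequentially)
    moreover have "fls_lim (\<lambda>n. \<Sum>k<Suc n. meet_term (int D) k) (meet_sum (int D))"
      by (rule fls_lim_subseq[OF meet_sum_lim]) (rule filterlim_Suc)
    ultimately show "fls_lim (\<lambda>n. (\<Sum>k<Suc n. meet_term (int D) k) - ipoch (int n) * inverse Qinf)
        (meet_sum (int D) - inverse Qinf * inverse Qinf)"
      by (intro fls_lim_diff fls_lim_mult fls_lim_const)
    fix n
    have e: "ipoch (int n) = (\<Sum>k<Suc n. fls_X ^ k * ipoch (int k))" by (rule sum_X_ipoch[symmetric])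
    have "(\<Sum>k<Suc n. meet_term (int D) k) - ipoch (int n) * inverse Qinf =
        (\<Sum>k<Suc n. (fls_X ^ k * ipoch (int k)) * (ipoch (int (k + D)) - inverse Qinf))"
      unfolding e sum_distrib_right
      by (simp add: meet_term_def right_diff_distrib sum_subtractf del: sum.lessThan_Suc)
    also have "fls_vanish K \<dots>"
    proof (rule fls_vanish_sum)
      fix k
      have "fls_vanish (int k + 0 + K) ((fls_X ^ k * ipoch (int k)) * (ipoch (int (k + D)) - inverse Qinf))"
        using fls_vanish_powi[of "int k" "int k"] D0[of "k + D"] D
        by (intro fls_vanish_mult ipoch_vanish) simp_all
      then show "fls_vanish K ((fls_X ^ k * ipoch (int k)) * (ipoch (int (k + D)) - inverse Qinf))"
        by (rule fls_vanish_mono) simp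
    qed
    finally show "fls_vanish K ((\<Sum>k<Suc n. meet_term (int D) k) - ipoch (int n) * inverse Qinf)" .
  qed
  then show "\<forall>\<^sub>F D in sequentially. fls_vanish K (meet_sum (int D) - inverse Qinf * inverse Qinf)"
    unfolding eventually_sequentially by blast
qed

text \<open>An expression invariant under shifts of \<open>D\<close> equals its limit as
  \<open>D\<close> grows, where the second summand vanishes.\<close>

lemma meet_sum_const: "meet_sum D + fls_X powi (1 + D) * meet_sum (D + 1) = inverse Qinf * inverse Qinf"
proof -
  define S where "S D = meet_sum D + fls_X powi (1 + D) * meet_sum (D + 1)" for D
  have step: "S (D + 1) = S D" for D using meet_sum_rec[of D] by (simp add: S_def add_ac)
  have S: "S (D + int l) = S D" for D l
  proof (induction l)
    case (Suc l)
    then show ?case using step[of "D + int l"] by (simp add: add_ac)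
  qed simp
  have "fls_lim (\<lambda>l. S (int l)) (inverse Qinf * inverse Qinf + 0)"
    unfolding S_def
  proof (rule fls_lim_add[OF meet_sum_limit])
    show "fls_lim (\<lambda>l. fls_X powi (1 + int l) * meet_sum (int l + 1)) 0"
      unfolding fls_lim_def eventually_sequentially
    proof (intro allI exI impI)
      fix K l assume "nat K \<le> l"
      then have "fls_vanish (K + 0) (fls_X powi (1 + int l) * meet_sum (int l + 1))"
        by (intro fls_vanish_mult fls_vanish_powi meet_sum_vanish) auto
      then show "fls_vanish K (fls_X powi (1 + int l) * meet_sum (int l + 1) - 0)" by simp
    qed
  qed
  moreover have "S (int l) = S 0" for l using S[of 0 l] by simp
  ultimately have "fls_lim (\<lambda>l. S 0) (inverse Qinf * inverse Qinf)" by simp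
  then have S0: "S 0 = inverse Qinf * inverse Qinf" by (rule fls_lim_unique[OF fls_lim_const])
  have "S D = S 0"
  proof (cases "0 \<le> D")
    case True
    then show ?thesis using S[of 0 "nat D"] by simp
  next
    case False
    then show ?thesis using S[of D "nat (- D)"] by simp
  qed
  then show ?thesis using S0 by (simp add: S_def)
qed

definition theta_term :: "int \<Rightarrow> nat \<Rightarrow> rat fls" where
  "theta_term d a = (-1) ^ a * fls_X powi (int ((a + 1) choose 2) + d * int a)"

lemma theta_lim: "fls_lim (\<lambda>n. \<Sum>a<n. theta_term d a) (theta_entry d)"
  unfolding theta_entry_def theta_term_def by (rule fls_lim_suminf[OF summable_theta_entry])

text \<open>Splitting off the term \<open>a = 0\<close> and shifting \<open>a\<close> by one
  multiplies the series for \<open>d + 1\<close> by \<open>- fls_X powi (1 + d)\<close>.\<close>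

lemma theta_rec: "theta_entry d + fls_X powi (1 + d) * theta_entry (d + 1) = 1"
proof -
  have t: "theta_term d (Suc a) = - (fls_X powi (1 + d) * theta_term (d + 1) a)" for a
  proof -
    have "int ((Suc a + 1) choose 2) + d * int (Suc a) = (1 + d) + (int ((a + 1) choose 2) + (d + 1) * int a)"
      by (simp add: numeral_2_eq_2 algebra_simps)
    then show ?thesis unfolding theta_term_def
      using power_int_add[of "fls_X :: rat fls" "1 + d" "int ((a + 1) choose 2) + (d + 1) * int a"] by (simp add: mult_ac)
  qed
  have "(\<Sum>a<Suc n. theta_term d a) + fls_X powi (1 + d) * (\<Sum>a<n. theta_term (d + 1) a) = 1" for n
    by (subst sum.lessThan_Suc_shift) (simp add: t sum_negf sum_distrib_left theta_term_def[of d 0] numeral_2_eq_2)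
  moreover have "fls_lim (\<lambda>n. (\<Sum>a<Suc n. theta_term d a) + fls_X powi (1 + d) * (\<Sum>a<n. theta_term (d + 1) a))
      (theta_entry d + fls_X powi (1 + d) * theta_entry (d + 1))"
    by (intro fls_lim_add fls_lim_mult fls_lim_const theta_lim fls_lim_subseq[OF theta_lim] filterlim_Suc)
  ultimately have "fls_lim (\<lambda>n. 1) (theta_entry d + fls_X powi (1 + d) * theta_entry (d + 1))" by simp
  then show ?thesis by (rule fls_lim_unique[OF _ fls_lim_const])
qed

lemma theta_vanish: "0 \<le> d \<Longrightarrow> fls_vanish 0 (theta_entry d)"
proof (rule fls_lim_vanish[OF theta_lim], rule fls_vanish_sum)
  fix a assume "0 \<le> d"
  then have "fls_vanish 0 (fls_X powi (int ((a + 1) choose 2) + d * int a) :: rat fls)"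
    by (intro fls_vanish_powi) simp
  then show "fls_vanish 0 (theta_term d a)"
    unfolding theta_term_def by (cases "even a") (auto intro: fls_vanish_uminus)
qed

text \<open>Both sides satisfy \<open>f D + q\<^sup>1\<^sup>+\<^sup>D f (D + 1) = const\<close>, so their difference \<open>h\<close> satisfies
  \<open>h D = - q\<^sup>1\<^sup>+\<^sup>D h (D + 1)\<close>; for \<open>D \<ge> 0\<close> this forces arbitrarily high order of vanishing.\<close>

theorem meet_sum_theta: "meet_sum D = theta_entry D * inverse Qinf * inverse Qinf"
proof -
  \<comment> \<open>Multiplying by \<open>Qinf\<close> twice normalises the constant in the
    recursion of \<open>meet_sum\<close> to one, as in \<open>theta_rec\<close>.\<close>
  define h where "h D = meet_sum D * Qinf * Qinf - theta_entry D" for D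
  have rec: "h D = - (fls_X powi (1 + D) * h (D + 1))" for D
  proof -
    have "meet_sum D = inverse Qinf * inverse Qinf - fls_X powi (1 + D) * meet_sum (D + 1)"
      using meet_sum_const[of D] by (simp add: algebra_simps)
    moreover have "theta_entry D = 1 - fls_X powi (1 + D) * theta_entry (D + 1)"
      using theta_rec[of D] by (simp add: algebra_simps)
    moreover have "inverse Qinf * Qinf = 1" by (rule left_inverse[OF Qinf_props(1)])
    moreover have "a * Q * Q - b = - (x * (c * Q * Q - d))"
      if "a = i * i - x * c" "b = 1 - x * d" "i * Q = 1" for a b c d i x Q :: "rat fls"
    proof -
      have "a * Q * Q - b = (i * Q) * (i * Q) - x * c * Q * Q - (1 - x * d)"
        unfolding that(1,2) by (simp only: left_diff_distrib right_diff_distrib mult_ac)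
      then show ?thesis unfolding that(3) by (simp only: right_diff_distrib mult.assoc mult_1) simp
    qed
    ultimately show ?thesis unfolding h_def by blast
  qed
  have base: "fls_vanish 0 (h D)" if "0 \<le> D" for D
  proof -
    have Q: "fls_vanish 0 Qinf" using Qinf_props by (simp add: fls_vanish_iff)
    have "fls_vanish (0 + 0 + 0) (meet_sum D * Qinf * Qinf)" by (intro fls_vanish_mult meet_sum_vanish Q)
    then show ?thesis unfolding h_def using theta_vanish[OF that] by (intro fls_vanish_diff) simp_all
  qed
  have "fls_vanish (int K) (h D)" if "0 \<le> D" for K D
    using that
  proof (induction K arbitrary: D)
    case (Suc K)
    have "fls_vanish (1 + int K) (fls_X powi (1 + D) * h (D + 1))"
      using Suc by (intro fls_vanish_mult fls_vanish_powi) auto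
    then show ?case by (subst rec) (auto intro: fls_vanish_uminus)
  qed (simp add: base)
  then have "fls_vanish K (h D)" if "0 \<le> D" for K D
    by (rule fls_vanish_mono[of "int (nat K)"]) (use that in auto)
  then have pos: "h D = 0" if "0 \<le> D" for D using that by (blast intro: fls_vanish_all)
  \<comment> \<open>The recursion expresses \<open>h D\<close> through \<open>h (D + 1)\<close>, so
    vanishing propagates downward to negative arguments.\<close>
  have "h (- int l) = 0" for l
  proof (induction l)
    case (Suc l)
    then show ?case using rec[of "- int (Suc l)"] by simp
  qed (simp add: pos)
  from this[of "nat (- D)"] have "h D = 0" using pos[of D] by (cases "0 \<le> D") simp_all
  then have e: "meet_sum D * Qinf * Qinf = theta_entry D" by (simp only: h_def eq_iff_diff_eq_0[symmetric])
  have Q: "Qinf * inverse Qinf = 1" by (rule right_inverse[OF Qinf_props(1)])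
  have "meet_sum D = meet_sum D * (Qinf * inverse Qinf) * (Qinf * inverse Qinf)" by (simp only: Q mult_1_right)
  also have "\<dots> = meet_sum D * Qinf * Qinf * inverse Qinf * inverse Qinf" by (simp only: mult_ac)
  finally show ?thesis unfolding e .
qed

section \<open>Removing the truncation\<close>

text \<open>Dominated convergence: term \<open>k\<close> has order at least \<open>k\<close>
  uniformly in \<open>L\<close>, so below order \<open>K\<close> only the first \<open>nat K\<close>
  terms matter, whatever the upper limit \<open>c L\<close>.\<close>

lemma fls_lim_dominated_sum:
  assumes g: "\<And>k. fls_lim (\<lambda>L. g L k) (t k)" and g0: "\<And>L k. fls_vanish (int k) (g L k)"
    and t0: "\<And>k. fls_vanish (int k) (t k)"
    and t: "fls_lim (\<lambda>n. \<Sum>k<n. t k) S" and c: "filterlim c at_top sequentially"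
  shows "fls_lim (\<lambda>L. \<Sum>k<c L. g L k) S"
  unfolding fls_lim_def
proof
  fix K :: int
  define R where "R = nat K"
  have tail: "fls_vanish K ((\<Sum>k<b. f k) - (\<Sum>k<R. f k))" if "R \<le> b" "\<And>k. fls_vanish (int k) (f k)"
    for b and f :: "nat \<Rightarrow> 'a fls"
  proof -
    have eq: "{..<b} = {..<R} \<union> {R..<b}" using that(1) by auto
    have "(\<Sum>k<b. f k) = (\<Sum>k<R. f k) + (\<Sum>k\<in>{R..<b}. f k)"
      unfolding eq by (rule sum.union_disjoint) auto
    moreover have "fls_vanish K (\<Sum>k\<in>{R..<b}. f k)"
      by (rule fls_vanish_sum, rule fls_vanish_mono[OF that(2)]) (auto simp: R_def)
    ultimately show ?thesis by simp
  qed
  have "\<forall>\<^sub>F n in sequentially. R \<le> n \<and> fls_vanish K ((\<Sum>k<n. t k) - S)"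
    using t by (intro eventually_conj eventually_ge_at_top) (simp add: fls_lim_def)
  then obtain n where n: "R \<le> n" "fls_vanish K ((\<Sum>k<n. t k) - S)"
    by (auto simp: eventually_sequentially)
  have S: "fls_vanish K ((\<Sum>k<R. t k) - S)"
    using fls_vanish_diff[OF n(2) tail[OF n(1) t0]] by simp
  have "fls_lim (\<lambda>L. \<Sum>k<R. g L k) (\<Sum>k<R. t k)" by (rule fls_lim_sum) (rule g)
  then have "\<forall>\<^sub>F L in sequentially. fls_vanish K ((\<Sum>k<R. g L k) - (\<Sum>k<R. t k))" by (simp add: fls_lim_def)
  moreover have "\<forall>\<^sub>F L in sequentially. R \<le> c L" using c by (simp add: filterlim_at_top)
  ultimately show "\<forall>\<^sub>F L in sequentially. fls_vanish K ((\<Sum>k<c L. g L k) - S)"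
  proof eventually_elim
    case (elim L)
    from fls_vanish_add[OF fls_vanish_add[OF tail[OF elim(2) g0[of _ L]] elim(1)] S] show ?case by simp
  qed
qed

lemma qbin_poch: "qbin fls_X s k = poch (s + k) * inverse (poch s) * inverse (poch k)"
  unfolding qbin_def by (simp only: divide_inverse inverse_mult_distrib mult_ac)

lemma qbin_vanish: "fls_vanish 0 (qbin fls_X s k :: rat fls)"
proof -
  have "fls_vanish (0 + 0 + 0) (qbin fls_X s k :: rat fls)"
    unfolding qbin_poch by (intro fls_vanish_mult) (use poch_props in \<open>simp_all add: fls_vanish_iff\<close>)
  then show ?thesis by simp
qed

lemma qbin_lim_left:
  assumes "filterlim s at_top sequentially"
  shows "fls_lim (\<lambda>L. qbin fls_X (s L) k) (inverse (poch k))"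
proof -
  have "filterlim (\<lambda>L. s L + k) at_top sequentially"
    by (rule filterlim_at_top_mono[OF assms]) simp
  then have "fls_lim (\<lambda>L. qbin fls_X (s L) k) (Qinf * inverse Qinf * inverse (poch k))"
    unfolding qbin_poch
    by (intro fls_lim_mult fls_lim_subseq[OF poch_lim] fls_lim_subseq[OF inverse_poch_lim] fls_lim_const assms)
  moreover have "Qinf * inverse Qinf = 1" by (rule right_inverse[OF Qinf_props(1)])
  ultimately show ?thesis by (simp only: mult_1)
qed

text \<open>The numerator and both denominators tend to \<open>Qinf\<close>, so one inverse factor
  remains.\<close>

lemma qbin_lim:
  assumes "filterlim s at_top sequentially" "filterlim t at_top sequentially"
  shows "fls_lim (\<lambda>L. qbin fls_X (s L) (t L)) (inverse Qinf)"
proof -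
  have "filterlim (\<lambda>L. s L + t L) at_top sequentially"
    by (rule filterlim_at_top_mono[OF assms(1)]) simp
  then have "fls_lim (\<lambda>L. qbin fls_X (s L) (t L)) (Qinf * inverse Qinf * inverse Qinf)"
    unfolding qbin_poch
    by (intro fls_lim_mult fls_lim_subseq[OF poch_lim] fls_lim_subseq[OF inverse_poch_lim] assms)
  moreover have "Qinf * inverse Qinf = 1" by (rule right_inverse[OF Qinf_props(1)])
  ultimately show ?thesis by (simp only: mult_1)
qed

lemma filterlim_nat_shift: "filterlim (\<lambda>L. nat (int L - c)) at_top sequentially"
  unfolding filterlim_at_top eventually_sequentially
proof (intro allI exI impI)
  fix Z L :: nat assume "Z + nat \<bar>c\<bar> \<le> L"
  then show "Z \<le> nat (int L - c)" by linarith
qed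

lemma filterlim_minus_const: "filterlim (\<lambda>L. L - c :: nat) at_top sequentially"
  by (rule filterlim_minus_const_nat_at_top)

text \<open>With \<open>k = x - a\<close> the summand tends to \<open>meet_term (a - b) k\<close>;
  the lower bound \<open>b\<close> on \<open>x\<close> becomes the convention that
  \<open>ipoch\<close> is zero at negative arguments.\<close>

lemma meet_lim:
  fixes a b :: nat
  shows "fls_lim (\<lambda>L. \<Sum>x\<in>{b..<Suc L}. if a \<le> x
     then fls_X ^ (x - a) * (qbin fls_X (L - 1) (x - a) * qbin fls_X (L - 1) (x - b)) else 0)
    (meet_sum (int a - int b))"
proof -
  define g where "g L k = fls_X ^ k * (if b \<le> k + a
    then qbin fls_X (L - 1) k * qbin fls_X (L - 1) (k + a - b) else 0 :: rat fls)" for L k :: nat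
  have "(\<Sum>x\<in>{b..<Suc L}. if a \<le> x
     then fls_X ^ (x - a) * (qbin fls_X (L - 1) (x - a) * qbin fls_X (L - 1) (x - b)) else 0) =
    (\<Sum>k<Suc L - a. g L k)" for L
  proof -
    have "(\<Sum>k<Suc L - a. g L k) = (\<Sum>k\<in>{k. k < Suc L - a \<and> b \<le> k + a}. g L k)"
      by (rule sum.mono_neutral_right) (auto simp: g_def)
    also have "\<dots> = (\<Sum>x\<in>{x \<in> {b..<Suc L}. a \<le> x}.
        fls_X ^ (x - a) * (qbin fls_X (L - 1) (x - a) * qbin fls_X (L - 1) (x - b)))"
      by (rule sum.reindex_bij_witness[where i = "\<lambda>x. x - a" and j = "\<lambda>k. k + a"]) (auto simp: g_def)
    finally show ?thesis by (simp only: sum.inter_filter[OF finite_atLeastLessThan])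
  qed
  moreover have "fls_lim (\<lambda>L. \<Sum>k<Suc L - a. g L k) (meet_sum (int a - int b))"
  proof (rule fls_lim_dominated_sum[OF _ _ meet_term_vanish meet_sum_lim])
    show "filterlim (\<lambda>L. Suc L - a) at_top sequentially"
      by (rule filterlim_at_top_mono[OF filterlim_minus_const[of a]])
        (intro always_eventually allI diff_le_mono, simp)
    fix k
    show "fls_lim (\<lambda>L. g L k) (meet_term (int a - int b) k)"
    proof (cases "b \<le> k + a")
      case True
      then have e: "int k + (int a - int b) = int (k + a - b)" by simp
      have "meet_term (int a - int b) k = fls_X ^ k * (inverse (poch k) * inverse (poch (k + a - b)))"
        unfolding meet_term_def e by (simp add: ipoch_def mult.assoc)
      then show ?thesis unfolding g_def using True
        by (auto intro!: fls_lim_mult fls_lim_const qbin_lim_left filterlim_minus_const simp del: One_nat_def)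
    next
      case False
      then show ?thesis by (simp add: g_def meet_term_def ipoch_def fls_lim_const)
    qed
    fix L
    have "fls_vanish (int k + (0 + 0)) (fls_X ^ k * (qbin fls_X (L - 1) k * qbin fls_X (L - 1) (k + a - b)) :: rat fls)"
      using fls_vanish_powi[of "int k" "int k"] by (intro fls_vanish_mult qbin_vanish) simp
    then show "fls_vanish (int k) (g L k)" by (simp add: g_def)
  qed
  ultimately show ?thesis by simp
qed

section \<open>Signs of block permutations\<close>

lemma fdet_swap_cols:
  "fdet (a + b) R = (-1) ^ (a * b) * fdet (a + b) (\<lambda>i j. R i (if j < a then j + b else j - a))"
proof -
  have "fdet (a + b) R = (-1) ^ (a * b) * Determinant.det (mat (a + b) (a + b)
      (\<lambda>(i, j). mat (a + b) (a + b) (\<lambda>(i, j). R i j) $$ (i, if j < a then j + b else j - a)))"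
    unfolding fdet_def by (rule det_swap_cols) simp
  also have "mat (a + b) (a + b)
      (\<lambda>(i, j). mat (a + b) (a + b) (\<lambda>(i, j). R i j) $$ (i, if j < a then j + b else j - a)) =
      mat (a + b) (a + b) (\<lambda>(i, j). R i (if j < a then j + b else j - a))"
    by (intro eq_matI) auto
  finally show ?thesis by (simp add: fdet_def)
qed

lemma fdet_swap_initial_rows:
  assumes "a + b \<le> K"
  shows "fdet K R = (-1) ^ (a * b) *
    fdet K (\<lambda>i j. R (if i < b then i + a else if i < a + b then i - b else i) j)"
proof -
  have "fdet K R = (-1) ^ (a * b) * Determinant.det (mat K K (\<lambda>(i, j). mat K K (\<lambda>(i, j). R i j) $$
      (if i < b then i + a else if i < a + b then i - b else i, j)))"
    unfolding fdet_def by (rule det_swap_initial_rows[OF _ assms]) simp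
  also have "mat K K (\<lambda>(i, j). mat K K (\<lambda>(i, j). R i j) $$
      (if i < b then i + a else if i < a + b then i - b else i, j)) =
      mat K K (\<lambda>(i, j). R (if i < b then i + a else if i < a + b then i - b else i) j)"
    using assms by (intro eq_matI) auto
  finally show ?thesis by (simp add: fdet_def)
qed

text \<open>With \<open>n = r + a\<close> and \<open>m = r + b\<close> every product occurs twice
  except for \<open>r * r - r\<close>, which is even.\<close>

lemma even_sign_exponent:
  fixes n m r :: nat
  assumes "r \<le> n" "r \<le> m"
  shows "even (n * (m - r) + (n - r) * r + (m * n - r))"
proof -
  obtain a b where ab: "n = r + a" "m = r + b" using assms le_Suc_ex by metis
  define e where "e = r * r - r"
  have "r \<le> r * r" by (cases r) auto
  moreover have "m * n = r * r + (r * a + b * r + b * a)" by (simp add: ab algebra_simps)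
  ultimately have "m * n - r = (r * a + b * r + b * a) + e" by (simp add: e_def)
  moreover have "n * (m - r) = r * b + a * b" "(n - r) * r = a * r" by (simp_all add: ab algebra_simps)
  ultimately have "n * (m - r) + (n - r) * r + (m * n - r) = 2 * (r * b + a * b + a * r) + e" by simp
  moreover have "even e" unfolding e_def by (cases "even r") auto
  ultimately show ?thesis by simp
qed

section \<open>Passage to the limit and comparison with the block matrix\<close>

context pit
begin

abbreviation (input) r :: nat where "r \<equiv> diag_r n m \<Lambda>"

definition particle :: "nat \<Rightarrow> nat" where "particle i = (if i < n then i else i - n + r)"

definition limit_entry :: "nat \<Rightarrow> nat \<Rightarrow> rat fls" where
  "limit_entry i j =
    (if r \<le> i \<and> i < n then (if j < n then fls_X powi (- (int (N j) * (P i + 1))) else 0)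
     else if j < n then theta_entry (int (N j) - int (M (particle i)))
     else fls_X powi (- (int (M (particle i)) * Q (particle j))))"

text \<open>Both truncation parameters are set to the same \<open>L\<close>, so a single limit
  removes them.\<close>

definition approx :: "nat \<Rightarrow> nat \<Rightarrow> nat \<Rightarrow> rat fls" where
  "approx L = truncated_pit.entry n r L L N M P Q"

lemma big: "\<forall>\<^sub>F L in sequentially. big_pit n m \<nu> \<mu> \<Lambda> L L"
proof -
  have "\<forall>\<^sub>F L in sequentially. \<forall>p\<in>{..<n}. P p < int L \<and> N p \<le> L"
  proof (rule eventually_ball_finite)
    show "\<forall>p\<in>{..<n}. \<forall>\<^sub>F L in sequentially. P p < int L \<and> N p \<le> L"
    proof
      fix p
      have "P p < int L \<and> N p \<le> L" if "nat (P p) + N p + 1 \<le> L" for L using that by linarith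
      then show "\<forall>\<^sub>F L in sequentially. P p < int L \<and> N p \<le> L" unfolding eventually_sequentially by blast
    qed
  qed simp
  moreover have "\<forall>\<^sub>F L in sequentially. \<forall>p\<in>{..<m}. Q p < int L \<and> M p \<le> L"
  proof (rule eventually_ball_finite)
    show "\<forall>p\<in>{..<m}. \<forall>\<^sub>F L in sequentially. Q p < int L \<and> M p \<le> L"
    proof
      fix p
      have "Q p < int L \<and> M p \<le> L" if "nat (Q p) + M p + 1 \<le> L" for L using that by linarith
      then show "\<forall>\<^sub>F L in sequentially. Q p < int L \<and> M p \<le> L" unfolding eventually_sequentially by blast
    qed
  qed simp
  moreover have "\<forall>\<^sub>F L in sequentially. 0 < (L :: nat)" by (rule eventually_gt_at_top)
  ultimately show ?thesis
  proof eventually_elim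
    case (elim L)
    then show ?case by (intro big_pit.intro big_pit_axioms.intro pit_axioms) simp_all
  qed
qed

text \<open>A border entry contains one q-binomial and leaves one factor
  \<open>inverse Qinf\<close>, a crossing entry leaves two. Assigning one to each row outside
  \<open>r..<n\<close> and one to each column below \<open>n\<close> fits every block.\<close>

lemma approx_lim:
  assumes "i < n + m - r" "j < n + m - r"
  shows "fls_lim (\<lambda>L. approx L i j)
    ((if r \<le> i \<and> i < n then 1 else inverse Qinf) * (if j < n then inverse Qinf else 1) * limit_entry i j)"
proof -
  define A where "A L = (if r \<le> i \<and> i < n then
       (if j < n then fls_X powi (- (int (N j) * (P i + 1))) * qbin fls_X (nat (int L - P i - 1)) (L - N j) else 0)
     else if j < n then (\<Sum>x\<in>{M (particle i)..<Suc L}. if N j \<le> x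
       then fls_X ^ (x - N j) * (qbin fls_X (L - 1) (x - N j) * qbin fls_X (L - 1) (x - M (particle i))) else 0)
     else fls_X powi (- (int (M (particle i)) * Q (particle j))) *
        qbin fls_X (nat (int L - Q (particle j) - 1)) (L - M (particle i)) :: rat fls)" for L
  have eq: "\<forall>\<^sub>F L in sequentially. A L = approx L i j"
    using big
  proof eventually_elim
    case (elim L)
    interpret b: big_pit n m \<nu> \<mu> \<Lambda> L L by (rule elim)
    show ?case
      by (simp only: A_def approx_def b.tp.entry_def b.tp.meet_def b.tp.particle_of_def particle_def)
  qed
  have lim: "filterlim (\<lambda>L. nat (int L - c - 1)) at_top sequentially" for c
    using filterlim_nat_shift[of "c + 1"] by (simp add: diff_diff_eq)
  note tail = fls_lim_mult[OF fls_lim_const qbin_lim[OF lim filterlim_minus_const]]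
  have "fls_lim A ((if r \<le> i \<and> i < n then 1 else inverse Qinf) * (if j < n then inverse Qinf else 1) * limit_entry i j)"
  proof (cases "r \<le> i \<and> i < n")
    case i: True
    show ?thesis
    proof (cases "j < n")
      case True
      have "A = (\<lambda>L. fls_X powi (- (int (N j) * (P i + 1))) * qbin fls_X (nat (int L - P i - 1)) (L - N j))"
        unfolding A_def using i True by (simp only: if_True simp_thms)
      moreover have "(if r \<le> i \<and> i < n then 1 else inverse Qinf) * (if j < n then inverse Qinf else 1) * limit_entry i j =
          fls_X powi (- (int (N j) * (P i + 1))) * inverse Qinf"
        unfolding limit_entry_def using i True by (simp only: if_True simp_thms mult_1 mult.commute)
      ultimately show ?thesis by (simp only: tail)
    next
      case False
      have "A = (\<lambda>L. 0)" unfolding A_def using i False by (simp only: if_True if_False simp_thms)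
      then show ?thesis using i False by (simp add: limit_entry_def fls_lim_const)
    qed
  next
    case i: False
    show ?thesis
    proof (cases "j < n")
      case True
      have "A = (\<lambda>L. \<Sum>x\<in>{M (particle i)..<Suc L}. if N j \<le> x
          then fls_X ^ (x - N j) * (qbin fls_X (L - 1) (x - N j) * qbin fls_X (L - 1) (x - M (particle i))) else 0)"
        unfolding A_def using i True by (simp only: if_True if_False simp_thms)
      moreover have "(if r \<le> i \<and> i < n then 1 else inverse Qinf) * (if j < n then inverse Qinf else 1) * limit_entry i j =
          meet_sum (int (N j) - int (M (particle i)))"
        unfolding limit_entry_def meet_sum_theta using i True
        by (simp only: if_True if_False simp_thms mult_ac)
      ultimately show ?thesis by (simp only: meet_lim)
    next
      case False
      have "A = (\<lambda>L. fls_X powi (- (int (M (particle i)) * Q (particle j))) *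
          qbin fls_X (nat (int L - Q (particle j) - 1)) (L - M (particle i)))"
        unfolding A_def using i False by (simp only: if_False simp_thms)
      moreover have "(if r \<le> i \<and> i < n then 1 else inverse Qinf) * (if j < n then inverse Qinf else 1) * limit_entry i j =
          fls_X powi (- (int (M (particle i)) * Q (particle j))) * inverse Qinf"
        unfolding limit_entry_def using i False by (simp only: if_False simp_thms mult_1_right mult_1 mult.commute)
      ultimately show ?thesis by (simp only: tail)
    qed
  qed
  then show ?thesis by (rule fls_lim_cong[OF eq])
qed

text \<open>An array of weight below \<open>K\<close> is asymptotic far out and has bounded finite
  entries, so for \<open>L \<ge> L0\<close> it belongs to the truncated set and the coefficients
  below \<open>K\<close> agree exactly.\<close>

lemma trunc_lim:
  "fls_lim (\<lambda>L. \<Sum>a\<in>big_pit.trunc n m \<nu> \<mu> \<Lambda> L L. fls_X ^ nat (weight n m \<mu> \<nu> \<Lambda> a)) (fps_to_fls (chi n m \<mu> \<nu> \<Lambda>))"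
  unfolding fls_lim_def
proof
  fix K :: int
  \<comment> \<open>The summands cover the extent of the infinite region, the largest finite entry
    and the index \<open>p < n + m\<close> added to it in a position.\<close>
  define L0 where "L0 = \<Lambda> 1 + part_length \<Lambda> + \<nu> 1 + \<mu> 1 + nat K + n + m + 1"
  have "\<forall>\<^sub>F L in sequentially. L0 \<le> L" by (rule eventually_ge_at_top)
  with big show "\<forall>\<^sub>F L in sequentially. fls_vanish K
      ((\<Sum>a\<in>big_pit.trunc n m \<nu> \<mu> \<Lambda> L L. fls_X ^ nat (weight n m \<mu> \<nu> \<Lambda> a)) - fps_to_fls (chi n m \<mu> \<nu> \<Lambda>))"
  proof eventually_elim
    case (elim L)
    interpret b: big_pit n m \<nu> \<mu> \<Lambda> L L by (rule elim)
    have L: "\<Lambda> 1 + part_length \<Lambda> + \<nu> 1 + \<mu> 1 + nat K + n + m + 1 \<le> L" using elim by (simp add: L0_def)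
    have in_trunc: "a \<in> b.trunc" if a: "a \<in> arrays n m \<mu> \<nu> \<Lambda>" and w: "weight n m \<mu> \<nu> \<Lambda> a = int k" and k: "k < nat K" for a k
    proof -
      have "a (i, j) = enat (\<nu> i)" if "1 \<le> i" "1 \<le> j" "int L \<le> diag i j" for i j
        by (rule array_row_stable[OF parts lens a w that(1)]) (use that L k in \<open>simp add: diag_def\<close>)
      moreover have "a (i, j) = enat (\<mu> j)" if "1 \<le> i" "1 \<le> j" "diag i j \<le> - int L" for i j
        by (rule array_col_stable[OF parts lens a w that(2)]) (use that L k in \<open>simp add: diag_def\<close>)
      moreover have "positions a d p \<le> L" if l: "live d p" for d p
      proof -
        obtain i j where ij: "cell d p = (i, j)" by force
        note c = live_cell[OF l ij]
        have "a (i, j) \<noteq> \<infinity>" using arrays_step(3)[OF parts lens a c(1,2)] c(3) by simp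
        then have "the_enat (a (i, j)) \<le> \<nu> 1 + \<mu> 1 + k"
          using array_values[OF parts lens a w c(1,2)] by auto
        moreover have "p < n + m" using l by (auto simp: live_def split: if_splits)
        ultimately show ?thesis using L k by (simp add: positions_def ij)
      qed
      ultimately show ?thesis using a by (simp add: b.trunc_def)
    qed
    show ?case
      unfolding fls_vanish_def
    proof (intro allI impI)
      fix k assume k: "k < K"
      have nth: "fls_nth (fls_X ^ e :: rat fls) k = (if k = int e then 1 else 0)" for e
        by (simp add: fls_X_power_conv_shift_1)
      show "fls_nth ((\<Sum>a\<in>b.trunc. fls_X ^ nat (weight n m \<mu> \<nu> \<Lambda> a)) - fps_to_fls (chi n m \<mu> \<nu> \<Lambda>)) k = 0"
      proof (cases "0 \<le> k")
        case True
        have "{a \<in> b.trunc. k = int (nat (weight n m \<mu> \<nu> \<Lambda> a))} =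
            {a \<in> arrays n m \<mu> \<nu> \<Lambda>. weight n m \<mu> \<nu> \<Lambda> a = int (nat k)}"
        proof (intro equalityI subsetI)
          fix a assume "a \<in> {a \<in> b.trunc. k = int (nat (weight n m \<mu> \<nu> \<Lambda> a))}"
          then have "a \<in> arrays n m \<mu> \<nu> \<Lambda>" "k = int (nat (weight n m \<mu> \<nu> \<Lambda> a))" by (auto simp: b.trunc_def)
          then show "a \<in> {a \<in> arrays n m \<mu> \<nu> \<Lambda>. weight n m \<mu> \<nu> \<Lambda> a = int (nat k)}"
            using weight_nonneg[OF parts lens] by simp
        next
          fix a assume "a \<in> {a \<in> arrays n m \<mu> \<nu> \<Lambda>. weight n m \<mu> \<nu> \<Lambda> a = int (nat k)}"
          then show "a \<in> {a \<in> b.trunc. k = int (nat (weight n m \<mu> \<nu> \<Lambda> a))}"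
            using in_trunc[of a "nat k"] True k by simp
        qed
        then show ?thesis using True chi_nth[OF parts lens, of "nat k"] b.finite_trunc
          by (simp add: fls_nth_sum nth sum.If_cases Int_def)
      next
        case False
        then have "fls_nth (\<Sum>a\<in>b.trunc. fls_X ^ nat (weight n m \<mu> \<nu> \<Lambda> a) :: rat fls) k = 0"
          by (auto simp: fls_nth_sum nth intro!: sum.neutral)
        then show ?thesis using False by simp
      qed
    qed
  qed
qed

lemma chi_limit_det:
  "fps_to_fls (chi n m \<mu> \<nu> \<Lambda>) =
    fls_X powi shift * (inverse Qinf ^ (m + n) * fdet (n + m - r) limit_entry)"
proof -
  let ?K = "n + m - r"
  define f where "f i = (if r \<le> i \<and> i < n then 1 else inverse Qinf)" for i
  define g where "g j = (if j < n then inverse Qinf else 1)" for j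
  have "\<forall>\<^sub>F L in sequentially. fls_X powi shift * fdet ?K (approx L) =
      (\<Sum>a\<in>big_pit.trunc n m \<nu> \<mu> \<Lambda> L L. fls_X ^ nat (weight n m \<mu> \<nu> \<Lambda> a))"
    using big
  proof eventually_elim
    case (elim L)
    then show ?case unfolding approx_def by (rule big_pit.sum_trunc[symmetric])
  qed
  moreover have "fls_lim (\<lambda>L. fls_X powi shift * fdet ?K (approx L))
      (fls_X powi shift * fdet ?K (\<lambda>i j. f i * g j * limit_entry i j))"
    unfolding f_def g_def by (intro fls_lim_mult fls_lim_const fls_lim_fdet approx_lim)
  ultimately have "fls_lim (\<lambda>L. \<Sum>a\<in>big_pit.trunc n m \<nu> \<mu> \<Lambda> L L. fls_X ^ nat (weight n m \<mu> \<nu> \<Lambda> a))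
      (fls_X powi shift * fdet ?K (\<lambda>i j. f i * g j * limit_entry i j))"
    by (rule fls_lim_cong)
  then have "fps_to_fls (chi n m \<mu> \<nu> \<Lambda>) = fls_X powi shift * fdet ?K (\<lambda>i j. f i * g j * limit_entry i j)"
    by (rule fls_lim_unique[OF trunc_lim])
  also have "fdet ?K (\<lambda>i j. f i * g j * limit_entry i j) = (\<Prod>i<?K. f i) * (\<Prod>j<?K. g j) * fdet ?K limit_entry"
    by (rule fdet_scale)
  \<comment> \<open>There are \<open>m\<close> rows outside \<open>r..<n\<close> and
    \<open>n\<close> columns below \<open>n\<close>, whence the exponent
    \<open>m + n\<close>.\<close>
  also have "(\<Prod>i<?K. f i) = (\<Prod>i\<in>{..<?K} - {r..<n}. inverse Qinf)"
    unfolding f_def by (rule prod.mono_neutral_cong_right) auto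
  also have "\<dots> = inverse Qinf ^ m"
  proof -
    have "card ({..<?K} - {r..<n}) = m"
      using diag_r_le[of n m \<Lambda>] by (subst card_Diff_subset) auto
    then show ?thesis by (simp only: prod_constant)
  qed
  also have "(\<Prod>j<?K. g j) = (\<Prod>j<n. inverse Qinf)"
    unfolding g_def by (rule prod.mono_neutral_cong_right) (use diag_r_le[of n m \<Lambda>] in auto)
  also have "\<dots> = inverse Qinf ^ n" by (simp only: prod_constant card_lessThan)
  finally show ?thesis by (simp only: power_add mult.assoc)
qed

lemma Delta_shift: "Delta n m \<mu> \<nu> \<Lambda> = shift"
proof -
  have "(\<Sum>j=1..m - r. M_co m \<mu> j * Q_co n m \<Lambda> j) = (\<Sum>p\<in>{r..<m}. int (M p) * Q p)"
    by (rule sum.reindex_bij_witness[where i = "\<lambda>p. m - p" and j = "\<lambda>j. m - j"])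
      (use diag_r_le[of n m \<Lambda>] in \<open>auto simp: M_co_def M_def Q_co_def kappa_part_def Q_def algebra_simps of_nat_diff\<close>)
  moreover have "(\<Sum>i=1..n - r. N_co n \<nu> i * (P_co n m \<Lambda> i + 1)) = (\<Sum>p\<in>{r..<n}. int (N p) * (P p + 1))"
    by (rule sum.reindex_bij_witness[where i = "\<lambda>p. n - p" and j = "\<lambda>j. n - j"])
      (use diag_r_le[of n m \<Lambda>] in \<open>auto simp: N_co_def N_def P_co_def pi_part_def P_def algebra_simps of_nat_diff\<close>)
  ultimately show ?thesis by (simp only: Delta_def shift_def)
qed

lemma block_matrix_index:
  assumes "i < n + m - r" "j < n + m - r"
  shows "block_matrix n m \<mu> \<nu> \<Lambda> $$ (i, j) =
    (if i < m then
       if j < n then theta_entry (int (N (n - Suc j)) - int (M (m - Suc i)))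
       else fls_X powi (- (int (M (m - Suc i)) * Q (m - Suc (j - n))))
     else if j < n then fls_X powi (- (int (N (n - Suc j)) * (P (n - Suc (i - m)) + 1))) else 0)"
proof -
  have co: "N_co n \<nu> (Suc j) = int (N (n - Suc j))" "P_co n m \<Lambda> (Suc j) = P (n - Suc j)" if "j < n" for j
    using that by (auto simp: N_co_def N_def P_co_def pi_part_def P_def of_nat_diff)
  have co': "M_co m \<mu> (Suc i) = int (M (m - Suc i))" "Q_co n m \<Lambda> (Suc i) = Q (m - Suc i)" if "i < m" for i
    using that by (auto simp: M_co_def M_def Q_co_def kappa_part_def Q_def of_nat_diff)
  show ?thesis
    using assms diag_r_le[of n m \<Lambda>] unfolding block_matrix_def Let_def
    by (subst index_mat_four_block) (auto simp: co co')
qed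

text \<open>Backward indexing reverses rows and columns, which costs no sign but puts the birth
  columns and the rows of dead particles in front. Moving the former behind the \<open>n\<close>
  start columns and the latter behind the \<open>r\<close> surviving particles gives the two
  signs.\<close>

lemma det_block_matrix:
  "Determinant.det (block_matrix n m \<mu> \<nu> \<Lambda>) =
    (-1) ^ (n * (m - r)) * ((-1) ^ ((n - r) * r) * fdet (n + m - r) limit_entry)"
proof -
  let ?K = "n + m - r"
  note r = diag_r_le[of n m \<Lambda>]
  define R where "R i j = block_matrix n m \<mu> \<nu> \<Lambda> $$ (i, j)" for i j
  define C where "C i j = R (?K - Suc i) (?K - Suc j)" for i j
  define col where "col j = (if j < n then j + (m - r) else j - n)" for j
  define row where "row i = (if i < r then i + (n - r) else if i < n then i - r else i)" for i
  have K: "?K = n + (m - r)" "(n - r) + r \<le> ?K" "?K = m + (n - r)" using r by auto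
  have "block_matrix n m \<mu> \<nu> \<Lambda> \<in> carrier_mat ?K ?K"
    unfolding block_matrix_def Let_def K(3) using r by (auto intro!: four_block_carrier_mat)
  then have "block_matrix n m \<mu> \<nu> \<Lambda> = mat ?K ?K (\<lambda>(i, j). R i j)" by (intro eq_matI) (auto simp: R_def)
  then have "Determinant.det (block_matrix n m \<mu> \<nu> \<Lambda>) = fdet ?K R" by (simp add: fdet_def)
  also have "fdet ?K R = fdet ?K C" unfolding C_def by (rule fdet_reverse[symmetric])
  also have "\<dots> = (-1) ^ (n * (m - r)) * fdet ?K (\<lambda>i j. C i (col j))"
    unfolding col_def by (rule fdet_swap_cols[of n "m - r" C, folded K(1)])
  also have "fdet ?K (\<lambda>i j. C i (col j)) = (-1) ^ ((n - r) * r) * fdet ?K (\<lambda>i j. C (row i) (col j))"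
    using fdet_swap_initial_rows[OF K(2), of "\<lambda>i j. C i (col j)"] by (simp only: row_def le_add_diff_inverse2[OF r(1)])
  also have "fdet ?K (\<lambda>i j. C (row i) (col j)) = fdet ?K limit_entry"
  proof (rule fdet_cong)
    fix i j assume ij: "i < ?K" "j < ?K"
    define i' where "i' = ?K - Suc (row i)"
    define j' where "j' = ?K - Suc (col j)"
    have j1: "j' < n \<and> n - Suc j' = j" if "j < n" using that r by (auto simp: j'_def col_def)
    have j2: "\<not> j' < n \<and> m - Suc (j' - n) = particle j" if "\<not> j < n"
      using that r ij by (auto simp: j'_def col_def particle_def)
    have i1: "\<not> i' < m \<and> n - Suc (i' - m) = i" if "r \<le> i" "i < n"
      using that r by (auto simp: i'_def row_def)
    have i2: "i' < m \<and> m - Suc i' = particle i" if "\<not> (r \<le> i \<and> i < n)"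
      using that r ij by (auto simp: i'_def row_def particle_def)
    have "i' < ?K" "j' < ?K" using ij by (auto simp: i'_def j'_def)
    note B = block_matrix_index[OF this]
    have "C (row i) (col j) = block_matrix n m \<mu> \<nu> \<Lambda> $$ (i', j')" by (simp add: C_def R_def i'_def j'_def)
    also have "\<dots> = limit_entry i j"
      unfolding B limit_entry_def using i1 i2 j1 j2 by (cases "r \<le> i \<and> i < n"; cases "j < n") auto
    finally show "C (row i) (col j) = limit_entry i j" .
  qed
  finally show ?thesis by (simp only: mult.assoc)
qed

end

theorem theorem1:
  fixes n m :: nat and \<nu> \<mu> \<Lambda> :: "nat \<Rightarrow> nat"
  assumes "is_partition \<nu>" and "is_partition \<mu>" and "is_partition \<Lambda>"
    and "part_length \<nu> \<le> n" and "part_length \<mu> \<le> m"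
    and "\<Lambda> (n + 1) < m + 1"
  shows "fps_to_fls (chi n m \<mu> \<nu> \<Lambda>) =
    (-1) ^ (m * n - diag_r n m \<Lambda>) * fls_X powi Delta n m \<mu> \<nu> \<Lambda>
      / fps_to_fls q_inf ^ (m + n)
      * Determinant.det (block_matrix n m \<mu> \<nu> \<Lambda>)"
proof -
  interpret pit n m \<nu> \<mu> \<Lambda> by unfold_locales (rule assms)+
  let ?r = "diag_r n m \<Lambda>"
  \<comment> \<open>By parity the two rearrangement signs together equal the sign in the
    formula.\<close>
  have "(-1 :: rat fls) ^ (m * n - ?r) * ((-1) ^ (n * (m - ?r)) * (-1) ^ ((n - ?r) * ?r)) = 1"
    using even_sign_exponent[OF diag_r_le, of n m \<Lambda>] by (simp only: power_add[symmetric] add_ac power_minus1_even neg_one_even_power)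
  then have "fdet (n + m - ?r) limit_entry = (-1) ^ (m * n - ?r) * Determinant.det (block_matrix n m \<mu> \<nu> \<Lambda>)"
    unfolding det_block_matrix by (simp only: mult.assoc[symmetric] mult_1)
  then show ?thesis
    unfolding chi_limit_det Delta_shift by (simp only: divide_inverse power_inverse mult_ac)
qed

end
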